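(* Let $l>0$, $a_1,a_2,b_1,b_2>0$, $c_1,c_2\ge 0$, $p_1\ge 0$, $p_2\le 0$, $q_1\le 0$, $q_2\ge 0$ be constants. For any $d_1,d_2\in C^1(\mathbb{R}_{\ge 0};L^2(0,l))$ and $d_3,d_4\in C^2(\mathbb{R}_{\ge 0};\mathbb{R})$, and for any given $X_0\in D(\mathcal{A}_{1,d})$ such that $\mathcal{B}X_0=(d_3(0),d_4(0))$, the abstract problem $$\dot X(t)=[\mathcal{A}_{1,d}+\mathcal{A}_2]X(t)+(0,d_1(\cdot,t),0,d_2(\cdot,t)),\qquad \mathcal{B}X(t)=(d_3(t),d_4(t)),\qquad t\ge 0,\qquad X(0)=X_0,$$ admits a unique solution $X\in C^0(\mathbb{R}_{\ge 0};D(\mathcal{A}_{1,d}))\cap C^1(\mathbb{R}_{\ge 0};\mathcal{H})$.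
   Context: Notation: $\mathbb{R}_{\ge 0}=[0,\infty)$; the subscript $y$ denotes the derivative in $y\in(0,l)$; $\mathrm{AC}[0,l]$ is the set of absolutely continuous functions on $[0,l]$. $\mathcal{H}$ is the Hilbert space $\{(f,g,h,z)\in H^2(0,l)\times L^2(0,l)\times H^1(0,l)\times L^2(0,l): f(0)=f_y(0)=h(0)=0,\ f,f_y,h\in\mathrm{AC}[0,l]\}$ with inner product $\langle(f_1,g_1,h_1,z_1),(f_2,g_2,h_2,z_2)\rangle_{\mathcal H}=\int_0^l(a_1f_{1yy}f_{2yy}+g_1g_2+a_2h_{1y}h_{2y}+z_1z_2)\,dy$. $D(\mathcal{A}_{1,d})$ is the set of $(f,g,h,z)\in\mathcal{H}$ such that $g\in H^2(0,l)$, $z\in H^1(0,l)$, $a_1f_{yy}+b_1g_{yy}\in H^2(0,l)$, $a_2h_y+b_2z_y\in H^1(0,l)$, $f(0)=f_y(0)=g(0)=g_y(0)=h(0)=z(0)=0$, $(a_1f_{yy}+b_1g_{yy})(l)=0$, and $f,f_y,g,g_y,h,z,\ a_1f_{yy}+b_1g_{yy},\ (a_1f_{yy}+b_1g_{yy})_y,\ a_2h_y+b_2z_y\in\mathrm{AC}[0,l]$. It carries the graph norm of $\mathcal{A}_{1,d}$. Operators: $\mathcal{A}_{1,d}:D(\mathcal{A}_{1,d})\subset\mathcal{H}\to\mathcal{H}$, $\mathcal{A}_{1,d}(f,g,h,z)=\big(g,-(a_1f_{yy}+b_1g_{yy})_{yy},z,(a_2h_y+b_2z_y)_y\big)$; $\mathcal{A}_2:\mathcal{H}\to\mathcal{H}$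 bounded, $\mathcal{A}_2(f,g,h,z)=(0,c_1h+p_1z+q_1g,0,c_2h+p_2z+q_2g)$; boundary operator $\mathcal{B}:D(\mathcal{A}_{1,d})\to\mathbb{R}^2$, $\mathcal{B}(f,g,h,z)=\big((a_1f_{yy}+b_1g_{yy})_y(l),(a_2h_y+b_2z_y)(l)\big)$. (This is the abstract form, with $X=(w,w_t,\phi,\phi_t)$, of the coupled beam-string system $w_{tt}+(a_1w_{yy}+b_1w_{tyy})_{yy}=c_1\phi+p_1\phi_t+q_1w_t+d_1$, $\phi_{tt}-(a_2\phi_y+b_2\phi_{ty})_y=c_2\phi+p_2\phi_t+q_2w_t+d_2$ with boundary disturbances $d_3,d_4$ at $y=l$.) *)

theory Defs
  imports "HOL-Analysis.Analysis" "HOL-Library.Function_Algebras"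
begin

instantiation "fun" :: (type, real_vector) real_vector
begin

definition scaleR_fun_def: "r *\<^sub>R f = (\<lambda>x. r *\<^sub>R f x)"

instance
  by standard (simp_all add: scaleR_fun_def fun_eq_iff algebra_simps)

end

section \<open>Function spaces on an interval\<close>

text \<open>
  Elements of \<open>L\<^sup>2(0,l)\<close> are represented by functions on the real line, of which only the values
  on \<open>(0,l)\<close> up to null sets matter. An absolutely continuous element is determined pointwise
  on \<open>[0,l]\<close>.
\<close>

definition L2 :: "real \<Rightarrow> (real \<Rightarrow> real) set" where
  "L2 l = {u. u \<in> borel_measurable (lebesgue_on {0<..<l}) \<and>
              integrable (lebesgue_on {0<..<l}) (\<lambda>y. (u y)\<^sup>2)}"

definition L2_norm :: "real \<Rightarrow> (real \<Rightarrow> real) \<Rightarrow> real" where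
  "L2_norm l u = sqrt (\<integral>y. (u y)\<^sup>2 \<partial>lebesgue_on {0<..<l})"

definition ae_eq :: "real \<Rightarrow> (real \<Rightarrow> real) \<Rightarrow> (real \<Rightarrow> real) \<Rightarrow> bool" where
  "ae_eq l u v \<longleftrightarrow> (AE y in lebesgue_on {0<..<l}. u y = v y)"

definition AC :: "real \<Rightarrow> (real \<Rightarrow> real) set" where
  "AC l = {u. \<forall>e>0. \<exists>d>0. \<forall>(n::nat) a b.
       (\<forall>i<n. 0 \<le> a i \<and> a i \<le> b i \<and> b i \<le> l) \<longrightarrow>
       disjoint_family_on (\<lambda>i. {a i<..<b i}) {..<n} \<longrightarrow>
       (\<Sum>i<n. b i - a i) < d \<longrightarrow>
       (\<Sum>i<n. \<bar>u (b i) - u (a i)\<bar>) < e}"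

definition test_functions :: "real \<Rightarrow> (real \<Rightarrow> real) set" where
  "test_functions l = {\<phi>. (\<forall>n y. (deriv ^^ n) \<phi> field_differentiable at y) \<and>
       (\<exists>a b. 0 < a \<and> b < l \<and> (\<forall>y. y \<notin> {a..b} \<longrightarrow> \<phi> y = 0))}"

definition L1_loc :: "real \<Rightarrow> (real \<Rightarrow> real) set" where
  "L1_loc l = {u. \<forall>a b. 0 < a \<longrightarrow> b < l \<longrightarrow> u absolutely_integrable_on {a..b}}"

definition has_weak_deriv :: "real \<Rightarrow> (real \<Rightarrow> real) \<Rightarrow> (real \<Rightarrow> real) \<Rightarrow> bool" where
  "has_weak_deriv l u v \<longleftrightarrow> u \<in> L1_loc l \<and> v \<in> L1_loc l \<and>
     (\<forall>\<phi>\<in>test_functions l.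
        (\<integral>y. u y * deriv \<phi> y \<partial>lebesgue_on {0<..<l}) = - (\<integral>y. v y * \<phi> y \<partial>lebesgue_on {0<..<l}))"

text \<open>The Sobolev spaces \<open>H\<^sup>k(0,l)\<close>.\<close>

primrec Sobolev :: "real \<Rightarrow> nat \<Rightarrow> (real \<Rightarrow> real) set" where
  "Sobolev l 0 = L2 l"
| "Sobolev l (Suc k) = {u \<in> L2 l. \<exists>v \<in> Sobolev l k. has_weak_deriv l u v}"

text \<open>
  The absolutely continuous representative of a class, if there is one. With it,
  \<open>ac_rep l u \<in> AC l\<close> says that the class of \<open>u\<close> belongs to \<open>AC[0,l]\<close>, and the values
  of \<open>ac_rep l u\<close> at \<open>0\<close> and \<open>l\<close> are the boundary values of that class.
\<close>

definition ac_rep :: "real \<Rightarrow> (real \<Rightarrow> real) \<Rightarrow> (real \<Rightarrow> real)" where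
  "ac_rep l u = (if \<exists>v\<in>AC l. ae_eq l v u then SOME v. v \<in> AC l \<and> ae_eq l v u else u)"

text \<open>The derivative \<open>u\<^sub>y\<close>, by its absolutely continuous representative where possible.\<close>

definition wd :: "real \<Rightarrow> (real \<Rightarrow> real) \<Rightarrow> (real \<Rightarrow> real)" where
  "wd l u = ac_rep l (SOME v. has_weak_deriv l u v)"

section \<open>The state space and the operators\<close>

type_synonym state = "(real \<Rightarrow> real) \<times> (real \<Rightarrow> real) \<times> (real \<Rightarrow> real) \<times> (real \<Rightarrow> real)"

definition H_space :: "real \<Rightarrow> state set" where
  "H_space l = {(f, g, h, z).
     f \<in> Sobolev l 2 \<and> g \<in> L2 l \<and> h \<in> Sobolev l 1 \<and> z \<in> L2 l \<and>
     f \<in> AC l \<and> wd l f \<in> AC l \<and> h \<in> AC l \<and>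
     f 0 = 0 \<and> wd l f 0 = 0 \<and> h 0 = 0}"

definition H_inner :: "real \<Rightarrow> real \<Rightarrow> real \<Rightarrow> state \<Rightarrow> state \<Rightarrow> real" where
  "H_inner l a1 a2 = (\<lambda>(f1, g1, h1, z1) (f2, g2, h2, z2).
     (\<integral>y. (a1 * wd l (wd l f1) y * wd l (wd l f2) y + g1 y * g2 y
            + a2 * wd l h1 y * wd l h2 y + z1 y * z2 y) \<partial>lebesgue_on {0<..<l}))"

definition H_norm :: "real \<Rightarrow> real \<Rightarrow> real \<Rightarrow> state \<Rightarrow> real" where
  "H_norm l a1 a2 X = sqrt (H_inner l a1 a2 X X)"

definition H_eq :: "real \<Rightarrow> state \<Rightarrow> state \<Rightarrow> bool" where
  "H_eq l = (\<lambda>(f1, g1, h1, z1) (f2, g2, h2, z2).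
     ae_eq l f1 f2 \<and> ae_eq l g1 g2 \<and> ae_eq l h1 h2 \<and> ae_eq l z1 z2)"

text \<open>The classes \<open>a\<^sub>1 f\<^sub>y\<^sub>y + b\<^sub>1 g\<^sub>y\<^sub>y\<close> and \<open>a\<^sub>2 h\<^sub>y + b\<^sub>2 z\<^sub>y\<close>.\<close>

definition moment :: "real \<Rightarrow> real \<Rightarrow> real \<Rightarrow> (real \<Rightarrow> real) \<Rightarrow> (real \<Rightarrow> real) \<Rightarrow> (real \<Rightarrow> real)" where
  "moment l a1 b1 f g = ac_rep l (\<lambda>y. a1 * wd l (wd l f) y + b1 * wd l (wd l g) y)"

definition stress :: "real \<Rightarrow> real \<Rightarrow> real \<Rightarrow> (real \<Rightarrow> real) \<Rightarrow> (real \<Rightarrow> real) \<Rightarrow> (real \<Rightarrow> real)" where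
  "stress l a2 b2 h z = ac_rep l (\<lambda>y. a2 * wd l h y + b2 * wd l z y)"

definition dom_A1 :: "real \<Rightarrow> real \<Rightarrow> real \<Rightarrow> real \<Rightarrow> real \<Rightarrow> state set" where
  "dom_A1 l a1 a2 b1 b2 = {(f, g, h, z). (f, g, h, z) \<in> H_space l \<and>
     g \<in> Sobolev l 2 \<and> z \<in> Sobolev l 1 \<and>
     moment l a1 b1 f g \<in> Sobolev l 2 \<and> stress l a2 b2 h z \<in> Sobolev l 1 \<and>
     f \<in> AC l \<and> wd l f \<in> AC l \<and> g \<in> AC l \<and> wd l g \<in> AC l \<and> h \<in> AC l \<and> z \<in> AC l \<and>
     moment l a1 b1 f g \<in> AC l \<and> wd l (moment l a1 b1 f g) \<in> AC l \<and> stress l a2 b2 h z \<in> AC l \<and>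
     f 0 = 0 \<and> wd l f 0 = 0 \<and> g 0 = 0 \<and> wd l g 0 = 0 \<and> h 0 = 0 \<and> z 0 = 0 \<and>
     moment l a1 b1 f g l = 0}"

definition op_A1 :: "real \<Rightarrow> real \<Rightarrow> real \<Rightarrow> real \<Rightarrow> real \<Rightarrow> state \<Rightarrow> state" where
  "op_A1 l a1 a2 b1 b2 = (\<lambda>(f, g, h, z).
     (g, - wd l (wd l (moment l a1 b1 f g)), z, wd l (stress l a2 b2 h z)))"

definition op_A2 :: "real \<Rightarrow> real \<Rightarrow> real \<Rightarrow> real \<Rightarrow> real \<Rightarrow> real \<Rightarrow> state \<Rightarrow> state" where
  "op_A2 c1 c2 p1 p2 q1 q2 = (\<lambda>(f, g, h, z).
     (0, c1 *\<^sub>R h + p1 *\<^sub>R z + q1 *\<^sub>R g, 0, c2 *\<^sub>R h + p2 *\<^sub>R z + q2 *\<^sub>R g))"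

definition op_B :: "real \<Rightarrow> real \<Rightarrow> real \<Rightarrow> real \<Rightarrow> real \<Rightarrow> state \<Rightarrow> real \<times> real" where
  "op_B l a1 a2 b1 b2 = (\<lambda>(f, g, h, z).
     (wd l (moment l a1 b1 f g) l, stress l a2 b2 h z l))"

definition graph_norm :: "real \<Rightarrow> real \<Rightarrow> real \<Rightarrow> real \<Rightarrow> real \<Rightarrow> state \<Rightarrow> real" where
  "graph_norm l a1 a2 b1 b2 X = H_norm l a1 a2 X + H_norm l a1 a2 (op_A1 l a1 a2 b1 b2 X)"

section \<open>Time regularity\<close>

text \<open>
  Since states are represented by functions, the norms above are seminorms on a space of
  representatives. Continuity and differentiability on \<open>[0,\<infinity>)\<close> (one-sided at \<open>0\<close>) of curves
  with values in a set \<open>S\<close> are taken with respect to such a seminorm \<open>N\<close>.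
\<close>

definition has_time_deriv ::
    "('a::real_vector \<Rightarrow> real) \<Rightarrow> (real \<Rightarrow> 'a) \<Rightarrow> 'a \<Rightarrow> real \<Rightarrow> bool" where
  "has_time_deriv N X D t \<longleftrightarrow>
     ((\<lambda>s. N ((1 / (s - t)) *\<^sub>R (X s - X t) - D)) \<longlongrightarrow> 0) (at t within {0..})"

definition C0_time :: "'a::real_vector set \<Rightarrow> ('a \<Rightarrow> real) \<Rightarrow> (real \<Rightarrow> 'a) set" where
  "C0_time S N = {X. \<forall>t\<ge>0. X t \<in> S \<and> ((\<lambda>s. N (X s - X t)) \<longlongrightarrow> 0) (at t within {0..})}"

definition C1_time :: "'a::real_vector set \<Rightarrow> ('a \<Rightarrow> real) \<Rightarrow> (real \<Rightarrow> 'a) set" where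
  "C1_time S N = {X \<in> C0_time S N. \<exists>X' \<in> C0_time S N. \<forall>t\<ge>0. has_time_deriv N X (X' t) t}"

definition C2_real :: "(real \<Rightarrow> real) set" where
  "C2_real = {d. \<exists>d' d''. continuous_on {0..} d'' \<and>
     (\<forall>t\<ge>0. (d has_real_derivative d' t) (at t within {0..}) \<and>
            (d' has_real_derivative d'' t) (at t within {0..}))}"

definition is_solution ::
    "real \<Rightarrow> real \<Rightarrow> real \<Rightarrow> real \<Rightarrow> real \<Rightarrow> real \<Rightarrow> real \<Rightarrow> real \<Rightarrow> real \<Rightarrow> real \<Rightarrow> real \<Rightarrow>
     (real \<Rightarrow> real \<Rightarrow> real) \<Rightarrow> (real \<Rightarrow> real \<Rightarrow> real) \<Rightarrow> (real \<Rightarrow> real) \<Rightarrow> (real \<Rightarrow> real) \<Rightarrow>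
     state \<Rightarrow> (real \<Rightarrow> state) \<Rightarrow> bool" where
  "is_solution l a1 a2 b1 b2 c1 c2 p1 p2 q1 q2 d1 d2 d3 d4 X0 X \<longleftrightarrow>
     X \<in> C0_time (dom_A1 l a1 a2 b1 b2) (graph_norm l a1 a2 b1 b2) \<and>
     X \<in> C1_time (H_space l) (H_norm l a1 a2) \<and>
     (\<forall>t\<ge>0. has_time_deriv (H_norm l a1 a2) X
        (op_A1 l a1 a2 b1 b2 (X t) + op_A2 c1 c2 p1 p2 q1 q2 (X t) + (0, d1 t, 0, d2 t)) t) \<and>
     (\<forall>t\<ge>0. op_B l a1 a2 b1 b2 (X t) = (d3 t, d4 t)) \<and>
     H_eq l (X 0) X0"

end

theory Submission
  imports Defs
begin

text \<open>
  The energy variables \<open>U = (\<surd>a\<^sub>1 f\<^sub>y\<^sub>y, g, \<surd>a\<^sub>2 h\<^sub>y, z)\<close> identify the state space with a product of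
  four copies of \<open>L\<^sup>2\<close>. There the generator with homogeneous boundary conditions is \<open>- K\<inverse>\<close>, where
  \<open>K\<close> is an explicit bounded operator built from \<open>I u = \<integral>\<^sub>0\<^sup>y u\<close> and its adjoint \<open>J u = \<integral>\<^sub>y\<^sup>l u\<close>;
  it is injective and accretive, \<open>\<langle>K v, v\<rangle> \<ge> 0\<close>, because the terms containing \<open>I\<close> and \<open>J\<close> cancel.
  A curve of states solves the boundary value problem iff \<open>U = K v + E\<close>, where \<open>E\<close> is an explicit
  lifting of \<open>(d\<^sub>3, d\<^sub>4)\<close> and \<open>U\<acute> = - v + P U + (0, d\<^sub>1, 0, d\<^sub>2)\<close> with \<open>P\<close> bounded.
  Such equations are solved with the Yosida approximations \<open>(K + \<epsilon>)\<inverse>\<close> of \<open>K\<inverse>\<close>: the approximate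
  solutions and their time derivatives converge locally uniformly, first for smooth data by Komura's
  estimate and then for all data by density. Uniqueness is the energy estimate.
\<close>

section \<open>Evolution equations with accretive resolvent in a Hilbert space\<close>

text \<open>In the domain only the sum
  \<open>a\<^sub>1 f\<^sub>y\<^sub>y + b\<^sub>1 g\<^sub>y\<^sub>y\<close> has two further
  derivatives, not its summands, so the domain does not split into conditions on single components.
  The inverse avoids this: four L^2 functions can be prescribed freely, and integrating them under
  the boundary conditions yields the state. Hence only the bounded operator \<open>K\<close> is
  handled, and the domain appears as its range. The lifting \<open>E\<close> encodes the stationary
  states with given boundary values: the generator annihilates them. For the remainder
  \<open>u = U - E\<close> the forcing becomes \<open>(0, d1, 0, d2) + P E - E'\<close>, and a
  classical solution asks for a C^1 forcing; the term \<open>E'\<close> is what consumes the second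
  derivatives of \<open>d3\<close> and \<open>d4\<close>. The compatibility condition at time 0 puts
  \<open>u 0\<close> in the range of \<open>K\<close>. Two obstacles are formal. Derivatives and
  representatives are chosen by \<open>SOME\<close>, so membership in the domain is translated into
  a choice-free relation between functions and their primitives. A type cannot depend on
  \<open>l\<close>, so the Hilbert space lives on the whole line and the projection
  \<open>cut\<close> removes what lies off (0,l).\<close>

lemma Lax_Milgram:
  fixes B :: "'a::{real_inner,banach} \<Rightarrow> 'a"
  assumes B: "bounded_linear B" and c: "c > 0" and coercive: "\<And>x. c * (norm x)\<^sup>2 \<le> B x \<bullet> x"
  shows "\<exists>C. bounded_linear C \<and> (\<forall>x. B (C x) = x) \<and> (\<forall>x. C (B x) = x)"
proof -
  interpret B: bounded_linear B by fact
  obtain L where L: "\<And>x. norm (B x) \<le> norm x * L" and Lpos: "L > 0"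
    using B.pos_bounded by blast
  have lower: "c * norm x \<le> norm (B x)" for x
  proof (cases "x = 0")
    case False
    have "c * norm x * norm x \<le> B x \<bullet> x"
      using coercive[of x] by (simp add: power2_eq_square mult.assoc)
    also have "\<dots> \<le> norm (B x) * norm x" by (rule norm_cauchy_schwarz)
    finally show ?thesis using False by simp
  qed (use c in auto)
  have inj: "x = y" if "B x = B y" for x y
    using lower[of "x - y"] that c by (simp add: B.diff mult_le_0_iff)
  \<comment> \<open>The maximum keeps \<open>1 - c\<^sup>2 / M\<^sup>2\<close> non-negative; its
    root is the contraction factor \<open>q\<close>.\<close>
  define M where "M = max L c"
  have M: "M > 0" "M \<ge> c" "norm (B x) \<le> M * norm x" for x
    using c Lpos L[of x] unfolding M_def
    by (auto intro: order_trans[OF L] simp: mult.commute[of _ "norm x"] mult_left_mono)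
  \<comment> \<open>This choice minimises
    \<open>1 - 2 * \<tau> * c + \<tau>\<^sup>2 * M\<^sup>2\<close>, the bound for the squared
    Lipschitz constant of \<open>x - \<tau> *\<^sub>R (B x - y)\<close>, whose fixed point solves
    \<open>B x = y\<close>.\<close>
  define \<tau> where "\<tau> = c / M\<^sup>2"
  define q where "q = sqrt (1 - c\<^sup>2 / M\<^sup>2)"
  have cM: "c\<^sup>2 / M\<^sup>2 \<le> 1" "c\<^sup>2 / M\<^sup>2 > 0"
    using M c by (auto simp: power_mono)
  have q: "0 \<le> q" "q < 1" using cM by (auto simp: q_def real_less_lsqrt)
  have step: "norm (x - \<tau> *\<^sub>R B x) \<le> q * norm x" for x
  proof -
    have "(norm (x - \<tau> *\<^sub>R B x))\<^sup>2 = (norm x)\<^sup>2 - 2 * \<tau> * (B x \<bullet> x) + \<tau>\<^sup>2 * (norm (B x))\<^sup>2"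
      unfolding power2_norm_eq_inner
      by (simp add: inner_diff_left inner_diff_right inner_commute power2_eq_square algebra_simps)
    also have "\<dots> \<le> (norm x)\<^sup>2 - 2 * \<tau> * (c * (norm x)\<^sup>2) + \<tau>\<^sup>2 * (M * norm x)\<^sup>2"
    proof -
      have "\<tau> \<ge> 0" using c by (simp add: \<tau>_def)
      moreover have "(norm (B x))\<^sup>2 \<le> (M * norm x)\<^sup>2" using M(3)[of x] by (simp add: power_mono)
      ultimately show ?thesis using coercive[of x]
        by (intro add_mono diff_mono mult_left_mono) auto
    qed
    also have "\<dots> = (1 - c\<^sup>2 / M\<^sup>2) * (norm x)\<^sup>2"
      using M(1) by (simp add: \<tau>_def field_simps power2_eq_square)
    also have "\<dots> = (q * norm x)\<^sup>2" using cM by (simp add: q_def power_mult_distrib)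
    finally show ?thesis using q by (meson mult_nonneg_nonneg norm_ge_zero power2_le_imp_le)
  qed
  have "\<exists>x. B x = y" for y
  proof -
    define f where "f = (\<lambda>x. x - \<tau> *\<^sub>R (B x - y))"
    have "\<exists>!x. f x = x"
    proof (rule banach_fix_type[OF q])
      show "\<forall>x z. dist (f x) (f z) \<le> q * dist x z"
      proof (intro allI)
        fix x z
        have "f x - f z = (x - z) - \<tau> *\<^sub>R B (x - z)"
          by (simp add: f_def B.diff algebra_simps)
        then show "dist (f x) (f z) \<le> q * dist x z"
          using step[of "x - z"] by (simp add: dist_norm)
      qed
    qed
    then obtain x where "f x = x" by auto
    then have "\<tau> *\<^sub>R (B x - y) = 0" by (simp add: f_def)
    moreover have "\<tau> \<noteq> 0" using c M(1) by (simp add: \<tau>_def)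
    ultimately show ?thesis by auto
  qed
  then obtain C where C: "\<And>y. B (C y) = y" by metis
  have "bounded_linear C"
  proof (rule bounded_linear_intro[where K = "1 / c"])
    show "C (x + y) = C x + C y" for x y by (rule inj) (simp add: C B.add)
    show "C (r *\<^sub>R x) = r *\<^sub>R C x" for r x by (rule inj) (simp add: C B.scaleR)
    show "norm (C x) \<le> norm x * (1 / c)" for x
      using lower[of "C x"] c by (simp add: C field_simps)
  qed
  then show ?thesis using C inj by metis
qed

section \<open>Calculus and linear differential equations on the closed half-line\<close>

lemma at_within_atLeastAtMost: "t \<ge> 0 \<Longrightarrow> at t within {0..t + 1} = at t within {0::real..}"
  by (rule at_within_nhd[of _ "{..<t + 1}"]) auto

lemma continuous_on_atLeastI:
  assumes "\<And>T. T \<ge> 0 \<Longrightarrow> continuous_on {0..T} u"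
  shows "continuous_on {0::real..} u"
  unfolding continuous_on_eq_continuous_within
proof
  fix t :: real assume t: "t \<in> {0..}"
  then have "continuous (at t within {0..t + 1}) u"
    using assms[of "t + 1"] by (simp add: continuous_on_eq_continuous_within)
  then show "continuous (at t within {0..}) u" using at_within_atLeastAtMost[of t] t by simp
qed

lemma integral_has_vector_derivative_atLeast:
  fixes g :: "real \<Rightarrow> 'a::banach"
  assumes "continuous_on {0..} g" "t \<ge> 0"
  shows "((\<lambda>t. integral {0..t} g) has_vector_derivative g t) (at t within {0..})"
proof -
  have "((\<lambda>t. integral {0..t} g) has_vector_derivative g t) (at t within {0..t + 1})"
    by (rule integral_has_vector_derivative)
      (use assms in \<open>auto intro: continuous_on_subset\<close>)
  then show ?thesis using at_within_atLeastAtMost assms(2) by simp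
qed

lemma has_vector_derivative_atLeast_imp_integral:
  fixes u :: "real \<Rightarrow> 'a::banach"
  assumes "\<And>t. t \<ge> 0 \<Longrightarrow> (u has_vector_derivative D t) (at t within {0..})" "t \<ge> 0"
  shows "u t = u 0 + integral {0..t} D"
proof -
  have "(D has_integral (u t - u 0)) {0..t}"
    by (rule fundamental_theorem_of_calculus)
      (use assms in \<open>auto intro!: has_vector_derivative_within_subset[OF assms(1)]\<close>)
  then show ?thesis by (simp add: integral_unique)
qed

lemma continuous_on_atLeast_if_derivative:
  assumes "\<And>t. t \<ge> 0 \<Longrightarrow> (u has_vector_derivative D t) (at t within {0::real..})"
  shows "continuous_on {0..} u"
  unfolding continuous_on_eq_continuous_within
proof
  fix t :: real assume "t \<in> {0..}"
  then show "continuous (at t within {0..}) u"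
    using has_vector_derivative_continuous[OF assms[of t]] by simp
qed

text \<open>Picard iteration. By linearity one Lipschitz constant serves all times, so the solution
  is global.\<close>

lemma linear_ode_exists:
  fixes B :: "'a::banach \<Rightarrow> 'a"
  assumes B: "bounded_linear B" and F: "continuous_on {0..} F"
  shows "\<exists>u. u 0 = x0 \<and> (\<forall>t\<ge>0. (u has_vector_derivative B (u t) + F t) (at t within {0..}))"
proof -
  interpret B: bounded_linear B by fact
  obtain L where L: "\<And>x. norm (B x) \<le> norm x * L" and Lpos: "L > 0"
    using B.pos_bounded by blast
  define p where "p = rec_nat (\<lambda>t::real. 0) (\<lambda>n v t. x0 + integral {0..t} (\<lambda>s. B (v s) + F s))"
  have p0: "p 0 = (\<lambda>t. 0)" and pS: "p (Suc n) t = x0 + integral {0..t} (\<lambda>s. B (p n s) + F s)" for n t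
    by (simp_all add: p_def)
  have cont: "continuous_on {0..} (p n)" for n
  proof (induction n)
    case (Suc n)
    have "continuous_on {0..} (\<lambda>s. B (p n s) + F s)"
      by (intro continuous_intros F B.continuous_on Suc)
    from continuous_on_atLeast_if_derivative[OF integral_has_vector_derivative_atLeast[OF this]]
    have "continuous_on {0..} (\<lambda>t. integral {0..t} (\<lambda>s. B (p n s) + F s))" by simp
    then show ?case unfolding pS[abs_def] by (intro continuous_intros)
  qed (simp add: p0)
  have integrand: "continuous_on {0..} (\<lambda>s. B (p n s) + F s)" for n
    by (intro continuous_intros F B.continuous_on cont)
  have integ: "(\<lambda>s. B (p n s) + F s) integrable_on {0..t}" for n t
    by (rule integrable_continuous_interval) (use integrand in \<open>rule continuous_on_subset, auto\<close>)
  have ulim: "uniform_limit {0..T} p (\<lambda>t. \<Sum>i. p (Suc i) t - p i t) sequentially" if T: "T \<ge> 0" for T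
  proof -
    have "compact (p 1 ` {0..T})"
      by (rule compact_continuous_image) (use cont[of 1] in \<open>auto intro: continuous_on_subset\<close>)
    then obtain M where M: "\<And>t. t \<in> {0..T} \<Longrightarrow> norm (p 1 t) \<le> M"
      by (meson bounded_iff compact_imp_bounded image_eqI)
    have M0: "M \<ge> 0" using order_trans[OF norm_ge_zero M[of 0]] T by simp
    \<comment> \<open>The weight \<open>exp (2 * L * t)\<close> gains a factor 1/2 per iteration,
      since the integral of \<open>L * exp (2 * L * s)\<close> over \<open>{0..t}\<close> is at most
      half of \<open>exp (2 * L * t)\<close>. The series is therefore geometric for every
      \<open>T\<close>.\<close>
    have bound: "norm (p (Suc n) t - p n t) \<le> M * exp (2 * L * t) * (1/2) ^ n" if "t \<in> {0..T}" for n t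
      using that
    proof (induction n arbitrary: t)
      case 0
      have "norm (p 1 t) \<le> M" by (rule M[OF 0])
      also have "M \<le> M * exp (2 * L * t)" using M0 Lpos 0 by (simp add: mult_le_cancel_left1)
      finally show ?case by (simp add: p0)
    next
      case (Suc n)
      have ex: "((\<lambda>s. L * (M * exp (2 * L * s) * (1/2) ^ n)) has_integral
          (M * exp (2 * L * t) * (1/2) ^ Suc n - M * exp (2 * L * 0) * (1/2) ^ Suc n)) {0..t}"
        by (rule fundamental_theorem_of_calculus)
          (use Suc.prems Lpos in \<open>auto intro!: derivative_eq_intros simp: has_real_derivative_iff_has_vector_derivative[symmetric]\<close>)
      have "p (Suc (Suc n)) t - p (Suc n) t
          = integral {0..t} (\<lambda>s. (B (p (Suc n) s) + F s) - (B (p n s) + F s))"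
        unfolding Henstock_Kurzweil_Integration.integral_diff[OF integ integ] by (simp add: pS)
      also have "\<dots> = integral {0..t} (\<lambda>s. B (p (Suc n) s - p n s))" by (simp add: B.diff)
      finally have eq: "p (Suc (Suc n)) t - p (Suc n) t = integral {0..t} (\<lambda>s. B (p (Suc n) s - p n s))" .
      have "norm (integral {0..t} (\<lambda>s. B (p (Suc n) s - p n s)))
          \<le> integral {0..t} (\<lambda>s. L * (M * exp (2 * L * s) * (1/2) ^ n))"
      proof (rule integral_norm_bound_integral)
        show "(\<lambda>s. B (p (Suc n) s - p n s)) integrable_on {0..t}"
          by (intro integrable_continuous_interval B.continuous_on continuous_intros
              continuous_on_subset[OF cont]) auto
        fix s assume s: "s \<in> {0..t}"
        have "norm (B (p (Suc n) s - p n s)) \<le> L * norm (p (Suc n) s - p n s)"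
          using L by (simp add: mult.commute)
        also have "\<dots> \<le> L * (M * exp (2 * L * s) * (1/2) ^ n)"
          by (rule mult_left_mono[OF Suc.IH]) (use s Suc.prems Lpos in auto)
        finally show "norm (B (p (Suc n) s - p n s)) \<le> L * (M * exp (2 * L * s) * (1/2) ^ n)" .
      qed (use ex in blast)
      also have "\<dots> \<le> M * exp (2 * L * t) * (1/2) ^ Suc n"
        using M0 unfolding integral_unique[OF ex] by simp
      finally show ?case unfolding eq .
    qed
    have "uniform_limit {0..T} (\<lambda>n t. \<Sum>i<n. p (Suc i) t - p i t) (\<lambda>t. \<Sum>i. p (Suc i) t - p i t) sequentially"
    proof (rule Weierstrass_m_test)
      fix n t assume t: "t \<in> {0..T}"
      show "norm (p (Suc n) t - p n t) \<le> M * exp (2 * L * T) * (1/2) ^ n"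
        by (rule order_trans[OF bound[OF t]]) (use t M0 Lpos in \<open>auto intro!: mult_right_mono mult_left_mono\<close>)
    qed (intro summable_mult summable_geometric, simp)
    moreover have "(\<Sum>i<n. p (Suc i) t - p i t) = p n t" for n t
      by (induction n) (simp_all add: p0)
    ultimately show ?thesis by simp
  qed
  define u where "u = (\<lambda>t. \<Sum>i. p (Suc i) t - p i t)"
  have cu: "continuous_on {0..T} u" if "T \<ge> 0" for T
    unfolding u_def
    by (rule uniform_limit_theorem[OF _ ulim[OF that]])
      (auto intro!: always_eventually continuous_on_subset[OF cont])
  have ueq: "u t = x0 + integral {0..t} (\<lambda>s. B (u s) + F s)" if t: "t \<ge> 0" for t
  proof -
    have "uniform_limit {0..t} (\<lambda>n s. B (p n s) + F s) (\<lambda>s. B (u s) + F s) sequentially"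
      using ulim[OF t, folded u_def]
      by (intro uniform_limit_intros bounded_linear.uniform_limit[OF B])
    then obtain I J where IJ: "\<And>n. ((\<lambda>s. B (p n s) + F s) has_integral I n) {0..t}"
        "((\<lambda>s. B (u s) + F s) has_integral J) {0..t}" "I \<longlonglongrightarrow> J"
      by (rule uniform_limit_integral[OF _ continuous_on_subset[OF integrand]]) auto
    have "(\<lambda>n. p (Suc n) t) \<longlonglongrightarrow> x0 + J"
      unfolding pS integral_unique[OF IJ(1)] by (intro tendsto_intros IJ(3))
    moreover have "(\<lambda>n. p (Suc n) t) \<longlonglongrightarrow> u t"
      using tendsto_uniform_limitI[OF ulim[OF t], of t] t unfolding u_def by (intro LIMSEQ_Suc) auto
    ultimately show ?thesis using LIMSEQ_unique integral_unique[OF IJ(2)] by blast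
  qed
  have cu': "continuous_on {0..} u" by (rule continuous_on_atLeastI[OF cu])
  have "(u has_vector_derivative B (u t) + F t) (at t within {0..})" if "t \<ge> 0" for t
  proof (rule has_vector_derivative_transform[of t "{0..}"])
    have "continuous_on {0..} (\<lambda>s. B (u s) + F s)" by (intro continuous_intros B.continuous_on F cu')
    from integral_has_vector_derivative_atLeast[OF this that]
    show "((\<lambda>t. x0 + integral {0..t} (\<lambda>s. B (u s) + F s)) has_vector_derivative B (u t) + F t) (at t within {0..})"
      by (simp add: has_vector_derivative_add_const add.commute[of x0])
  qed (use that ueq in auto)
  moreover have "u 0 = x0" using ueq[of 0] by simp
  ultimately show ?thesis by blast
qed

text \<open>Gronwall's inequality. Only the inner product of \<open>D t\<close> with
  \<open>u t\<close> is controlled, never the norm of \<open>D t\<close>; this allows estimates that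
  are uniform in the Yosida parameter.\<close>

lemma energy_estimate:
  fixes u :: "real \<Rightarrow> 'a::real_inner"
  assumes deriv: "\<And>t. t \<in> {0..T} \<Longrightarrow> (u has_vector_derivative D t) (at t within {0..T})"
    and le: "\<And>t. t \<in> {0..T} \<Longrightarrow> 2 * (D t \<bullet> u t) \<le> k * (norm (u t))\<^sup>2 + M"
    and "k \<ge> 0" "M \<ge> 0" "t \<in> {0..T}"
  shows "(norm (u t))\<^sup>2 \<le> exp (k * T) * ((norm (u 0))\<^sup>2 + M * T)"
proof -
  \<comment> \<open>Subtracting \<open>M * t\<close> absorbs the constant \<open>M\<close>, because
    the integrating factor is at most 1 for non-negative times.\<close>
  define \<phi> where "\<phi> = (\<lambda>t. exp (- k * t) * (u t \<bullet> u t) - M * t)"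
  define d where "d = (\<lambda>t. exp (- k * t) * (2 * (D t \<bullet> u t)) - k * exp (- k * t) * (u t \<bullet> u t) - M)"
  have der: "(\<phi> has_vector_derivative d s) (at s within {0..t})" if s: "s \<in> {0..t}" for s
  proof -
    have uD: "(u has_vector_derivative D s) (at s within {0..t})"
      by (rule has_vector_derivative_within_subset[OF deriv]) (use s assms(5) in auto)
    have "((\<lambda>t. u t \<bullet> u t) has_vector_derivative u s \<bullet> D s + D s \<bullet> u s) (at s within {0..t})"
      by (rule bounded_bilinear.has_vector_derivative[OF bounded_bilinear_inner uD uD])
    then have "((\<lambda>t. u t \<bullet> u t) has_real_derivative 2 * (D s \<bullet> u s)) (at s within {0..t})"
      by (simp add: has_real_derivative_iff_has_vector_derivative inner_commute)
    then have "(\<phi> has_real_derivative d s) (at s within {0..t})"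
      unfolding \<phi>_def d_def by (auto intro!: derivative_eq_intros simp: algebra_simps)
    then show ?thesis by (simp add: has_real_derivative_iff_has_vector_derivative)
  qed
  have d: "d s \<le> 0" if s: "s \<in> {0..t}" for s
  proof -
    have "exp (- k * s) * (2 * (D s \<bullet> u s)) \<le> exp (- k * s) * (k * (norm (u s))\<^sup>2 + M)"
      using le[of s] s assms(5) by (intro mult_left_mono) auto
    moreover have "exp (- k * s) * M \<le> 1 * M" using s assms by (intro mult_right_mono) auto
    ultimately show ?thesis unfolding d_def power2_norm_eq_inner by (simp add: algebra_simps)
  qed
  have "\<phi> t \<le> \<phi> 0"
  proof -
    have "(d has_integral (\<phi> t - \<phi> 0)) {0..t}"
      by (rule fundamental_theorem_of_calculus) (use assms(5) der in auto)
    from has_integral_le[OF this has_integral_0[of "{0..t}"]] d show ?thesis by auto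
  qed
  then have "exp (- k * t) * (norm (u t))\<^sup>2 \<le> (norm (u 0))\<^sup>2 + M * t"
    by (simp add: \<phi>_def power2_norm_eq_inner)
  then have "exp (k * t) * (exp (- k * t) * (norm (u t))\<^sup>2) \<le> exp (k * t) * ((norm (u 0))\<^sup>2 + M * t)"
    by (rule mult_left_mono) simp
  also have "exp (k * t) * (exp (- k * t) * (norm (u t))\<^sup>2) = (norm (u t))\<^sup>2"
    by (simp add: mult.assoc[symmetric] exp_add[symmetric])
  also have "exp (k * t) * ((norm (u 0))\<^sup>2 + M * t) \<le> exp (k * T) * ((norm (u 0))\<^sup>2 + M * T)"
    using assms(3-5) by (intro mult_mono add_left_mono) (auto intro: mult_left_mono)
  finally show ?thesis .
qed

text \<open>The approximants are the averages of \<open>G\<close> over \<open>{t..t + h}\<close>;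
  averaging forward in time stays inside the half-line.\<close>

lemma C1_approximation:
  fixes G :: "real \<Rightarrow> 'a::banach"
  assumes G: "continuous_on {0..} G" and e: "e > 0"
  shows "\<exists>H H'. continuous_on {0..} H' \<and>
    (\<forall>t\<ge>0. (H has_vector_derivative H' t) (at t within {0..})) \<and> (\<forall>t\<in>{0..T}. norm (G t - H t) \<le> e)"
proof -
  \<comment> \<open>The averages reach beyond \<open>T\<close> by \<open>h\<close>, which is at most
    1.\<close>
  have "uniformly_continuous_on {0..T + 1} G"
    by (rule compact_uniformly_continuous) (auto intro: continuous_on_subset[OF G])
  then obtain d where d: "d > 0" "\<And>s t. s \<in> {0..T + 1} \<Longrightarrow> t \<in> {0..T + 1} \<Longrightarrow> dist s t < d \<Longrightarrow> dist (G s) (G t) < e"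
    using e unfolding uniformly_continuous_on_def by metis
  define h where "h = min (d / 2) 1"
  have h: "h > 0" "h < d" "h \<le> 1" using d by (auto simp: h_def)
  define \<Gamma> where "\<Gamma> = (\<lambda>t. integral {0..t} G)"
  have \<Gamma>: "(\<Gamma> has_vector_derivative G t) (at t within {0..})" if "t \<ge> 0" for t
    unfolding \<Gamma>_def by (rule integral_has_vector_derivative_atLeast[OF G that])
  define H where "H = (\<lambda>t. (1 / h) *\<^sub>R (\<Gamma> (t + h) - \<Gamma> t))"
  define H' where "H' = (\<lambda>t. (1 / h) *\<^sub>R (G (t + h) - G t))"
  have "continuous_on {0..} H'"
    unfolding H'_def
    by (intro continuous_intros G continuous_on_compose2[OF G, where f = "\<lambda>t. t + h"]) (use h in auto)
  moreover have "(H has_vector_derivative H' t) (at t within {0..})" if "t \<ge> 0" for t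
  proof -
    have 1: "((\<lambda>t. t + h) has_vector_derivative 1) (at t within {0..})"
      by (auto intro!: derivative_eq_intros)
    have "(\<Gamma> has_vector_derivative G (t + h)) (at (t + h) within (\<lambda>t. t + h) ` {0..})"
      by (rule has_vector_derivative_within_subset[OF \<Gamma>]) (use that h in auto)
    from vector_diff_chain_within[OF 1 this]
    have "((\<lambda>t. \<Gamma> (t + h)) has_vector_derivative G (t + h)) (at t within {0..})"
      by (simp add: o_def)
    then show ?thesis
      unfolding H_def H'_def
      by (intro has_vector_derivative_diff bounded_linear.has_vector_derivative[OF bounded_linear_scaleR_right] \<Gamma>[OF that])
  qed
  moreover have "norm (G t - H t) \<le> e" if t: "t \<in> {0..T}" for t
  proof -
    have "(G has_integral (\<Gamma> (t + h) - \<Gamma> t)) {t..t + h}"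
      by (rule fundamental_theorem_of_calculus)
        (use t h in \<open>auto intro!: has_vector_derivative_within_subset[OF \<Gamma>]\<close>)
    from has_integral_diff[OF has_integral_const_real[of "G t" t "t + h"] this]
    have int: "((\<lambda>s. G t - G s) has_integral (h *\<^sub>R (G t - H t))) {t..t + h}"
      using h by (simp add: H_def scaleR_right_diff_distrib)
    have "norm (h *\<^sub>R (G t - H t)) \<le> e * measure lborel (cbox t (t + h))"
    proof (rule has_integral_bound[of e "\<lambda>s. G t - G s"])
      fix s assume "s \<in> cbox t (t + h)"
      then have "dist (G t) (G s) < e" using t h by (intro d(2)) (auto simp: dist_real_def)
      then show "norm (G t - G s) \<le> e" by (simp add: dist_norm)
    qed (use e int in auto)
    then show ?thesis using h by (simp add: mult.commute)
  qed
  ultimately show ?thesis by blast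
qed

section \<open>Accretive generators given by their bounded inverse, and their Yosida
  approximations\<close>

locale evolution =
  fixes K P :: "'a::{real_inner,banach} \<Rightarrow> 'a"
  assumes K: "bounded_linear K" and P: "bounded_linear P"
    and accretive: "0 \<le> K x \<bullet> x" and injective: "K x = 0 \<Longrightarrow> x = 0"
begin

interpretation K: bounded_linear K by (rule K)
interpretation P: bounded_linear P by (rule P)

definition eps :: "nat \<Rightarrow> real" where "eps n = 1 / real (Suc n)"

text \<open>Yosida approximations \<open>(K + \<epsilon>)\<inverse>\<close> of the generator \<open>K\<inverse>\<close>.\<close>

definition Y :: "nat \<Rightarrow> 'a \<Rightarrow> 'a" where
  "Y n = (SOME C. bounded_linear C \<and> (\<forall>x. K (C x) + eps n *\<^sub>R C x = x) \<and> (\<forall>x. C (K x + eps n *\<^sub>R x) = x))"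

lemma eps_pos: "eps n > 0" by (simp add: eps_def)

lemma eps_tendsto: "eps \<longlonglongrightarrow> 0"
  using LIMSEQ_inverse_real_of_nat by (simp add: eps_def[abs_def] inverse_eq_divide)

lemma Y: "bounded_linear (Y n)" "K (Y n x) + eps n *\<^sub>R Y n x = x" "Y n (K x + eps n *\<^sub>R x) = x"
proof -
  have "\<exists>C. bounded_linear C \<and> (\<forall>x. K (C x) + eps n *\<^sub>R C x = x) \<and> (\<forall>x. C (K x + eps n *\<^sub>R x) = x)"
  proof (rule Lax_Milgram[where c = "eps n"])
    show "bounded_linear (\<lambda>x. K x + eps n *\<^sub>R x)"
      by (intro bounded_linear_add K bounded_linear_scaleR_right)
    show "eps n * (norm x)\<^sup>2 \<le> (K x + eps n *\<^sub>R x) \<bullet> x" for x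
      using accretive[of x] by (simp add: inner_add_left power2_norm_eq_inner)
  qed (rule eps_pos)
  from someI_ex[OF this, folded Y_def]
  show "bounded_linear (Y n)" "K (Y n x) + eps n *\<^sub>R Y n x = x" "Y n (K x + eps n *\<^sub>R x) = x" by auto
qed

interpretation Y: bounded_linear "Y n" for n by (rule Y)

lemma Y_accretive: "0 \<le> Y n x \<bullet> x"
proof -
  have "Y n x \<bullet> x = K (Y n x) \<bullet> Y n x + eps n * (Y n x \<bullet> Y n x)"
    by (subst (2) Y(2)[of n x, symmetric]) (simp add: inner_add_right inner_commute)
  then show ?thesis using accretive[of "Y n x"] eps_pos[of n] by simp
qed

text \<open>With \<open>p = Y n (K y)\<close> one has
  \<open>K (p - y) = - (eps n *\<^sub>R p)\<close>; testing against \<open>p - y\<close> removes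
  \<open>eps n\<close>. The bound, uniform in \<open>n\<close>, controls the initial velocities of
  approximations that start in the range of \<open>K\<close>.\<close>

lemma norm_Y_K_le: "norm (Y n (K y)) \<le> norm y"
proof -
  define p where "p = Y n (K y)"
  have "K (p - y) = - (eps n *\<^sub>R p)" using Y(2)[of n "K y"] by (simp add: p_def K.diff algebra_simps)
  with accretive[of "p - y"] have "eps n * (p \<bullet> (p - y)) \<le> 0" by simp
  then have "p \<bullet> p \<le> p \<bullet> y" using eps_pos[of n] by (simp add: mult_le_0_iff inner_diff_right)
  then have "norm p * norm p \<le> norm p * norm y"
    using norm_cauchy_schwarz[of p y] by (simp add: power2_norm_eq_inner[symmetric] power2_eq_square)
  then show ?thesis unfolding p_def[symmetric] by (cases "p = 0") auto
qed

lemma Y_K_commute: "Y n (K y) = K (Y n y)"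
proof -
  have "K (Y n y) = Y n (K (K (Y n y)) + eps n *\<^sub>R K (Y n y))" by (simp add: Y(3))
  also have "K (K (Y n y)) + eps n *\<^sub>R K (Y n y) = K y"
    by (metis K.add K.scaleR Y(2))
  finally show ?thesis by simp
qed

lemma norm_eps_Y_le: "norm (eps n *\<^sub>R Y n y) \<le> norm y"
proof -
  define x where "x = Y n y"
  have "eps n * (x \<bullet> x) \<le> y \<bullet> x"
    using accretive[of x] Y(2)[of n y] by (metis add.commute inner_add_left inner_scaleR_left le_add_same_cancel1 x_def)
  then have "(eps n * norm x) * norm x \<le> norm y * norm x"
    using norm_cauchy_schwarz[of y x] by (simp add: power2_norm_eq_inner[symmetric] power2_eq_square)
  then show ?thesis using eps_pos[of n] unfolding x_def[symmetric] by (cases "x = 0") auto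
qed

text \<open>With \<open>s\<^sub>n = y - \<epsilon>\<^sub>n Y\<^sub>n y\<close>, accretivity yields \<open>|s\<^sub>m - s\<^sub>n|\<^sup>2 \<le> |s\<^sub>m|\<^sup>2 - |s\<^sub>n|\<^sup>2\<close> for \<open>m \<ge> n\<close>, so
  \<open>s\<^sub>n\<close> converges; the limit of \<open>\<epsilon>\<^sub>n Y\<^sub>n y\<close> lies in the kernel of \<open>K\<close>.\<close>

lemma eps_Y_tendsto: "(\<lambda>n. eps n *\<^sub>R Y n y) \<longlonglongrightarrow> 0"
proof -
  define r where "r = (\<lambda>n. eps n *\<^sub>R Y n y)"
  define s where "s = (\<lambda>n. y - r n)"
  have Kr: "K (r n) = eps n *\<^sub>R s n" for n
    using Y(2)[of n y] by (simp add: r_def s_def K.scaleR eq_diff_eq)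
  have key: "(norm (s m - s n))\<^sup>2 \<le> (norm (s m))\<^sup>2 - (norm (s n))\<^sup>2" if "n \<le> m" for m n
  proof (cases "eps n = eps m")
    case True
    then have "n = m" by (simp add: eps_def)
    then show ?thesis by simp
  next
    case False
    then have less: "eps m < eps n" using that by (simp add: eps_def frac_less2 le_neq_implies_less divide_strict_left_mono)
    have "K (s m - s n) = K (r n) - K (r m)" by (simp add: s_def K.diff[symmetric])
    then have "K (s m - s n) = (eps n - eps m) *\<^sub>R s n - eps m *\<^sub>R (s m - s n)"
      unfolding Kr by (simp add: algebra_simps)
    then have "0 \<le> (eps n - eps m) * (s n \<bullet> (s m - s n)) - eps m * ((s m - s n) \<bullet> (s m - s n))"
      using accretive[of "s m - s n"] by (simp add: inner_diff_left)
    moreover have "0 \<le> eps m * ((s m - s n) \<bullet> (s m - s n))" using eps_pos[of m] by simp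
    ultimately have "0 \<le> s n \<bullet> (s m - s n)" using less by (smt (verit) zero_le_mult_iff)
    then show ?thesis
      unfolding power2_norm_eq_inner by (simp add: inner_diff_left inner_diff_right inner_commute[of "s n" "s m"])
  qed
  have "incseq (\<lambda>n. (norm (s n))\<^sup>2)"
  proof (rule monoI)
    fix n m :: nat assume "n \<le> m"
    then show "(norm (s n))\<^sup>2 \<le> (norm (s m))\<^sup>2" using key[of n m] zero_le_power2[of "norm (s m - s n)"] by linarith
  qed
  moreover have bound: "(norm (s n))\<^sup>2 \<le> (2 * norm y)\<^sup>2" for n
    using norm_triangle_ineq4[of y "r n"] norm_eps_Y_le[of n y] unfolding r_def s_def by (intro power_mono) auto
  ultimately obtain L where "(\<lambda>n. (norm (s n))\<^sup>2) \<longlonglongrightarrow> L" using incseq_convergent by metis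
  then have "Cauchy (\<lambda>n. (norm (s n))\<^sup>2)" by (rule LIMSEQ_imp_Cauchy)
  have "Cauchy s"
    unfolding Cauchy_altdef2
  proof (intro allI impI)
    fix e :: real assume e: "e > 0"
    then have "e\<^sup>2 > 0" by simp
    then obtain N where N: "\<And>n. n \<ge> N \<Longrightarrow> dist ((norm (s n))\<^sup>2) ((norm (s N))\<^sup>2) < e\<^sup>2"
      using \<open>Cauchy (\<lambda>n. (norm (s n))\<^sup>2)\<close> unfolding Cauchy_altdef2 by blast
    have "dist (s n) (s N) < e" if "n \<ge> N" for n
      using key[OF that] N[OF that] e by (intro power2_less_imp_less[of _ e]) (auto simp: dist_norm)
    then show "\<exists>N. \<forall>n\<ge>N. dist (s n) (s N) < e" by blast
  qed
  then obtain s' where s': "s \<longlonglongrightarrow> s'" using Cauchy_convergent convergent_def by blast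
  have r: "r \<longlonglongrightarrow> y - s'" using tendsto_diff[OF tendsto_const s', of y] by (simp add: s_def)
  have "(\<lambda>n. K (r n)) \<longlonglongrightarrow> 0 *\<^sub>R s'" unfolding Kr by (intro tendsto_intros eps_tendsto s')
  then have "K (y - s') = 0" using LIMSEQ_unique[OF K.tendsto[OF r]] by simp
  then show ?thesis using r injective unfolding r_def by metis
qed

text \<open>On the range of \<open>K\<close> the Yosida approximations converge to the inverse: the
  error is \<open>eps n *\<^sub>R Y n y\<close>.\<close>

lemma Y_K_tendsto: "(\<lambda>n. Y n (K y)) \<longlonglongrightarrow> y"
proof -
  have "Y n (K y) = y - eps n *\<^sub>R Y n y" for n
    unfolding Y_K_commute using Y(2)[of n y] by (simp add: eq_diff_eq)
  then show ?thesis using tendsto_diff[OF tendsto_const eps_Y_tendsto[of y], of y] by simp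
qed

text \<open>The approximant is \<open>K (Y n y)\<close>, again with error
  \<open>eps n *\<^sub>R Y n y\<close>. Density thus rests on injectivity, through the vanishing of
  that error.\<close>

lemma dense_range:
  assumes "e > 0" shows "\<exists>x. norm (y - K x) < e"
proof -
  obtain n where n: "norm (eps n *\<^sub>R Y n y) < e"
    using LIMSEQ_D[OF eps_Y_tendsto assms, of y] by auto
  have "y - K (Y n y) = eps n *\<^sub>R Y n y" using Y(2)[of n y] by (simp add: diff_eq_eq add.commute)
  then show ?thesis using n by (intro exI[of _ "Y n y"]) simp
qed

section \<open>Solutions of the approximate equations and their convergence\<close>

definition is_sol :: "nat \<Rightarrow> 'a \<Rightarrow> (real \<Rightarrow> 'a) \<Rightarrow> (real \<Rightarrow> 'a) \<Rightarrow> bool" where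
  "is_sol n y0 G u \<longleftrightarrow> u 0 = y0 \<and>
     (\<forall>t\<ge>0. (u has_vector_derivative - Y n (u t) + P (u t) + G t) (at t within {0..}))"

lemma is_sol_exists: "continuous_on {0..} G \<Longrightarrow> \<exists>u. is_sol n y0 G u"
  unfolding is_sol_def
  by (rule linear_ode_exists[OF bounded_linear_add[OF bounded_linear_minus[OF Y(1)] P]])

lemma is_sol_continuous: "is_sol n y0 G u \<Longrightarrow> continuous_on {0..} u"
  by (rule continuous_on_atLeast_if_derivative[where D = "\<lambda>t. - Y n (u t) + P (u t) + G t"])
    (simp add: is_sol_def)

text \<open>Twice the operator norm pays for \<open>P\<close>; the additional 1 pays for Young's
  inequality on the forcing term in \<open>stability\<close>.\<close>

definition \<kappa> :: real where "\<kappa> = 2 * onorm P + 1"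

lemma \<kappa>_nonneg: "\<kappa> \<ge> 0" using onorm_pos_le[OF P] by (simp add: \<kappa>_def)

lemma P_inner_le: "2 * (P x \<bullet> x) \<le> (\<kappa> - 1) * (norm x)\<^sup>2"
proof -
  have "P x \<bullet> x \<le> norm (P x) * norm x" by (rule norm_cauchy_schwarz)
  also have "\<dots> \<le> (onorm P * norm x) * norm x" by (intro mult_right_mono onorm[OF P]) simp
  finally show ?thesis by (simp add: \<kappa>_def power2_eq_square)
qed

lemma P_inner_le': "2 * (P x \<bullet> x) \<le> \<kappa> * (norm x)\<^sup>2"
  using P_inner_le[of x] zero_le_power2[of "norm x"] unfolding left_diff_distrib by linarith

lemma two_inner_le: "2 * ((x::'a) \<bullet> y) \<le> (norm x)\<^sup>2 + (norm y)\<^sup>2"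
  using inner_ge_zero[of "x - y"] by (simp add: inner_diff_left inner_diff_right inner_commute[of y x] power2_norm_eq_inner)

text \<open>Accretivity discards the term with \<open>Y n\<close>, so its size never enters and the
  constants are the same for all \<open>n\<close>.\<close>

lemma stability:
  assumes u: "is_sol n y0 G u" and v: "is_sol n z0 H v"
    and GH: "\<And>t. t \<in> {0..T} \<Longrightarrow> norm (G t - H t) \<le> m" and t: "t \<in> {0..T}"
  shows "(norm (u t - v t))\<^sup>2 \<le> exp (\<kappa> * T) * ((norm (y0 - z0))\<^sup>2 + m\<^sup>2 * T)"
proof -
  let ?D = "\<lambda>t. (- Y n (u t) + P (u t) + G t) - (- Y n (v t) + P (v t) + H t)"
  have "(norm (u t - v t))\<^sup>2 \<le> exp (\<kappa> * T) * ((norm (u 0 - v 0))\<^sup>2 + m\<^sup>2 * T)"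
  proof (rule energy_estimate[where D = ?D, OF _ _ \<kappa>_nonneg _ t])
    fix s assume s: "s \<in> {0..T}"
    have "((\<lambda>t. u t - v t) has_vector_derivative ?D s) (at s within {0..})"
      using u v s by (intro has_vector_derivative_diff) (auto simp: is_sol_def)
    then show "((\<lambda>t. u t - v t) has_vector_derivative ?D s) (at s within {0..T})"
      by (rule has_vector_derivative_within_subset) auto
    let ?w = "u s - v s"
    have D: "?D s = - Y n ?w + P ?w + (G s - H s)" by (simp add: Y.diff P.diff)
    have "(norm (G s - H s))\<^sup>2 \<le> m\<^sup>2" using GH[OF s] by (simp add: power_mono)
    then show "2 * (?D s \<bullet> ?w) \<le> \<kappa> * (norm ?w)\<^sup>2 + m\<^sup>2"
      unfolding D using Y_accretive[of n ?w] P_inner_le[of ?w] two_inner_le[of "G s - H s" ?w]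
      by (simp add: inner_add_left algebra_simps)
  qed auto
  then show ?thesis using u v by (simp add: is_sol_def)
qed

lemma is_sol_bound:
  assumes u: "is_sol n y0 G u"
    and G: "\<And>t. t \<in> {0..T} \<Longrightarrow> norm (G t) \<le> m" and t: "t \<in> {0..T}"
  shows "(norm (u t))\<^sup>2 \<le> exp (\<kappa> * T) * ((norm y0)\<^sup>2 + m\<^sup>2 * T)"
proof -
  have "is_sol n 0 (\<lambda>_. 0) (\<lambda>_. 0)" by (simp add: is_sol_def Y.zero P.zero)
  from stability[OF u this _ t, of m] G show ?thesis by simp
qed

text \<open>The approximate equation has bounded operators as coefficients, so it may be
  differentiated in time: the velocity solves an equation of the same type with forcing
  \<open>G'\<close>.\<close>

lemma is_sol_derivative:
  assumes u: "is_sol n y0 G u"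
    and G: "\<And>t. t \<ge> 0 \<Longrightarrow> (G has_vector_derivative G' t) (at t within {0..})"
  shows "is_sol n (- Y n y0 + P y0 + G 0) G' (\<lambda>t. - Y n (u t) + P (u t) + G t)"
proof -
  have "((\<lambda>t. - Y n (u t) + P (u t) + G t) has_vector_derivative
      - Y n (- Y n (u t) + P (u t) + G t) + P (- Y n (u t) + P (u t) + G t) + G' t) (at t within {0..})"
    if t: "t \<ge> 0" for t
    using u t unfolding is_sol_def
    by (intro has_vector_derivative_add has_vector_derivative_minus G
        Y.has_vector_derivative P.has_vector_derivative) auto
  then show ?thesis using u by (simp add: is_sol_def)
qed

lemma continuous_bounded_on_interval:
  assumes "continuous_on {0..} (G :: real \<Rightarrow> 'a)"
  shows "\<exists>m\<ge>0. \<forall>t\<in>{0..T}. norm (G t) \<le> m"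
proof -
  have "compact (G ` {0..T})"
    by (rule compact_continuous_image) (auto intro: continuous_on_subset[OF assms])
  then obtain m where m: "\<forall>x\<in>G ` {0..T}. norm x \<le> m" by (meson bounded_iff compact_imp_bounded)
  \<comment> \<open>The maximum covers the empty interval of a negative \<open>T\<close>.\<close>
  show ?thesis by (rule exI[of _ "max m 0"]) (use m in \<open>auto simp: le_max_iff_disj\<close>)
qed

text \<open>Let \<open>p\<close> and \<open>q\<close> be the Yosida terms of two approximations. By
  the resolvent identity the difference of the solutions is \<open>K (p - q)\<close> plus
  \<open>eps m *\<^sub>R p - eps n *\<^sub>R q\<close>. Tested against \<open>p - q\<close> the
  former has the good sign, and the latter is of order \<open>eps m + eps n\<close> once
  \<open>p\<close> and \<open>q\<close> are bounded. Boundedness comes from the velocities; this is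
  where the initial value \<open>K x\<close> and the differentiable forcing enter.\<close>

lemma smooth_data_Cauchy:
  assumes u: "\<And>n. is_sol n (K x) G (u n)"
    and G: "\<And>t. t \<ge> 0 \<Longrightarrow> (G has_vector_derivative G' t) (at t within {0..})"
    and G': "continuous_on {0..} G'" and e: "e > 0"
  shows "\<exists>N. \<forall>m\<ge>N. \<forall>n\<ge>N. \<forall>t\<in>{0..T}. norm (u m t - u n t) \<le> e"
proof (cases "T \<ge> 0")
  case T: True
  have cG: "continuous_on {0..} G" using G by (rule continuous_on_atLeast_if_derivative)
  obtain m0 where m0: "m0 \<ge> 0" "\<forall>t\<in>{0..T}. norm (G t) \<le> m0" using continuous_bounded_on_interval[OF cG] by blast
  obtain m1 where m1: "m1 \<ge> 0" "\<forall>t\<in>{0..T}. norm (G' t) \<le> m1" using continuous_bounded_on_interval[OF G'] by blast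
  define v where "v = (\<lambda>n t. - Y n (u n t) + P (u n t) + G t)"
  have v: "is_sol n (- Y n (K x) + P (K x) + G 0) G' (v n)" for n
    unfolding v_def by (rule is_sol_derivative[OF u G])
  define R where "R = norm x + norm (P (K x)) + norm (G 0)"
  have v0: "norm (- Y n (K x) + P (K x) + G 0) \<le> R" for n
    unfolding R_def using norm_Y_K_le[of n x]
    by (intro order_trans[OF norm_triangle_ineq] add_mono order_trans[OF norm_triangle_ineq]) auto
  define C1 where "C1 = sqrt (exp (\<kappa> * T) * (R\<^sup>2 + m1\<^sup>2 * T))"
  define C0 where "C0 = sqrt (exp (\<kappa> * T) * ((norm (K x))\<^sup>2 + m0\<^sup>2 * T))"
  define C where "C = onorm P * C0 + m0 + C1"
  have C1: "norm (v n t) \<le> C1" if t: "t \<in> {0..T}" for n t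
  proof -
    have "(norm (v n t))\<^sup>2 \<le> exp (\<kappa> * T) * ((norm (- Y n (K x) + P (K x) + G 0))\<^sup>2 + m1\<^sup>2 * T)"
      by (rule is_sol_bound[OF v]) (use m1 t in auto)
    also have "\<dots> \<le> exp (\<kappa> * T) * (R\<^sup>2 + m1\<^sup>2 * T)"
      by (intro mult_left_mono add_right_mono power_mono v0) auto
    finally show ?thesis unfolding C1_def by (rule real_le_rsqrt)
  qed
  have C0: "norm (u n t) \<le> C0" if t: "t \<in> {0..T}" for n t
    unfolding C0_def by (rule real_le_rsqrt, rule is_sol_bound[OF u]) (use m0 t in auto)
  \<comment> \<open>The equation expresses the Yosida term through the velocity and terms that are
    already bounded.\<close>
  have C: "norm (Y n (u n t)) \<le> C" if t: "t \<in> {0..T}" for n t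
  proof -
    have "Y n (u n t) = P (u n t) + G t - v n t" by (simp add: v_def)
    also have "norm \<dots> \<le> norm (P (u n t)) + norm (G t) + norm (v n t)"
      by (intro order_trans[OF norm_triangle_ineq4] add_mono norm_triangle_ineq order_refl)
    also have "\<dots> \<le> C"
      unfolding C_def using m0(2) t C1[OF t] C0[OF t]
      by (intro add_mono order_trans[OF onorm[OF P]] mult_left_mono onorm_pos_le P) auto
    finally show ?thesis .
  qed
  have C_nonneg: "C \<ge> 0" using order_trans[OF norm_ge_zero C[of 0]] T by simp
  have est: "(norm (u m t - u n t))\<^sup>2 \<le> exp (\<kappa> * T) * (4 * C\<^sup>2 * (eps m + eps n) * T)"
    if t: "t \<in> {0..T}" for m n t
  proof -
    let ?w = "\<lambda>t. u m t - u n t"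
    let ?D = "\<lambda>t. v m t - v n t"
    have "(norm (?w t))\<^sup>2 \<le> exp (\<kappa> * T) * ((norm (?w 0))\<^sup>2 + 4 * C\<^sup>2 * (eps m + eps n) * T)"
    proof (rule energy_estimate[where D = ?D, OF _ _ \<kappa>_nonneg _ t])
      fix s assume s: "s \<in> {0..T}"
      have "(?w has_vector_derivative ?D s) (at s within {0..})"
        using u s by (intro has_vector_derivative_diff) (auto simp: is_sol_def v_def)
      then show "(?w has_vector_derivative ?D s) (at s within {0..T})"
        by (rule has_vector_derivative_within_subset) auto
      define p q where "p = Y m (u m s)" and "q = Y n (u n s)"
      have w: "?w s = K (p - q) + (eps m *\<^sub>R p - eps n *\<^sub>R q)"
        using Y(2)[of m "u m s"] Y(2)[of n "u n s"] by (simp add: p_def q_def K.diff algebra_simps)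
      have pq: "norm p \<le> C" "norm q \<le> C" using C[OF s] by (auto simp: p_def q_def)
      have "\<bar>(p - q) \<bullet> (eps m *\<^sub>R p - eps n *\<^sub>R q)\<bar> \<le> norm (p - q) * norm (eps m *\<^sub>R p - eps n *\<^sub>R q)"
        by (rule Cauchy_Schwarz_ineq2)
      also have "\<dots> \<le> (C + C) * (eps m * C + eps n * C)"
        using pq eps_pos[of m] eps_pos[of n] C_nonneg
        by (intro mult_mono order_trans[OF norm_triangle_ineq4] add_mono) (auto intro!: mult_left_mono)
      finally have "- ((p - q) \<bullet> ?w s) \<le> 2 * C\<^sup>2 * (eps m + eps n)"
        unfolding w using accretive[of "p - q"]
        by (simp add: inner_add_right inner_commute power2_eq_square algebra_simps)
      moreover have "?D s = - (p - q) + P (?w s)" by (simp add: v_def p_def q_def P.diff)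
      ultimately have D_inner: "?D s \<bullet> ?w s = - ((p - q) \<bullet> ?w s) + P (?w s) \<bullet> ?w s"
        by (simp only: inner_add_left inner_minus_left)
      show "2 * (?D s \<bullet> ?w s) \<le> \<kappa> * (norm (?w s))\<^sup>2 + 4 * C\<^sup>2 * (eps m + eps n)"
        using P_inner_le'[of "?w s"] \<open>- ((p - q) \<bullet> ?w s) \<le> _\<close> unfolding D_inner by simp
    qed (use eps_pos[of m] eps_pos[of n] in simp)
    then show ?thesis using u by (simp add: is_sol_def)
  qed
  define B where "B = exp (\<kappa> * T) * (4 * C\<^sup>2 * T)"
  have "(\<lambda>n. B * eps n) \<longlonglongrightarrow> B * 0" by (intro tendsto_intros eps_tendsto)
  then have "\<forall>\<^sub>F n in sequentially. B * eps n < e\<^sup>2 / 2" by (rule order_tendstoD) (use e in simp)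
  then obtain N where N: "\<And>n. n \<ge> N \<Longrightarrow> B * eps n < e\<^sup>2 / 2" by (auto simp: eventually_sequentially)
  show ?thesis
  proof (intro exI allI impI ballI)
    fix m n t assume mn: "N \<le> m" "N \<le> n" and t: "t \<in> {0..T}"
    have "(norm (u m t - u n t))\<^sup>2 \<le> B * eps m + B * eps n"
      using est[OF t, of m n] by (simp add: B_def algebra_simps)
    also have "\<dots> \<le> e\<^sup>2" using N[OF mn(1)] N[OF mn(2)] by linarith
    finally show "norm (u m t - u n t) \<le> e" by (rule power2_le_imp_le) (use e in simp)
  qed
next
  case False
  then have "{0..T} = {}" by simp
  then show ?thesis by simp
qed

text \<open>The data are replaced by \<open>K x\<close> and a C^1 forcing, at a cost that
  \<open>stability\<close> bounds uniformly in \<open>n\<close>. Initial values may vary with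
  \<open>n\<close> because the result is also applied to velocities, which start at
  \<open>- Y n (K v0) + P (K v0) + F 0\<close>.\<close>

lemma general_data_convergence:
  assumes u: "\<And>n. is_sol n (y0 n) G (u n)" and y0: "y0 \<longlonglongrightarrow> y" and G: "continuous_on {0..} G"
  shows "uniform_limit {0..T} u (\<lambda>t. lim (\<lambda>n. u n t)) sequentially"
proof (cases "T \<ge> 0")
  case T: True
  have "uniformly_Cauchy_on {0..T} u"
    unfolding uniformly_Cauchy_on_def
  proof (intro allI impI)
    fix e :: real assume e: "e > 0"
    \<comment> \<open>For errors up to \<open>\<eta>\<close> in the initial value and in the
      forcing, the bound of \<open>stability\<close> becomes exactly
      \<open>(e / 8)\<^sup>2\<close>.\<close>
    define \<eta> where "\<eta> = e / 8 / sqrt (exp (\<kappa> * T) * (1 + T))"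
    have \<eta>: "\<eta> > 0" using e T by (simp add: \<eta>_def)
    obtain x where x: "norm (y - K x) < \<eta> / 2" using dense_range[of "\<eta> / 2" y] \<eta> by auto
    obtain H H' where H: "continuous_on {0..} H'"
      "\<And>t. t\<ge>0 \<Longrightarrow> (H has_vector_derivative H' t) (at t within {0..})"
      "\<And>t. t\<in>{0..T} \<Longrightarrow> norm (G t - H t) \<le> \<eta>" using C1_approximation[OF G \<eta>] by blast
    have cH: "continuous_on {0..} H" using H(2) by (rule continuous_on_atLeast_if_derivative)
    have "\<forall>n. \<exists>u. is_sol n (K x) H u" using is_sol_exists[OF cH] by blast
    then obtain v where v: "\<And>n. is_sol n (K x) H (v n)" by metis
    obtain N1 where N1: "\<And>n. n \<ge> N1 \<Longrightarrow> norm (y0 n - y) < \<eta> / 2" using LIMSEQ_D[OF y0, of "\<eta> / 2"] \<eta> by auto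
    obtain N2 where N2: "\<And>m n t. m \<ge> N2 \<Longrightarrow> n \<ge> N2 \<Longrightarrow> t \<in> {0..T} \<Longrightarrow> norm (v m t - v n t) \<le> e / 4"
      using smooth_data_Cauchy[OF v H(2,1), of "e / 4" T] e by force
    have close: "norm (u n t - v n t) \<le> e / 8" if n: "n \<ge> N1" and t: "t \<in> {0..T}" for n t
    proof -
      have "norm (y0 n - K x) \<le> \<eta>"
        using norm_triangle_ineq[of "y0 n - y" "y - K x"] N1[OF n] x by simp
      have "(norm (u n t - v n t))\<^sup>2 \<le> exp (\<kappa> * T) * ((norm (y0 n - K x))\<^sup>2 + \<eta>\<^sup>2 * T)"
        by (rule stability[OF u v H(3) t])
      also have "\<dots> \<le> exp (\<kappa> * T) * (\<eta>\<^sup>2 + \<eta>\<^sup>2 * T)"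
        using \<open>norm (y0 n - K x) \<le> \<eta>\<close> by (intro mult_left_mono add_right_mono power_mono) auto
      also have "\<dots> = (\<eta> * sqrt (exp (\<kappa> * T) * (1 + T)))\<^sup>2"
        using T by (simp add: power_mult_distrib algebra_simps)
      also have "\<dots> = (e / 8)\<^sup>2" using T by (simp add: \<eta>_def)
      finally show ?thesis by (rule power2_le_imp_le) (use e in simp)
    qed
    show "\<exists>M. \<forall>t\<in>{0..T}. \<forall>m\<ge>M. \<forall>n\<ge>M. dist (u m t) (u n t) < e"
    proof (intro exI[of _ "max N1 N2"] ballI allI impI)
      fix t m n assume t: "t \<in> {0..T}" and mn: "max N1 N2 \<le> m" "max N1 N2 \<le> n"
      have "u m t - u n t = (u m t - v m t) - (u n t - v n t) + (v m t - v n t)" by simp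
      then have "norm (u m t - u n t) \<le> norm (u m t - v m t) + norm (u n t - v n t) + norm (v m t - v n t)"
        by (metis (no_types) norm_triangle_le norm_triangle_ineq4 add_right_mono)
      also have "\<dots> \<le> e / 8 + e / 8 + e / 4"
        using mn t by (intro add_mono close N2) auto
      also have "\<dots> < e" using e by simp
      finally show "dist (u m t) (u n t) < e" by (simp add: dist_norm)
    qed
  qed
  then show ?thesis
    using Cauchy_uniformly_convergent uniformly_convergent_uniform_limit_iff by blast
next
  case False
  then have "{0..T} = {}" by simp
  then show ?thesis by (simp add: uniform_limit_iff)
qed

text \<open>Convergence is used for the approximations and for their velocities. The limits inherit
  the integral relation between them, so the limit of the solutions is differentiable.\<close>

theorem classical_solution:
  assumes F: "\<And>t. t \<ge> 0 \<Longrightarrow> (F has_vector_derivative F' t) (at t within {0..})"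
    and F': "continuous_on {0..} F'"
  shows "\<exists>u v. u 0 = K v0 \<and> continuous_on {0..} v \<and>
    (\<forall>t\<ge>0. u t = K (v t) \<and> (u has_vector_derivative - v t + P (u t) + F t) (at t within {0..}))"
proof -
  have cF: "continuous_on {0..} F" using F by (rule continuous_on_atLeast_if_derivative)
  have "\<forall>n. \<exists>u. is_sol n (K v0) F u" using is_sol_exists[OF cF] by blast
  then obtain U where U: "\<And>n. is_sol n (K v0) F (U n)" by metis
  define V where "V = (\<lambda>n t. - Y n (U n t) + P (U n t) + F t)"
  have V: "is_sol n (- Y n (K v0) + P (K v0) + F 0) F' (V n)" for n
    unfolding V_def by (rule is_sol_derivative[OF U F])
  define u where "u = (\<lambda>t. lim (\<lambda>n. U n t))"
  define w where "w = (\<lambda>t. lim (\<lambda>n. V n t))"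
  have ulim: "uniform_limit {0..T} U u sequentially" for T
    unfolding u_def by (rule general_data_convergence[OF U tendsto_const cF])
  have "(\<lambda>n. - Y n (K v0) + P (K v0) + F 0) \<longlonglongrightarrow> - v0 + P (K v0) + F 0"
    by (intro tendsto_intros Y_K_tendsto)
  from general_data_convergence[OF V this F']
  have wlim: "uniform_limit {0..T} V w sequentially" for T unfolding w_def .
  have cw: "continuous_on {0..T} w" for T
    by (rule uniform_limit_theorem[OF _ wlim])
      (auto intro!: always_eventually continuous_on_subset[OF is_sol_continuous[OF V]])
  have cw': "continuous_on {0..} w" by (rule continuous_on_atLeastI[OF cw])
  have Upt: "(\<lambda>n. U n t) \<longlonglongrightarrow> u t" and Vpt: "(\<lambda>n. V n t) \<longlonglongrightarrow> w t" if "t \<ge> 0" for t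
    using tendsto_uniform_limitI[OF ulim[of t], of t] tendsto_uniform_limitI[OF wlim[of t], of t] that by auto
  have ueq: "u t = K v0 + integral {0..t} w" if t: "t \<ge> 0" for t
  proof -
    have Ueq: "U n t = K v0 + integral {0..t} (V n)" for n
      using has_vector_derivative_atLeast_imp_integral[of "U n" "V n" t] U[of n] t
      by (simp add: is_sol_def V_def)
    obtain I J where IJ: "\<And>n. (V n has_integral I n) {0..t}" "(w has_integral J) {0..t}" "I \<longlonglongrightarrow> J"
      by (rule uniform_limit_integral[OF wlim continuous_on_subset[OF is_sol_continuous[OF V]]]) auto
    have "(\<lambda>n. U n t) \<longlonglongrightarrow> K v0 + J"
      unfolding Ueq integral_unique[OF IJ(1)] by (intro tendsto_intros IJ(3))
    then show ?thesis using Upt[OF t] LIMSEQ_unique integral_unique[OF IJ(2)] by blast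
  qed
  have u': "(u has_vector_derivative w t) (at t within {0..})" if t: "t \<ge> 0" for t
  proof (rule has_vector_derivative_transform[of t "{0..}"])
    show "((\<lambda>t. K v0 + integral {0..t} w) has_vector_derivative w t) (at t within {0..})"
      using integral_has_vector_derivative_atLeast[OF cw' t]
      by (simp add: has_vector_derivative_add_const add.commute[of "K v0"])
  qed (use t ueq in auto)
  \<comment> \<open>\<open>K\<close> need not be surjective, so \<open>v\<close> is read off from
    the limit equation; \<open>u t = K (v t)\<close> then follows from the resolvent identity for
    \<open>p n\<close>, whose \<open>eps n\<close> term vanishes in the limit.\<close>
  define v where "v = (\<lambda>t. P (u t) + F t - w t)"
  have "u t = K (v t)" if t: "t \<ge> 0" for t
  proof -
    define p where "p = (\<lambda>n. P (U n t) + F t - V n t)"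
    have p: "p n = Y n (U n t)" for n by (simp add: p_def V_def)
    have plim: "p \<longlonglongrightarrow> v t" unfolding p_def v_def
      by (intro tendsto_intros P.tendsto Upt Vpt t)
    have "(\<lambda>n. K (p n) + eps n *\<^sub>R p n) \<longlonglongrightarrow> K (v t) + 0 *\<^sub>R v t"
      by (intro tendsto_intros K.tendsto plim eps_tendsto)
    moreover have "K (p n) + eps n *\<^sub>R p n = U n t" for n unfolding p by (rule Y(2))
    ultimately have "(\<lambda>n. U n t) \<longlonglongrightarrow> K (v t)" by simp
    then show ?thesis using Upt[OF t] LIMSEQ_unique by blast
  qed
  moreover have "continuous_on {0..} v"
    unfolding v_def
    by (intro continuous_intros P.continuous_on cF cw' continuous_on_atLeast_if_derivative[OF u'])
  moreover have "(u has_vector_derivative - v t + P (u t) + F t) (at t within {0..})" if "t \<ge> 0" for t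
    using u'[OF that] by (simp add: v_def)
  moreover have "u 0 = K v0" using ueq[of 0] by simp
  ultimately show ?thesis by blast
qed

text \<open>Testing the equation with \<open>u t = K (v t)\<close> turns the generator term into
  \<open>- (K (v t) \<bullet> v t)\<close>, which is non-positive; only the bounded term with
  \<open>P\<close> is left.\<close>

theorem zero_solution_unique:
  assumes "u 0 = 0" and uv: "\<And>t. t \<ge> 0 \<Longrightarrow> u t = K (v t)"
    and "\<And>t. t \<ge> 0 \<Longrightarrow> (u has_vector_derivative - v t + P (u t)) (at t within {0..})" and t: "t \<ge> 0"
  shows "u t = 0"
proof -
  have "(norm (u t))\<^sup>2 \<le> exp (\<kappa> * t) * ((norm (u 0))\<^sup>2 + 0 * t)"
  proof (rule energy_estimate[where D = "\<lambda>t. - v t + P (u t)", OF _ _ \<kappa>_nonneg])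
    fix s assume s: "s \<in> {0..t}"
    show "(u has_vector_derivative - v s + P (u s)) (at s within {0..t})"
      by (rule has_vector_derivative_within_subset[OF assms(3)]) (use s in auto)
    have "(- v s + P (u s)) \<bullet> u s = P (u s) \<bullet> u s - K (v s) \<bullet> v s"
      using uv[of s] s by (simp add: inner_diff_left inner_commute[of "K (v s)" "v s"])
    then show "2 * ((- v s + P (u s)) \<bullet> u s) \<le> \<kappa> * (norm (u s))\<^sup>2 + 0"
      using P_inner_le'[of "u s"] accretive[of "v s"] by simp
  qed (use t in auto)
  then show ?thesis using assms(1) by simp
qed

end

section \<open>The Hilbert space of square integrable functions\<close>

definition sq_integrable :: "(real \<Rightarrow> real) \<Rightarrow> bool" where
  "sq_integrable f \<longleftrightarrow> f \<in> borel_measurable lebesgue \<and> integrable lebesgue (\<lambda>x. (f x)\<^sup>2)"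

lemma sq_integrable_mult:
  assumes "sq_integrable f" "sq_integrable g"
  shows "integrable lebesgue (\<lambda>x. f x * g x)"
proof (rule Bochner_Integration.integrable_bound)
  show "integrable lebesgue (\<lambda>x. (f x)\<^sup>2 + (g x)\<^sup>2)"
    using assms by (auto simp: sq_integrable_def)
  show "(\<lambda>x. f x * g x) \<in> borel_measurable lebesgue"
    using assms by (auto simp: sq_integrable_def)
  have "\<bar>a * b\<bar> \<le> a\<^sup>2 + b\<^sup>2" for a b :: real
    using sum_squares_bound[of a b] sum_squares_bound[of a "- b"] by (auto simp: abs_if)
  then show "AE x in lebesgue. norm (f x * g x) \<le> norm ((f x)\<^sup>2 + (g x)\<^sup>2)" by simp
qed

lemma sq_integrable_zero [simp]: "sq_integrable (\<lambda>x. 0)"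
  by (simp add: sq_integrable_def)

lemma sq_integrable_add:
  assumes "sq_integrable f" "sq_integrable g"
  shows "sq_integrable (\<lambda>x. f x + g x)"
proof -
  have "(\<lambda>x. (f x + g x)\<^sup>2) = (\<lambda>x. (f x)\<^sup>2 + (g x)\<^sup>2 + 2 * (f x * g x))"
    by (simp add: power2_sum algebra_simps)
  then show ?thesis
    using assms sq_integrable_mult[OF assms] by (auto simp: sq_integrable_def)
qed

lemma sq_integrable_scale:
  assumes "sq_integrable f"
  shows "sq_integrable (\<lambda>x. c * f x)"
  using assms by (auto simp: sq_integrable_def power_mult_distrib)

lemma sq_integrable_minus: "sq_integrable f \<Longrightarrow> sq_integrable (\<lambda>x. - f x)"
  by (auto simp: sq_integrable_def)

lemma sq_integrable_diff:
  "sq_integrable f \<Longrightarrow> sq_integrable g \<Longrightarrow> sq_integrable (\<lambda>x. f x - g x)"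
  using sq_integrable_add[of f "\<lambda>x. - g x"] sq_integrable_minus[of g] by simp

lemma sq_integrable_abs: "sq_integrable f \<Longrightarrow> sq_integrable (\<lambda>x. \<bar>f x\<bar>)"
  by (auto simp: sq_integrable_def)

lemma sq_integrable_cut:
  assumes "sq_integrable f"
  shows "sq_integrable (\<lambda>x. if 0 < x \<and> x < l then f x else 0)"
proof -
  have "(\<lambda>x. indicat_real {0<..<l} x * f x) \<in> borel_measurable lebesgue"
    using assms unfolding sq_integrable_def by (intro borel_measurable_times borel_measurable_indicator) auto
  moreover have "(\<lambda>x. indicat_real {0<..<l} x * f x) = (\<lambda>x. if 0 < x \<and> x < l then f x else 0)"
    by (auto simp: fun_eq_iff)
  ultimately have meas: "(\<lambda>x. if 0 < x \<and> x < l then f x else 0) \<in> borel_measurable lebesgue" by simp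
  have "integrable lebesgue (\<lambda>x. (if 0 < x \<and> x < l then f x else 0)\<^sup>2)"
    by (rule Bochner_Integration.integrable_bound[where f = "\<lambda>x. (f x)\<^sup>2"])
      (use assms borel_measurable_power[OF meas] in \<open>simp_all add: sq_integrable_def\<close>)
  with meas show ?thesis by (simp add: sq_integrable_def)
qed

definition L2_rel :: "(real \<Rightarrow> real) \<Rightarrow> (real \<Rightarrow> real) \<Rightarrow> bool" where
  "L2_rel f g \<longleftrightarrow> sq_integrable f \<and> sq_integrable g \<and> (AE x in lebesgue. f x = g x)"

\<comment> \<open>The whole line is the domain since a type cannot depend on \<open>l\<close>;
  functions on (0,l) enter through the extension by zero in \<open>l2_of\<close>.\<close>
quotient_type l2 = "real \<Rightarrow> real" / partial: L2_rel
  morphisms rep_l2 abs_l2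
proof (rule part_equivpI)
  show "\<exists>f. L2_rel f f" by (rule exI[of _ "\<lambda>x. 0"]) (simp add: L2_rel_def)
  show "symp L2_rel" by (rule sympI) (auto simp: L2_rel_def elim!: eventually_mono)
  show "transp L2_rel" by (rule transpI) (auto simp: L2_rel_def elim!: eventually_elim2)
qed

instantiation l2 :: real_inner
begin

lift_definition zero_l2 :: l2 is "\<lambda>x. 0" by (simp add: L2_rel_def)

lift_definition plus_l2 :: "l2 \<Rightarrow> l2 \<Rightarrow> l2" is "\<lambda>f g x. f x + g x"
  by (auto simp: L2_rel_def intro: sq_integrable_add elim!: eventually_elim2)

lift_definition minus_l2 :: "l2 \<Rightarrow> l2 \<Rightarrow> l2" is "\<lambda>f g x. f x - g x"
  by (auto simp: L2_rel_def intro: sq_integrable_diff elim!: eventually_elim2)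

lift_definition uminus_l2 :: "l2 \<Rightarrow> l2" is "\<lambda>f x. - f x"
  by (auto simp: L2_rel_def intro: sq_integrable_minus elim!: eventually_mono)

lift_definition scaleR_l2 :: "real \<Rightarrow> l2 \<Rightarrow> l2" is "\<lambda>c f x. c * f x"
  by (auto simp: L2_rel_def intro: sq_integrable_scale elim!: eventually_mono)

lift_definition inner_l2 :: "l2 \<Rightarrow> l2 \<Rightarrow> real" is "\<lambda>f g. \<integral>x. f x * g x \<partial>lebesgue"
proof -
  fix f f' g g' assume "L2_rel f f'" "L2_rel g g'"
  then have m: "f \<in> borel_measurable lebesgue" "f' \<in> borel_measurable lebesgue"
      "g \<in> borel_measurable lebesgue" "g' \<in> borel_measurable lebesgue"
    and ae: "AE x in lebesgue. f x = f' x" "AE x in lebesgue. g x = g' x"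
    by (auto simp: L2_rel_def sq_integrable_def)
  show "(\<integral>x. f x * g x \<partial>lebesgue) = (\<integral>x. f' x * g' x \<partial>lebesgue)"
  proof (rule integral_cong_AE)
    show "AE x in lebesgue. f x * g x = f' x * g' x" using ae by eventually_elim simp
  qed (use m in auto)
qed

definition norm_l2 :: "l2 \<Rightarrow> real" where "norm_l2 x = sqrt (x \<bullet> x)"
definition dist_l2 :: "l2 \<Rightarrow> l2 \<Rightarrow> real" where "dist_l2 x y = norm (x - y)"
definition sgn_l2 :: "l2 \<Rightarrow> l2" where "sgn_l2 x = inverse (norm x) *\<^sub>R x"
definition uniformity_l2 :: "(l2 \<times> l2) filter" where
  "uniformity_l2 = (INF e\<in>{0<..}. principal {(x, y). dist x y < e})"
definition open_l2 :: "l2 set \<Rightarrow> bool" where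
  "open_l2 U = (\<forall>x\<in>U. eventually (\<lambda>(x', y). x' = x \<longrightarrow> y \<in> U) uniformity)"

instance
proof
  fix x y z :: l2 and a b r :: real
  show "x + y + z = x + (y + z)"
    by transfer (auto simp: L2_rel_def sq_integrable_add add.assoc)
  show "x + y = y + x"
    by transfer (auto simp: L2_rel_def sq_integrable_add add.commute)
  show "0 + x = x" by transfer (auto simp: L2_rel_def)
  show "- x + x = 0" by transfer (auto simp: L2_rel_def)
  show "x - y = x + - y"
    by transfer (auto simp: L2_rel_def intro: sq_integrable_diff)
  show "a *\<^sub>R (x + y) = a *\<^sub>R x + a *\<^sub>R y"
    by transfer (auto simp: L2_rel_def distrib_left intro!: sq_integrable_add sq_integrable_scale)
  show "(a + b) *\<^sub>R x = a *\<^sub>R x + b *\<^sub>R x"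
    by transfer (auto simp: L2_rel_def distrib_right intro!: sq_integrable_add sq_integrable_scale)
  show "a *\<^sub>R b *\<^sub>R x = (a * b) *\<^sub>R x"
    by transfer (auto simp: L2_rel_def mult.assoc intro!: sq_integrable_scale)
  show "1 *\<^sub>R x = x" by transfer (auto simp: L2_rel_def)
  show "x \<bullet> y = y \<bullet> x" by transfer (simp add: mult.commute)
  show "(x + y) \<bullet> z = x \<bullet> z + y \<bullet> z"
    by transfer (simp add: L2_rel_def distrib_right sq_integrable_mult)
  show "(r *\<^sub>R x) \<bullet> y = r * (x \<bullet> y)" by transfer (simp add: mult.assoc)
  show "0 \<le> x \<bullet> x" by transfer simp
  show "x \<bullet> x = 0 \<longleftrightarrow> x = 0"
    by transfer (auto simp: L2_rel_def sq_integrable_mult integral_nonneg_eq_0_iff_AE)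
qed (simp_all add: norm_l2_def dist_l2_def sgn_l2_def uniformity_l2_def open_l2_def)

end

lemma abs_l2_rep: "\<exists>f. sq_integrable f \<and> abs_l2 f = x"
  by (rule exI[of _ "rep_l2 x"])
    (use Quotient3_abs_rep[OF Quotient3_l2, of x] Quotient3_rep_reflp[OF Quotient3_l2, of x]
      in \<open>auto simp: L2_rel_def\<close>)

lemma abs_l2_eq_iff:
  assumes "sq_integrable f" "sq_integrable g"
  shows "abs_l2 f = abs_l2 g \<longleftrightarrow> (AE x in lebesgue. f x = g x)"
  using assms Quotient3_rel[OF Quotient3_l2, of f g] by (auto simp: L2_rel_def)

lemma abs_l2_ops:
  assumes "sq_integrable f" "sq_integrable g"
  shows "abs_l2 f + abs_l2 g = abs_l2 (\<lambda>x. f x + g x)"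
    and "abs_l2 f - abs_l2 g = abs_l2 (\<lambda>x. f x - g x)"
    and "c *\<^sub>R abs_l2 f = abs_l2 (\<lambda>x. c * f x)"
    and "abs_l2 f \<bullet> abs_l2 g = (\<integral>x. f x * g x \<partial>lebesgue)"
  using assms
  by (auto simp: L2_rel_def plus_l2.abs_eq minus_l2.abs_eq scaleR_l2.abs_eq inner_l2.abs_eq)

lemma norm_abs_l2:
  assumes "sq_integrable f"
  shows "(norm (abs_l2 f))\<^sup>2 = (\<integral>x. (f x)\<^sup>2 \<partial>lebesgue)"
  using abs_l2_ops(4)[OF assms assms] by (simp add: power2_norm_eq_inner power2_eq_square[of "f _"])

lemma nn_integral_abs_l2:
  assumes "sq_integrable f"
  shows "(\<integral>\<^sup>+x. ennreal ((f x)\<^sup>2) \<partial>lebesgue) = ennreal ((norm (abs_l2 f))\<^sup>2)"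
  unfolding norm_abs_l2[OF assms]
  using assms by (intro nn_integral_eq_integral) (auto simp: sq_integrable_def)

lemma norm_abs_l2_abs: "sq_integrable f \<Longrightarrow> norm (abs_l2 (\<lambda>x. \<bar>f x\<bar>)) = norm (abs_l2 f)"
  by (rule power2_eq_imp_eq) (simp_all add: norm_abs_l2 sq_integrable_abs)

lemma sq_integrable_sum:
  "(\<And>i. i < (n::nat) \<Longrightarrow> sq_integrable (g i)) \<Longrightarrow> sq_integrable (\<lambda>x. \<Sum>i<n. g i x)"
  by (induction n) (auto intro: sq_integrable_add)

lemma norm_abs_l2_sum_le:
  "(\<And>i. i < (n::nat) \<Longrightarrow> sq_integrable (g i)) \<Longrightarrow>
    norm (abs_l2 (\<lambda>x. \<Sum>i<n. g i x)) \<le> (\<Sum>i<n. norm (abs_l2 (g i)))"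
proof (induction n)
  case 0
  have "(norm (abs_l2 (\<lambda>x. 0)))\<^sup>2 = 0" by (subst norm_abs_l2) auto
  then show ?case by simp
next
  case (Suc n)
  have "abs_l2 (\<lambda>x. \<Sum>i<Suc n. g i x) = abs_l2 (\<lambda>x. \<Sum>i<n. g i x) + abs_l2 (g n)"
    using Suc.prems by (subst abs_l2_ops) (auto intro: sq_integrable_sum)
  then show ?case using Suc norm_triangle_ineq[of "abs_l2 (\<lambda>x. \<Sum>i<n. g i x)" "abs_l2 (g n)"] by force
qed

text \<open>Riesz--Fischer: a rapidly converging subsequence converges almost everywhere.\<close>

instance l2 :: banach
proof
  fix X :: "nat \<Rightarrow> l2" assume "Cauchy X"
  have "\<forall>k. \<exists>N. \<forall>m\<ge>N. \<forall>n\<ge>N. norm (X m - X n) < (1/2) ^ k"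
    using \<open>Cauchy X\<close> by (auto simp: Cauchy_iff)
  then obtain N where N: "\<And>k m n. m \<ge> N k \<Longrightarrow> n \<ge> N k \<Longrightarrow> norm (X m - X n) < (1/2) ^ k" by metis
  \<comment> \<open>Partial sums make \<open>r m\<close> at least \<open>N k\<close> whenever
    \<open>m\<close> is at least \<open>k\<close>, so consecutive terms of the subsequence differ by
    less than \<open>(1/2) ^ k\<close>.\<close>
  define r where "r = (\<lambda>k. \<Sum>i\<le>k. N i)"
  have r: "N k \<le> r m" if "k \<le> m" for k m
    unfolding r_def using that by (intro member_le_sum) auto
  have "\<forall>n. \<exists>f. sq_integrable f \<and> abs_l2 f = X (r n)" using abs_l2_rep by blast
  then obtain f where f: "\<And>n. sq_integrable (f n)" "\<And>n. abs_l2 (f n) = X (r n)" by metis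
  define g where "g = (\<lambda>k x. \<bar>f (Suc k) x - f k x\<bar>)"
  have g: "sq_integrable (g k)" for k
    unfolding g_def by (intro sq_integrable_abs sq_integrable_diff f)
  have ng: "norm (abs_l2 (g k)) \<le> (1/2) ^ k" for k
  proof -
    have "norm (abs_l2 (g k)) = norm (X (r (Suc k)) - X (r k))"
      unfolding g_def by (simp add: norm_abs_l2_abs sq_integrable_diff f abs_l2_ops(2)[symmetric])
    then show ?thesis using N[of k "r (Suc k)" "r k"] r[of k k] r[of k "Suc k"] by simp
  qed
  define G where "G = (\<lambda>n x. \<Sum>k<n. g k x)"
  have G: "sq_integrable (G n)" for n unfolding G_def by (intro sq_integrable_sum g)
  have G_meas [measurable]: "G n \<in> borel_measurable lebesgue" for n using G by (simp add: sq_integrable_def)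
  have G0: "0 \<le> G n x" for n x by (auto simp: G_def g_def intro: sum_nonneg)
  have G_mono: "G n x \<le> G (Suc n) x" for n x by (simp add: G_def g_def)
  \<comment> \<open>The bound is the square of the geometric sum 2. By monotone convergence the
    supremum of the partial sums is then finite almost everywhere, which gives absolute convergence
    of the telescoping series.\<close>
  have intG: "(\<integral>\<^sup>+x. ennreal ((G n x)\<^sup>2) \<partial>lebesgue) \<le> 4" for n
  proof -
    have "norm (abs_l2 (G n)) \<le> (\<Sum>k<n. (1/2) ^ k)"
      unfolding G_def by (rule order_trans[OF norm_abs_l2_sum_le[OF g] sum_mono[OF ng]])
    also have "\<dots> \<le> 2" by (simp add: geometric_sum)
    finally have "(norm (abs_l2 (G n)))\<^sup>2 \<le> 2\<^sup>2" by (intro power_mono) auto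
    then show ?thesis unfolding nn_integral_abs_l2[OF G] using ennreal_leI by fastforce
  qed
  have "(\<integral>\<^sup>+x. (SUP n. ennreal ((G n x)\<^sup>2)) \<partial>lebesgue) = (SUP n. \<integral>\<^sup>+x. ennreal ((G n x)\<^sup>2) \<partial>lebesgue)"
    by (rule nn_integral_monotone_convergence_SUP)
      (auto intro!: incseq_SucI ennreal_leI power_mono G0 G_mono simp: le_fun_def)
  also have "\<dots> \<le> 4" by (rule SUP_least) (rule intG)
  also have "(4::ennreal) < \<infinity>" by simp
  finally have "AE x in lebesgue. (SUP n. ennreal ((G n x)\<^sup>2)) \<noteq> \<infinity>"
    by (intro nn_integral_PInf_AE) auto
  then have conv: "AE x in lebesgue. convergent (\<lambda>n. f n x)"
  proof eventually_elim
    fix x assume fin: "(SUP n. ennreal ((G n x)\<^sup>2)) \<noteq> \<infinity>"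
    then obtain c where c: "(SUP n. ennreal ((G n x)\<^sup>2)) = ennreal c" "c \<ge> 0"
      by (cases "SUP n. ennreal ((G n x)\<^sup>2)") auto
    have "G n x \<le> sqrt c" for n
    proof -
      have "ennreal ((G n x)\<^sup>2) \<le> ennreal c" unfolding c(1)[symmetric] by (rule SUP_upper) simp
      then show ?thesis using c(2) by (simp add: real_le_rsqrt)
    qed
    then have "summable (\<lambda>k. g k x)"
      by (intro summableI_nonneg_bounded[of _ "sqrt c"]) (auto simp: G_def g_def)
    then have "summable (\<lambda>k. f (Suc k) x - f k x)"
      unfolding g_def by (rule summable_rabs_cancel)
    then have "convergent (\<lambda>n. \<Sum>k<n. f (Suc k) x - f k x)"
      by (simp add: summable_iff_convergent)
    moreover have "(\<Sum>k<n. f (Suc k) x - f k x) = f n x - f 0 x" for n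
      by (induction n) simp_all
    ultimately have "convergent (\<lambda>n. f n x - f 0 x)" by simp
    then show "convergent (\<lambda>n. f n x)" using convergent_diff_const_right_iff by blast
  qed
  define h where "h = (\<lambda>x. lim (\<lambda>n. f n x))"
  have f_meas [measurable]: "f n \<in> borel_measurable lebesgue" for n using f by (simp add: sq_integrable_def)
  have h_meas [measurable]: "h \<in> borel_measurable lebesgue"
    unfolding h_def by measurable
  \<comment> \<open>Fatou's lemma turns the Cauchy estimate into a bound for the distance to the
    limit, which in turn shows that \<open>h\<close> is square integrable.\<close>
  have est: "(\<integral>\<^sup>+x. ennreal ((h x - f k x)\<^sup>2) \<partial>lebesgue) \<le> ennreal (((1/2) ^ k)\<^sup>2)" for k
  proof -
    have "(\<integral>\<^sup>+x. ennreal ((h x - f k x)\<^sup>2) \<partial>lebesgue)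
        = (\<integral>\<^sup>+x. liminf (\<lambda>m. ennreal ((f m x - f k x)\<^sup>2)) \<partial>lebesgue)"
    proof (rule nn_integral_cong_AE)
      show "AE x in lebesgue. ennreal ((h x - f k x)\<^sup>2) = liminf (\<lambda>m. ennreal ((f m x - f k x)\<^sup>2))"
        using conv
      proof eventually_elim
        fix x assume "convergent (\<lambda>n. f n x)"
        then have "(\<lambda>n. f n x) \<longlonglongrightarrow> h x" by (simp add: h_def convergent_LIMSEQ_iff)
        then have "(\<lambda>m. ennreal ((f m x - f k x)\<^sup>2)) \<longlonglongrightarrow> ennreal ((h x - f k x)\<^sup>2)"
          by (intro tendsto_ennrealI tendsto_intros)
        then show "ennreal ((h x - f k x)\<^sup>2) = liminf (\<lambda>m. ennreal ((f m x - f k x)\<^sup>2))"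
          by (intro lim_imp_Liminf[symmetric]) auto
      qed
    qed
    also have "\<dots> \<le> liminf (\<lambda>m. \<integral>\<^sup>+x. ennreal ((f m x - f k x)\<^sup>2) \<partial>lebesgue)"
      by (rule nn_integral_liminf) measurable
    also have "\<dots> \<le> ennreal (((1/2) ^ k)\<^sup>2)"
    proof -
      have "(\<integral>\<^sup>+x. ennreal ((f m x - f k x)\<^sup>2) \<partial>lebesgue) \<le> ennreal (((1/2) ^ k)\<^sup>2)" if "m \<ge> k" for m
      proof -
        have "norm (abs_l2 (\<lambda>x. f m x - f k x)) \<le> (1/2) ^ k"
          using N[of k "r m" "r k"] r[of k k] r[OF that]
          by (simp add: abs_l2_ops(2)[symmetric] f)
        then show ?thesis
          by (subst nn_integral_abs_l2) (auto intro!: sq_integrable_diff f ennreal_leI power_mono)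
      qed
      then show ?thesis
        by (intro Liminf_le) (auto simp: eventually_sequentially)
    qed
    finally show ?thesis .
  qed
  have hf: "sq_integrable (\<lambda>x. h x - f k x)" for k
    using le_less_trans[OF est[of k] ennreal_less_top]
    by (auto simp: sq_integrable_def integrable_iff_bounded)
  have h: "sq_integrable h"
    using sq_integrable_add[OF hf[of 0] f(1)[of 0]] by simp
  have dist_h: "norm (abs_l2 h - X (r k)) \<le> (1/2) ^ k" for k
  proof -
    have "ennreal ((norm (abs_l2 h - X (r k)))\<^sup>2) \<le> ennreal (((1/2) ^ k)\<^sup>2)"
      using est[of k] by (simp add: nn_integral_abs_l2 hf f(2)[symmetric] abs_l2_ops(2) h f(1))
    then show ?thesis by (simp add: power2_le_iff_abs_le)
  qed
  have "X \<longlonglongrightarrow> abs_l2 h"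
  proof (rule LIMSEQ_I)
    fix e :: real assume e: "e > 0"
    obtain k where k: "(1/2) ^ k < e / 2" using real_arch_pow_inv[of "e / 2" "1/2"] e by auto
    show "\<exists>M. \<forall>m\<ge>M. norm (X m - abs_l2 h) < e"
    proof (intro exI allI impI)
      fix m assume "m \<ge> N k"
      then have "norm (X m - X (r k)) < (1/2) ^ k" using N r[of k k] by blast
      then show "norm (X m - abs_l2 h) < e"
        using dist_h[of k] k norm_triangle_ineq4[of "X m - X (r k)" "abs_l2 h - X (r k)"] by simp
    qed
  qed
  then show "convergent X" by (auto simp: convergent_def)
qed

section \<open>Smooth functions with compact support\<close>

definition smooth :: "(real \<Rightarrow> real) \<Rightarrow> bool" where
  "smooth f \<longleftrightarrow> (\<forall>n y. (deriv ^^ n) f field_differentiable at y)"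

text \<open>Spares formulas for higher derivatives: it suffices to exhibit a family that is closed
  under differentiation.\<close>

lemma smooth_coinduct:
  assumes "f \<in> S" and step: "\<And>f. f \<in> S \<Longrightarrow> \<exists>f'\<in>S. \<forall>x. (f has_real_derivative f' x) (at x)"
  shows "smooth f"
proof -
  have "(deriv ^^ n) f \<in> S" for n
  proof (induction n)
    case (Suc n)
    then obtain f' where f': "f' \<in> S" "\<forall>x. ((deriv ^^ n) f has_real_derivative f' x) (at x)"
      using step by blast
    then have "deriv ((deriv ^^ n) f) = f'" by (auto intro!: DERIV_imp_deriv)
    then show ?case using f' by simp
  qed (use assms in simp)
  then show ?thesis unfolding smooth_def field_differentiable_def using step by blast
qed

lemma smooth_deriv:
  assumes "smooth f"
  shows "(f has_real_derivative deriv f x) (at x)" and "smooth (deriv f)"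
proof -
  have "f field_differentiable at x" using assms unfolding smooth_def by (metis funpow_0)
  then show "(f has_real_derivative deriv f x) (at x)"
    by (simp add: field_differentiable_derivI)
  show "smooth (deriv f)"
    unfolding smooth_def
  proof (intro allI)
    fix n y
    have "(deriv ^^ Suc n) f field_differentiable at y" using assms unfolding smooth_def by blast
    then show "(deriv ^^ n) (deriv f) field_differentiable at y" by (simp add: funpow_swap1)
  qed
qed

lemma smooth_continuous: "smooth f \<Longrightarrow> continuous_on S f"
  by (meson smooth_deriv(1) DERIV_isCont continuous_at_imp_continuous_on)

lemma smooth_add_scale:
  assumes "smooth f" "smooth g"
  shows "smooth (\<lambda>x. f x + c * g x)"
proof (rule smooth_coinduct[of _ "{\<lambda>x. f x + c * g x | f g. smooth f \<and> smooth g}"])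
  fix h assume "h \<in> {\<lambda>x. f x + c * g x | f g. smooth f \<and> smooth g}"
  then obtain f g where h: "h = (\<lambda>x. f x + c * g x)" and fg: "smooth f" "smooth g" by blast
  have "(h has_real_derivative deriv f x + c * deriv g x) (at x)" for x
    unfolding h by (intro DERIV_add DERIV_cmult smooth_deriv fg)
  then show "\<exists>h'\<in>{\<lambda>x. f x + c * g x | f g. smooth f \<and> smooth g}. \<forall>x. (h has_real_derivative h' x) (at x)"
    using smooth_deriv(2)[OF fg(1)] smooth_deriv(2)[OF fg(2)]
    by (intro bexI[of _ "\<lambda>x. deriv f x + c * deriv g x"]) auto
qed (use assms in blast)

text \<open>The flat function exp(-1/x), glued to zero. The polynomial factor in
  \<open>1 / x\<close> closes the family under differentiation, which replaces p by X^2 (p -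
  p').\<close>

definition flat_exp :: "real poly \<Rightarrow> real \<Rightarrow> real" where
  "flat_exp p x = (if x > 0 then poly p (1 / x) * exp (- (1 / x)) else 0)"

lemma poly_exp_tendsto_0: "((\<lambda>y. poly p y * exp (- y)) \<longlongrightarrow> (0::real)) at_top"
proof -
  have "((\<lambda>y. \<Sum>i\<le>degree p. coeff p i * (y ^ i / exp y)) \<longlongrightarrow> (\<Sum>i\<le>degree p. coeff p i * (0::real))) at_top"
    by (intro tendsto_sum tendsto_mult tendsto_const tendsto_power_div_exp_0)
  then show ?thesis
    by (simp add: poly_altdef exp_minus sum_divide_distrib divide_inverse sum_distrib_right mult.assoc)
qed

lemma flat_exp_derivative:
  "(flat_exp p has_real_derivative flat_exp ([:0, 0, 1:] * (p - pderiv p)) x) (at x)"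
proof (cases x "0::real" rule: linorder_cases)
  case less
  have "((\<lambda>x. 0) has_real_derivative flat_exp ([:0, 0, 1:] * (p - pderiv p)) x) (at x)"
    using less by (simp add: flat_exp_def)
  then show ?thesis
    by (rule has_field_derivative_transform_within_open[of _ _ _ "{..<0}"])
      (use less in \<open>auto simp: flat_exp_def\<close>)
next
  case greater
  have "((\<lambda>x. poly p (1 / x) * exp (- (1 / x))) has_real_derivative
      poly p (1 / x) * (exp (- (1 / x)) * (1 / x\<^sup>2)) + (poly (pderiv p) (1 / x) * (- (1 / x\<^sup>2))) * exp (- (1 / x))) (at x)"
    using greater
    by (auto intro!: derivative_eq_intros DERIV_chain2[OF poly_DERIV] simp: field_simps power2_eq_square)
  also have "poly p (1 / x) * (exp (- (1 / x)) * (1 / x\<^sup>2)) + (poly (pderiv p) (1 / x) * (- (1 / x\<^sup>2))) * exp (- (1 / x))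
      = flat_exp ([:0, 0, 1:] * (p - pderiv p)) x"
    using greater by (simp add: flat_exp_def algebra_simps power2_eq_square)
  finally show ?thesis
    by (rule has_field_derivative_transform_within_open[of _ _ _ "{0<..}"])
      (use greater in \<open>auto simp: flat_exp_def\<close>)
next
  case equal
  \<comment> \<open>With \<open>y = inverse h\<close> the difference quotient is
    \<open>y * poly p y * exp (- y)\<close>; \<open>pCons 0 p\<close> is multiplication of
    \<open>p\<close> by the variable.\<close>
  have "((\<lambda>h. flat_exp p h / h) \<longlongrightarrow> 0) (at_right 0)"
  proof (rule Lim_transform_eventually)
    have "((\<lambda>h. poly (pCons 0 p) (inverse h) * exp (- inverse h)) \<longlongrightarrow> 0) (at_right (0::real))"
      by (rule filterlim_compose[OF poly_exp_tendsto_0 filterlim_inverse_at_top_right])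
    then show "((\<lambda>h. poly (pCons 0 p) (inverse h) * exp (- inverse h)) \<longlongrightarrow> 0) (at_right (0::real))" .
    show "\<forall>\<^sub>F h in at_right 0. poly (pCons 0 p) (inverse h) * exp (- inverse h) = flat_exp p h / h"
      by (auto simp: eventually_at_filter flat_exp_def inverse_eq_divide)
  qed
  moreover have "((\<lambda>h. flat_exp p h / h) \<longlongrightarrow> 0) (at_left 0)"
    by (rule Lim_transform_eventually[OF tendsto_const])
      (auto simp: eventually_at_filter flat_exp_def)
  ultimately have "((\<lambda>h. flat_exp p h / h) \<longlongrightarrow> 0) (at 0)"
    by (rule filterlim_split_at_real[rotated])
  then show ?thesis using equal by (simp add: DERIV_def flat_exp_def)
qed

text \<open>The product rule turns one product of flat functions into two, so sums are included to
  make the family closed under differentiation.\<close>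

inductive_set bumps :: "real \<Rightarrow> real \<Rightarrow> real \<Rightarrow> (real \<Rightarrow> real) set" for a b k where
  base: "(\<lambda>x. c * (flat_exp p (k * (x - a)) * flat_exp q (k * (b - x)))) \<in> bumps a b k"
| add: "f \<in> bumps a b k \<Longrightarrow> g \<in> bumps a b k \<Longrightarrow> (\<lambda>x. f x + g x) \<in> bumps a b k"

lemma bumps_derivative:
  "f \<in> bumps a b k \<Longrightarrow> \<exists>f'\<in>bumps a b k. \<forall>x. (f has_real_derivative f' x) (at x)"
proof (induction rule: bumps.induct)
  case (base c p q)
  define D where "D = (\<lambda>p. [:0, 0, 1:] * (p - pderiv p) :: real poly)"
  have 1: "((\<lambda>x. flat_exp p (k * (x - a))) has_real_derivative flat_exp (D p) (k * (x - a)) * k) (at x)" for x p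
    unfolding D_def by (rule DERIV_chain2[OF flat_exp_derivative]) (auto intro!: derivative_eq_intros)
  have 2: "((\<lambda>x. flat_exp q (k * (b - x))) has_real_derivative flat_exp (D q) (k * (b - x)) * (- k)) (at x)" for x q
    unfolding D_def by (rule DERIV_chain2[OF flat_exp_derivative]) (auto intro!: derivative_eq_intros)
  let ?f' = "\<lambda>x. (c * k) * (flat_exp (D p) (k * (x - a)) * flat_exp q (k * (b - x)))
      + (- (c * k)) * (flat_exp p (k * (x - a)) * flat_exp (D q) (k * (b - x)))"
  have "((\<lambda>x. c * (flat_exp p (k * (x - a)) * flat_exp q (k * (b - x)))) has_real_derivative ?f' x) (at x)" for x
    by (rule DERIV_cong[OF DERIV_cmult[OF DERIV_mult[OF 1 2]]]) (simp add: algebra_simps)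
  moreover have "?f' \<in> bumps a b k" by (intro bumps.intros)
  ultimately show ?case by (intro bexI[of _ ?f'] allI)
next
  case (add f g)
  then obtain f' g' where "f' \<in> bumps a b k" "g' \<in> bumps a b k"
    "\<forall>x. (f has_real_derivative f' x) (at x)" "\<forall>x. (g has_real_derivative g' x) (at x)" by blast
  then show ?case by (intro bexI[of _ "\<lambda>x. f' x + g' x"]) (auto intro: bumps.add DERIV_add)
qed

text \<open>Larger \<open>k\<close> steepens both flanks: the bumps tend to the indicator of (a,b)
  while staying between 0 and 1, as dominated convergence requires.\<close>

definition bump :: "real \<Rightarrow> real \<Rightarrow> real \<Rightarrow> real \<Rightarrow> real" where
  "bump a b k x = flat_exp 1 (k * (x - a)) * flat_exp 1 (k * (b - x))"

lemma bump_smooth: "smooth (bump a b k)"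
proof (rule smooth_coinduct[OF _ bumps_derivative])
  show "bump a b k \<in> bumps a b k"
    using bumps.base[of 1 1 k a 1 b] by (simp add: bump_def[abs_def])
qed

lemma bump_zero: "k > 0 \<Longrightarrow> x \<notin> {a<..<b} \<Longrightarrow> bump a b k x = 0"
  by (auto simp: bump_def flat_exp_def zero_less_mult_iff)

lemma bump_pos: "k > 0 \<Longrightarrow> x \<in> {a<..<b} \<Longrightarrow> bump a b k x > 0"
  by (auto simp: bump_def flat_exp_def)

lemma bump_bounds: "0 \<le> bump a b k x" "bump a b k x \<le> 1"
proof -
  have "0 \<le> flat_exp 1 y \<and> flat_exp 1 y \<le> 1" for y by (auto simp: flat_exp_def)
  then show "0 \<le> bump a b k x" "bump a b k x \<le> 1"
    unfolding bump_def by (auto intro: mult_le_one)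
qed

lemma bump_tendsto_indicator: "(\<lambda>n. bump a b (real (Suc n)) x) \<longlonglongrightarrow> indicator {a<..<b} x"
proof (cases "x \<in> {a<..<b}")
  case True
  have lim: "(\<lambda>n. flat_exp 1 (real (Suc n) * y)) \<longlonglongrightarrow> 1" if "y > 0" for y
  proof -
    have "(\<lambda>n. exp (- (inverse (real (Suc n)) * (1 / y)))) \<longlonglongrightarrow> exp (- (0 * (1 / y)))"
      by (intro tendsto_intros LIMSEQ_inverse_real_of_nat)
    then show ?thesis using that by (simp add: flat_exp_def inverse_eq_divide)
  qed
  have "(\<lambda>n. bump a b (real (Suc n)) x) \<longlonglongrightarrow> 1 * 1"
    unfolding bump_def by (intro tendsto_mult lim) (use True in auto)
  then show ?thesis using True by simp
next
  case False
  then have "(\<lambda>n. bump a b (real (Suc n)) x) = (\<lambda>n. 0)" by (intro ext bump_zero) auto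
  then show ?thesis using False by simp
qed

lemma test_functions_iff:
  "\<phi> \<in> test_functions l \<longleftrightarrow> smooth \<phi> \<and> (\<exists>a b. 0 < a \<and> b < l \<and> (\<forall>y. y \<notin> {a..b} \<longrightarrow> \<phi> y = 0))"
  by (simp add: test_functions_def smooth_def)

lemma bump_test_function:
  assumes "0 < a" "b < l" "k > 0"
  shows "bump a b k \<in> test_functions l"
  unfolding test_functions_iff using assms bump_smooth bump_zero[OF assms(3)]
  by (intro conjI exI[of _ a] exI[of _ b]) auto

section \<open>Weak derivatives on an interval\<close>

abbreviation \<Omega> :: "real \<Rightarrow> real measure" where "\<Omega> l \<equiv> lebesgue_on {0<..<l}"

lemma finite_measure_\<Omega>: "finite_measure (\<Omega> l)"
  by (intro finite_measure_lebesgue_on bounded_set_imp_lmeasurable) auto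

lemma integrable_\<Omega>_iff: "integrable (\<Omega> l) u \<longleftrightarrow> integrable lebesgue (\<lambda>x. if 0 < x \<and> x < l then u x else (0::real))"
  using Lebesgue_Measure.integrable_restrict_UNIV[of "{0<..<l}" u] by simp

lemma integral_\<Omega>: "(\<integral>x. u x \<partial>\<Omega> l) = (\<integral>x. (if 0 < x \<and> x < l then u x else (0::real)) \<partial>lebesgue)"
  using Lebesgue_Measure.integral_restrict_UNIV[of "{0<..<l}" u] by simp

lemma borel_measurable_\<Omega>_iff:
  "u \<in> borel_measurable (\<Omega> l) \<longleftrightarrow> (\<lambda>x. if 0 < x \<and> x < l then u x else (0::real)) \<in> borel_measurable lebesgue"
  using borel_measurable_if[of "{0<..<l}" u] by simp

lemma AE_\<Omega>_iff: "(AE x in \<Omega> l. P x) \<longleftrightarrow> (AE x in lebesgue. 0 < x \<and> x < l \<longrightarrow> P x)"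
  by (subst AE_restrict_space_iff) auto

lemma AE_\<Omega>I: "(\<And>x. 0 < x \<Longrightarrow> x < l \<Longrightarrow> P x) \<Longrightarrow> AE x in \<Omega> l. P x"
  by (rule AE_I2) auto

section \<open>Almost everywhere equality and square integrability on (0,l)\<close>

lemma ae_eq_refl [simp]: "ae_eq l u u" by (simp add: ae_eq_def)

lemma ae_eq_sym: "ae_eq l u v \<Longrightarrow> ae_eq l v u"
  unfolding ae_eq_def by (elim eventually_mono) simp

lemma ae_eq_trans:
  assumes "ae_eq l u v" "ae_eq l v w" shows "ae_eq l u w"
  using assms unfolding ae_eq_def by eventually_elim simp

lemma ae_eqI: "(\<And>x. 0 < x \<Longrightarrow> x < l \<Longrightarrow> u x = v x) \<Longrightarrow> ae_eq l u v"
  unfolding ae_eq_def by (rule AE_\<Omega>I)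

lemma borel_measurable_ae_eq:
  assumes "u \<in> borel_measurable (\<Omega> l)" "ae_eq l u v"
  shows "v \<in> borel_measurable (\<Omega> l)"
  using assms(1) unfolding borel_measurable_\<Omega>_iff
proof (rule borel_measurable_AE)
  show "AE x in lebesgue. (if 0 < x \<and> x < l then u x else 0) = (if 0 < x \<and> x < l then v x else 0)"
    using assms(2) unfolding ae_eq_def AE_\<Omega>_iff by (elim eventually_mono) simp
qed

lemma integral_ae_eq:
  assumes "u \<in> borel_measurable (\<Omega> l)" "ae_eq l u v"
  shows "(\<integral>x. u x \<partial>\<Omega> l) = (\<integral>x. v x \<partial>\<Omega> l)"
  by (rule integral_cong_AE) (use assms borel_measurable_ae_eq[OF assms] in \<open>simp_all add: ae_eq_def\<close>)

lemma integrable_ae_eq: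
  assumes "integrable (\<Omega> l) u" "ae_eq l u v"
  shows "integrable (\<Omega> l) v"
proof -
  have u: "u \<in> borel_measurable (\<Omega> l)" by (rule borel_measurable_integrable[OF assms(1)])
  show ?thesis
    using assms integrable_cong_AE[OF u borel_measurable_ae_eq[OF u assms(2)]] by (simp add: ae_eq_def)
qed

lemma L2_iff_sq_integrable: "u \<in> L2 l \<longleftrightarrow> sq_integrable (\<lambda>x. if 0 < x \<and> x < l then u x else 0)"
proof -
  have "(\<lambda>x. (if 0 < x \<and> x < l then u x else 0)\<^sup>2) = (\<lambda>x. if 0 < x \<and> x < l then (u x)\<^sup>2 else 0)" by auto
  then show ?thesis
    by (simp add: L2_def sq_integrable_def borel_measurable_\<Omega>_iff integrable_\<Omega>_iff)
qed

lemma L2_add: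
  assumes "u \<in> L2 l" "v \<in> L2 l" shows "(\<lambda>x. u x + v x) \<in> L2 l"
proof -
  have "(\<lambda>x. if 0 < x \<and> x < l then u x + v x else 0)
      = (\<lambda>x. (if 0 < x \<and> x < l then u x else 0) + (if 0 < x \<and> x < l then v x else 0))" by auto
  then show ?thesis using sq_integrable_add assms by (simp add: L2_iff_sq_integrable)
qed

lemma L2_scale:
  assumes "u \<in> L2 l" shows "(\<lambda>x. c * u x) \<in> L2 l"
proof -
  have "(\<lambda>x. if 0 < x \<and> x < l then c * u x else 0) = (\<lambda>x. c * (if 0 < x \<and> x < l then u x else 0))" by auto
  then show ?thesis using sq_integrable_scale assms by (simp add: L2_iff_sq_integrable)
qed

lemma L2_minus: "u \<in> L2 l \<Longrightarrow> (\<lambda>x. - u x) \<in> L2 l"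
  using L2_scale[of u l "- 1"] by simp

lemma L2_diff: "u \<in> L2 l \<Longrightarrow> v \<in> L2 l \<Longrightarrow> (\<lambda>x. u x - v x) \<in> L2 l"
  using L2_add[of u l "\<lambda>x. - v x"] L2_minus[of v l] by simp

lemma L2_ae_eq:
  assumes "u \<in> L2 l" "ae_eq l u v" shows "v \<in> L2 l"
proof -
  have "ae_eq l (\<lambda>x. (u x)\<^sup>2) (\<lambda>x. (v x)\<^sup>2)"
    using assms(2) unfolding ae_eq_def by (elim eventually_mono) simp
  from integrable_ae_eq[OF _ this] borel_measurable_ae_eq[OF _ assms(2)]
  show ?thesis using assms(1) by (simp add: L2_def)
qed

lemma L2_mult_integrable:
  assumes "u \<in> L2 l" "v \<in> L2 l" shows "integrable (\<Omega> l) (\<lambda>x. u x * v x)"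
proof -
  have "(\<lambda>x. if 0 < x \<and> x < l then u x * v x else 0)
      = (\<lambda>x. (if 0 < x \<and> x < l then u x else 0) * (if 0 < x \<and> x < l then v x else 0))" by auto
  then show ?thesis using sq_integrable_mult assms by (simp add: L2_iff_sq_integrable integrable_\<Omega>_iff)
qed

lemma L2_measurable: "u \<in> L2 l \<Longrightarrow> u \<in> borel_measurable (\<Omega> l)"
  by (simp add: L2_def)

lemma L2_integrable: "u \<in> L2 l \<Longrightarrow> integrable (\<Omega> l) u"
  by (rule finite_measure.square_integrable_imp_integrable[OF finite_measure_\<Omega>]) (auto simp: L2_def)

lemma L2_bounded:
  assumes "u \<in> borel_measurable (\<Omega> l)" "\<And>x. 0 < x \<Longrightarrow> x < l \<Longrightarrow> \<bar>u x\<bar> \<le> B"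
  shows "u \<in> L2 l"
proof -
  interpret finite_measure "\<Omega> l" by (rule finite_measure_\<Omega>)
  have "integrable (\<Omega> l) (\<lambda>x. (u x)\<^sup>2)"
  proof (rule integrable_const_bound[where B = "B\<^sup>2"])
    show "AE x in \<Omega> l. norm ((u x)\<^sup>2) \<le> B\<^sup>2"
      by (rule AE_\<Omega>I) (use assms(2) power_mono[of "\<bar>u _\<bar>" B 2] in auto)
  qed (use assms(1) in measurable)
  then show ?thesis using assms(1) by (simp add: L2_def)
qed

lemma L2_indicator_mult:
  assumes "u \<in> L2 l" "A \<in> sets borel" shows "(\<lambda>x. indicator A x * u x) \<in> L2 l"
proof -
  have A: "A \<in> sets lebesgue" using assms(2) by simp
  have "indicat_real A \<in> borel_measurable (\<Omega> l)"
    by (rule measurable_restrict_space1) (use A in simp)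
  then have m: "(\<lambda>x. indicator A x * u x) \<in> borel_measurable (\<Omega> l)"
    using L2_measurable[OF assms(1)] by (rule borel_measurable_times)
  have "integrable (\<Omega> l) (\<lambda>x. (indicator A x * u x)\<^sup>2)"
  proof (rule Bochner_Integration.integrable_bound)
    show "integrable (\<Omega> l) (\<lambda>x. (u x)\<^sup>2)" using assms(1) by (simp add: L2_def)
    show "AE x in \<Omega> l. norm ((indicator A x * u x)\<^sup>2) \<le> norm ((u x)\<^sup>2)"
      by (rule AE_I2) (auto simp: indicator_def)
  qed (use m in measurable)
  with m show ?thesis by (simp add: L2_def)
qed

lemma continuous_on_imp_L2:
  assumes "continuous_on {0..l} u"
  shows "u \<in> L2 l"
proof -
  have "compact (u ` {0..l})" by (rule compact_continuous_image[OF assms]) simp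
  then obtain B where B: "\<And>x. x \<in> {0..l} \<Longrightarrow> norm (u x) \<le> B" by (meson bounded_iff compact_imp_bounded image_eqI)
  show ?thesis
  proof (rule L2_bounded)
    show "u \<in> borel_measurable (\<Omega> l)"
      by (rule continuous_imp_measurable_on_sets_lebesgue)
        (auto intro: continuous_on_subset[OF assms])
    show "\<bar>u x\<bar> \<le> B" if "0 < x" "x < l" for x using B[of x] that by simp
  qed
qed

text \<open>Extension by zero hides the values of \<open>u\<close> off (0,l), so that equality in
  \<open>l2\<close> is precisely \<open>ae_eq l\<close>.\<close>

definition l2_of :: "real \<Rightarrow> (real \<Rightarrow> real) \<Rightarrow> l2" where
  "l2_of l u = abs_l2 (\<lambda>x. if 0 < x \<and> x < l then u x else 0)"

lemma l2_of_inner: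
  assumes "u \<in> L2 l" "v \<in> L2 l"
  shows "l2_of l u \<bullet> l2_of l v = (\<integral>x. u x * v x \<partial>\<Omega> l)"
proof -
  have "(\<lambda>x. if 0 < x \<and> x < l then u x * v x else 0)
      = (\<lambda>x. (if 0 < x \<and> x < l then u x else 0) * (if 0 < x \<and> x < l then v x else 0))" by auto
  then show ?thesis
    using assms unfolding l2_of_def L2_iff_sq_integrable by (simp add: abs_l2_ops integral_\<Omega>)
qed

lemma l2_of_norm: "u \<in> L2 l \<Longrightarrow> norm (l2_of l u) = L2_norm l u"
  unfolding L2_norm_def norm_eq_sqrt_inner by (simp add: l2_of_inner power2_eq_square)

lemma l2_of_add: "u \<in> L2 l \<Longrightarrow> v \<in> L2 l \<Longrightarrow> l2_of l (\<lambda>x. u x + v x) = l2_of l u + l2_of l v"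
  unfolding l2_of_def L2_iff_sq_integrable
  by (subst abs_l2_ops) (auto intro!: arg_cong[of _ _ abs_l2])

lemma l2_of_scale: "u \<in> L2 l \<Longrightarrow> l2_of l (\<lambda>x. c * u x) = c *\<^sub>R l2_of l u"
  unfolding l2_of_def L2_iff_sq_integrable
  by (subst abs_l2_ops) (auto intro!: arg_cong[of _ _ abs_l2])

lemma l2_of_minus: "u \<in> L2 l \<Longrightarrow> l2_of l (\<lambda>x. - u x) = - l2_of l u"
  using l2_of_scale[of u l "- 1"] by simp

lemma l2_of_diff: "u \<in> L2 l \<Longrightarrow> v \<in> L2 l \<Longrightarrow> l2_of l (\<lambda>x. u x - v x) = l2_of l u - l2_of l v"
  using l2_of_add[of u l "\<lambda>x. - v x"] l2_of_minus[of v l] L2_minus[of v l] by simp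

lemma l2_of_eq_iff: "u \<in> L2 l \<Longrightarrow> v \<in> L2 l \<Longrightarrow> l2_of l u = l2_of l v \<longleftrightarrow> ae_eq l u v"
  unfolding l2_of_def L2_iff_sq_integrable ae_eq_def AE_\<Omega>_iff
  by (subst abs_l2_eq_iff) (auto intro!: arg_cong[of _ _ "\<lambda>P. AE x in lebesgue. P x"])

lemma l2_of_cong: "(\<And>x. 0 < x \<Longrightarrow> x < l \<Longrightarrow> u x = v x) \<Longrightarrow> l2_of l u = l2_of l v"
  unfolding l2_of_def by (auto intro!: arg_cong[of _ _ abs_l2])

lemma L2_Cauchy_Schwarz:
  assumes "u \<in> L2 l" "v \<in> L2 l"
  shows "\<bar>\<integral>x. u x * v x \<partial>\<Omega> l\<bar> \<le> L2_norm l u * L2_norm l v"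
  using Cauchy_Schwarz_ineq2[of "l2_of l u" "l2_of l v"] assms by (simp add: l2_of_inner l2_of_norm)

section \<open>Integration from the left and from the right\<close>

definition ip :: "real \<Rightarrow> (real \<Rightarrow> real) \<Rightarrow> real \<Rightarrow> real" where
  "ip l u y = (\<integral>s. indicator {..<y} s * u s \<partial>\<Omega> l)"

text \<open>Like \<open>ip\<close>, an integral of an indicator against one fixed measure: this form
  is ready for Cauchy-Schwarz and Fubini.\<close>

definition jp :: "real \<Rightarrow> (real \<Rightarrow> real) \<Rightarrow> real \<Rightarrow> real" where
  "jp l u y = (\<integral>s. indicator {y<..} s * u s \<partial>\<Omega> l)"

lemma ip_integrable: "u \<in> L2 l \<Longrightarrow> A \<in> sets borel \<Longrightarrow> integrable (\<Omega> l) (\<lambda>s. indicator A s * u s)"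
  by (intro L2_integrable L2_indicator_mult)

lemma ip_0 [simp]: "ip l u 0 = 0"
proof -
  have "ip l u 0 = (\<integral>s. 0 \<partial>\<Omega> l)"
    unfolding ip_def by (rule Bochner_Integration.integral_cong) auto
  then show ?thesis by simp
qed

lemma ip_l: "ip l u l = (\<integral>s. u s \<partial>\<Omega> l)"
  unfolding ip_def by (rule Bochner_Integration.integral_cong) auto

lemma jp_l [simp]: "jp l u l = 0"
proof -
  have "jp l u l = (\<integral>s. 0 \<partial>\<Omega> l)"
    unfolding jp_def by (rule Bochner_Integration.integral_cong) auto
  then show ?thesis by simp
qed

lemma ip_add: "u \<in> L2 l \<Longrightarrow> v \<in> L2 l \<Longrightarrow> ip l (\<lambda>x. u x + v x) y = ip l u y + ip l v y"
  unfolding ip_def by (simp add: distrib_left ip_integrable)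

lemma ip_scale: "ip l (\<lambda>x. c * u x) y = c * ip l u y"
  unfolding ip_def by (simp add: mult.left_commute)

lemma ip_cong_ae:
  assumes "u \<in> L2 l" "ae_eq l u v" shows "ip l u y = ip l v y"
  unfolding ip_def
proof (rule integral_ae_eq)
  show "(\<lambda>s. indicator {..<y} s * u s) \<in> borel_measurable (\<Omega> l)"
    by (intro L2_measurable L2_indicator_mult assms) simp
  show "ae_eq l (\<lambda>s. indicator {..<y} s * u s) (\<lambda>s. indicator {..<y} s * v s)"
    using assms(2) unfolding ae_eq_def by (elim eventually_mono) simp
qed

lemma ae_eq_off_point: "(\<And>s. s \<noteq> y \<Longrightarrow> u s = v s) \<Longrightarrow> ae_eq l u v"
  unfolding ae_eq_def AE_\<Omega>_iff
  by (rule AE_mp[OF AE_completion[OF AE_lborel_singleton[of y]]]) auto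

lemma jp_eq:
  assumes "u \<in> L2 l" shows "jp l u y = ip l u l - ip l u y"
proof -
  have "(\<integral>s. indicator {y<..} s * u s \<partial>\<Omega> l) = (\<integral>s. u s - indicator {..<y} s * u s \<partial>\<Omega> l)"
    by (rule integral_ae_eq[OF L2_measurable[OF L2_indicator_mult[OF assms]] ae_eq_off_point[of y]])
      (auto simp: indicator_def)
  also have "\<dots> = (\<integral>s. u s \<partial>\<Omega> l) - (\<integral>s. indicator {..<y} s * u s \<partial>\<Omega> l)"
    by (rule Bochner_Integration.integral_diff) (auto intro: ip_integrable assms L2_integrable)
  finally show ?thesis unfolding jp_def ip_l ip_def .
qed

text \<open>Link to the gauge integral, in which the fundamental theorem of calculus is
  stated.\<close>

lemma ip_has_integral:
  assumes u: "u \<in> L2 l" and y: "y \<in> {0..l}"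
  shows "(u has_integral ip l u y) {0..y}"
proof -
  have eq: "(\<lambda>x. if 0 < x \<and> x < l then indicator {..<y} x * u x else 0)
      = (\<lambda>x. if 0 < x \<and> x < y then u x else 0)" using y by (auto simp: indicator_def)
  have "integrable (\<Omega> y) u"
    using ip_integrable[OF u, of "{..<y}"] unfolding integrable_\<Omega>_iff eq by simp
  then have "(u has_integral (\<integral>x. u x \<partial>\<Omega> y)) {0<..<y}"
    by (rule has_integral_integral_lebesgue_on) simp
  moreover have "(\<integral>x. u x \<partial>\<Omega> y) = ip l u y" unfolding ip_def integral_\<Omega> eq by simp
  ultimately show ?thesis by (simp add: has_integral_Icc_iff_Ioo)
qed

lemma ip_derivative:
  assumes f: "\<And>x. x \<in> {0..l} \<Longrightarrow> (f has_real_derivative f' x) (at x within {0..l})"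
    and f': "continuous_on {0..l} f'" and y: "y \<in> {0..l}"
  shows "ip l f' y = f y - f 0"
proof -
  have "(f' has_integral (f y - f 0)) {0..y}"
    by (rule fundamental_theorem_of_calculus)
      (use y in \<open>auto simp: has_real_derivative_iff_has_vector_derivative[symmetric]
        intro!: has_field_derivative_subset[OF f]\<close>)
  with ip_has_integral[OF continuous_on_imp_L2[OF f'] y] show ?thesis
    using has_integral_unique by blast
qed

lemma ip_diff_le:
  assumes u: "u \<in> L2 l" and "y \<le> z"
  shows "\<bar>ip l u z - ip l u y\<bar> \<le> (\<integral>s. indicator {y<..<z} s * \<bar>u s\<bar> \<partial>\<Omega> l)"
proof -
  have "ip l u z - ip l u y = (\<integral>s. indicator {..<z} s * u s - indicator {..<y} s * u s \<partial>\<Omega> l)"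
    unfolding ip_def by (rule Bochner_Integration.integral_diff[symmetric]) (auto intro: ip_integrable u)
  also have "\<dots> = (\<integral>s. indicator {y<..<z} s * u s \<partial>\<Omega> l)"
    by (rule integral_ae_eq[OF L2_measurable[OF L2_diff[OF L2_indicator_mult[OF u] L2_indicator_mult[OF u]]] ae_eq_off_point[of y]])
      (use \<open>y \<le> z\<close> in \<open>auto simp: indicator_def\<close>)
  also have "\<bar>\<dots>\<bar> \<le> (\<integral>s. \<bar>indicator {y<..<z} s * u s\<bar> \<partial>\<Omega> l)"
    using integral_norm_bound[of "\<Omega> l" "\<lambda>s. indicator {y<..<z} s * u s"] by simp
  finally show ?thesis by (simp add: abs_mult)
qed

lemma L2_abs: "u \<in> L2 l \<Longrightarrow> (\<lambda>x. \<bar>u x\<bar>) \<in> L2 l"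
  by (auto simp: L2_def)

lemma L2_const: "(\<lambda>x. c) \<in> L2 l"
  by (rule L2_bounded[of _ _ "\<bar>c\<bar>"]) auto

lemma integral_indicator_interval:
  assumes "0 \<le> a" "a \<le> b" "b \<le> l"
  shows "(\<integral>s. indicator {a<..<b} s \<partial>\<Omega> l) = b - a"
proof -
  have "(\<lambda>s. if 0 < s \<and> s < l then indicat_real {a<..<b} s else 0) = indicator {a<..<b}"
    using assms by (auto simp: fun_eq_iff indicator_def)
  then show ?thesis unfolding integral_\<Omega> using assms by simp
qed

text \<open>The increments over disjoint intervals sum to at most the integral of |u| over their
  union; by Cauchy-Schwarz this is at most the root of the total length times the norm of
  \<open>u\<close>.\<close>

lemma AC_ip:
  assumes u: "u \<in> L2 l"
  shows "(\<lambda>y. c + ip l u y) \<in> AC l"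
  unfolding AC_def
proof (intro CollectI allI impI)
  fix e :: real assume e: "e > 0"
  define N where "N = L2_norm l u"
  have N: "N \<ge> 0" by (simp add: N_def L2_norm_def)
  \<comment> \<open>Yields \<open>sqrt d * N = e / (N + 1) * N\<close>, which is below
    \<open>e\<close>; the added 1 avoids division by zero and keeps the inequality strict.\<close>
  define d where "d = (e / (N + 1))\<^sup>2"
  have d: "d > 0" using e N by (simp add: d_def)
  show "\<exists>d>0. \<forall>(n::nat) a b. (\<forall>i<n. 0 \<le> a i \<and> a i \<le> b i \<and> b i \<le> l) \<longrightarrow>
       disjoint_family_on (\<lambda>i. {a i<..<b i}) {..<n} \<longrightarrow> (\<Sum>i<n. b i - a i) < d \<longrightarrow>
       (\<Sum>i<n. \<bar>(c + ip l u (b i)) - (c + ip l u (a i))\<bar>) < e"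
  proof (intro exI[of _ d] conjI allI impI d)
    fix n :: nat and a b :: "nat \<Rightarrow> real"
    assume ab: "\<forall>i<n. 0 \<le> a i \<and> a i \<le> b i \<and> b i \<le> l"
      and disj: "disjoint_family_on (\<lambda>i. {a i<..<b i}) {..<n}" and sum: "(\<Sum>i<n. b i - a i) < d"
    define A where "A = (\<Union>i<n. {a i<..<b i})"
    have A: "A \<in> sets borel" by (auto simp: A_def)
    have ind: "indicator A s = (\<Sum>i<n. indicat_real {a i<..<b i} s)" for s
      unfolding A_def by (rule indicator_UN_disjoint[OF _ disj]) simp
    have LA: "(\<lambda>s. indicator A s * 1) \<in> L2 l" by (intro L2_indicator_mult L2_const A)
    then have LA': "indicator A \<in> L2 l" by simp
    have "(\<Sum>i<n. \<bar>(c + ip l u (b i)) - (c + ip l u (a i))\<bar>)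
        \<le> (\<Sum>i<n. \<integral>s. indicator {a i<..<b i} s * \<bar>u s\<bar> \<partial>\<Omega> l)"
      by (intro sum_mono) (use ab ip_diff_le[OF u] in auto)
    also have "\<dots> = (\<integral>s. (\<Sum>i<n. indicator {a i<..<b i} s * \<bar>u s\<bar>) \<partial>\<Omega> l)"
      by (rule Bochner_Integration.integral_sum[symmetric]) (intro ip_integrable L2_abs u, simp)
    also have "\<dots> = (\<integral>s. indicator A s * \<bar>u s\<bar> \<partial>\<Omega> l)"
      by (simp add: ind sum_distrib_right)
    also have "\<dots> \<le> L2_norm l (indicator A) * L2_norm l (\<lambda>s. \<bar>u s\<bar>)"
      using L2_Cauchy_Schwarz[OF LA' L2_abs[OF u]] by simp
    also have "L2_norm l (\<lambda>s. \<bar>u s\<bar>) = N" by (simp add: L2_norm_def N_def)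
    also have "L2_norm l (indicator A) = sqrt (\<Sum>i<n. b i - a i)"
    proof -
      have "(\<integral>s. (indicat_real A s)\<^sup>2 \<partial>\<Omega> l) = (\<integral>s. indicat_real A s \<partial>\<Omega> l)"
        by (rule Bochner_Integration.integral_cong) (auto simp: indicator_def)
      also have "\<dots> = (\<integral>s. (\<Sum>i<n. indicat_real {a i<..<b i} s) \<partial>\<Omega> l)" by (simp add: ind)
      also have "\<dots> = (\<Sum>i<n. \<integral>s. indicat_real {a i<..<b i} s \<partial>\<Omega> l)"
        by (rule Bochner_Integration.integral_sum) (use ip_integrable[OF L2_const, of _ _ 1] in simp)
      also have "\<dots> = (\<Sum>i<n. b i - a i)"
        by (intro sum.cong integral_indicator_interval) (use ab in auto)
      finally show ?thesis by (simp add: L2_norm_def)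
    qed
    also have "sqrt (\<Sum>i<n. b i - a i) * N \<le> sqrt d * N"
      using sum N by (intro mult_right_mono) auto
    also have "\<dots> = e / (N + 1) * N" using e N by (simp add: d_def)
    also have "\<dots> < e" using e N by (simp add: field_simps)
    finally show "(\<Sum>i<n. \<bar>(c + ip l u (b i)) - (c + ip l u (a i))\<bar>) < e" .
  qed
qed

lemma AC_continuous_on:
  assumes "u \<in> AC l" shows "continuous_on {0..l} u"
  unfolding continuous_on_iff
proof (intro ballI allI impI)
  fix x e :: real assume x: "x \<in> {0..l}" and e: "e > 0"
  obtain d where d: "d > 0" and D: "\<And>(n::nat) a b. (\<forall>i<n. 0 \<le> a i \<and> a i \<le> b i \<and> b i \<le> l) \<Longrightarrow>
       disjoint_family_on (\<lambda>i. {a i<..<b i}) {..<n} \<Longrightarrow> (\<Sum>i<n. b i - a i) < d \<Longrightarrow>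
       (\<Sum>i<n. \<bar>u (b i) - u (a i)\<bar>) < e"
    using assms e unfolding AC_def by blast
  show "\<exists>d>0. \<forall>y\<in>{0..l}. dist y x < d \<longrightarrow> dist (u y) (u x) < e"
  proof (intro exI[of _ d] conjI ballI impI d)
    fix y assume y: "y \<in> {0..l}" "dist y x < d"
    \<comment> \<open>Absolute continuity for a single interval; \<open>min\<close> and
      \<open>max\<close> order its end points.\<close>
    have "(\<Sum>i<(1::nat). \<bar>u (max x y) - u (min x y)\<bar>) < e"
      by (rule D) (use x y in \<open>auto simp: disjoint_family_on_def dist_real_def\<close>)
    then show "dist (u y) (u x) < e" by (auto simp: dist_real_def max_def min_def split: if_splits)
  qed
qed

lemma ip_continuous_on: "u \<in> L2 l \<Longrightarrow> continuous_on {0..l} (ip l u)"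
  using AC_continuous_on[OF AC_ip[of u l 0]] by simp

lemma jp_continuous_on: "u \<in> L2 l \<Longrightarrow> continuous_on {0..l} (jp l u)"
  by (simp add: jp_eq continuous_on_diff ip_continuous_on)

lemma ip_L2: "u \<in> L2 l \<Longrightarrow> ip l u \<in> L2 l"
  by (rule continuous_on_imp_L2[OF ip_continuous_on])

lemma jp_L2: "u \<in> L2 l \<Longrightarrow> jp l u \<in> L2 l"
  by (rule continuous_on_imp_L2[OF jp_continuous_on])

text \<open>Both sides integrate \<open>u s * v y\<close> over the triangle
  \<open>s < y\<close>.\<close>

lemma ip_adjoint:
  assumes u: "u \<in> L2 l" and v: "v \<in> L2 l"
  shows "(\<integral>y. ip l u y * v y \<partial>\<Omega> l) = (\<integral>s. u s * jp l v s \<partial>\<Omega> l)"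
proof -
  interpret finite_measure "\<Omega> l" by (rule finite_measure_\<Omega>)
  interpret P: pair_sigma_finite "\<Omega> l" "\<Omega> l" by unfold_locales
  have id: "(\<lambda>x. x) \<in> borel_measurable (\<Omega> l)"
    using id_borel_measurable_lebesgue_on[of "{0<..<l}"] by (simp add: id_def)
  note [measurable] = L2_measurable[OF u] L2_measurable[OF v]
    measurable_compose[OF measurable_fst id] measurable_compose[OF measurable_snd id]
  have uv: "integrable (\<Omega> l \<Otimes>\<^sub>M \<Omega> l) (\<lambda>p. u (fst p) * v (snd p))"
  proof (rule P.Fubini_integrable)
    show "integrable (\<Omega> l) (\<lambda>s. \<integral>y. norm (u (fst (s, y)) * v (snd (s, y))) \<partial>\<Omega> l)"
      using L2_integrable[OF L2_abs[OF u]] by (simp add: abs_mult)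
    show "AE s in \<Omega> l. integrable (\<Omega> l) (\<lambda>y. u (fst (s, y)) * v (snd (s, y)))"
      using L2_integrable[OF v] by simp
  qed measurable
  define f where "f = (\<lambda>s y. (if s < y then 1 else 0) * (u s * v y))"
  have f: "integrable (\<Omega> l \<Otimes>\<^sub>M \<Omega> l) (case_prod f)"
  proof (rule Bochner_Integration.integrable_bound[OF uv])
    show "case_prod f \<in> borel_measurable (\<Omega> l \<Otimes>\<^sub>M \<Omega> l)"
      unfolding f_def case_prod_beta by measurable
    show "AE p in \<Omega> l \<Otimes>\<^sub>M \<Omega> l. norm (case_prod f p) \<le> norm (u (fst p) * v (snd p))"
      by (rule AE_I2) (auto simp: f_def)
  qed
  have "(\<integral>y. ip l u y * v y \<partial>\<Omega> l) = (\<integral>y. (\<integral>s. f s y \<partial>\<Omega> l) \<partial>\<Omega> l)"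
    unfolding ip_def f_def
    by (intro Bochner_Integration.integral_cong refl)
      (simp add: integral_mult_left_zero[symmetric] mult.assoc indicator_def of_bool_def del: integral_mult_left_zero)
  also have "\<dots> = (\<integral>s. (\<integral>y. f s y \<partial>\<Omega> l) \<partial>\<Omega> l)" by (rule P.Fubini_integral[OF f])
  also have "\<dots> = (\<integral>s. u s * jp l v s \<partial>\<Omega> l)"
    unfolding jp_def f_def
    by (intro Bochner_Integration.integral_cong refl)
      (simp add: integral_mult_right_zero[symmetric] mult.left_commute indicator_def of_bool_def del: integral_mult_right_zero)
  finally show ?thesis .
qed

section \<open>Test functions, the fundamental lemma and du Bois-Reymond's lemma\<close>

lemma test_function_interval:
  assumes "\<phi> \<in> test_functions l"
  obtains a b where "0 < a" "b < l" "\<And>y. y \<notin> {a..b} \<Longrightarrow> \<phi> y = 0" "\<And>y. y \<notin> {a..b} \<Longrightarrow> deriv \<phi> y = 0" "smooth \<phi>"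
proof -
  obtain a b where ab: "0 < a" "b < l" "\<forall>y. y \<notin> {a..b} \<longrightarrow> \<phi> y = 0" and s: "smooth \<phi>"
    using assms by (auto simp: test_functions_iff)
  have "deriv \<phi> y = 0" if y: "y \<notin> {a..b}" for y
  proof -
    have "(\<phi> has_real_derivative 0) (at y)"
      by (rule has_field_derivative_transform_within_open[OF DERIV_const, of "- {a..b}"])
        (use ab y in \<open>auto simp: open_Compl\<close>)
    then show ?thesis by (rule DERIV_imp_deriv)
  qed
  then show ?thesis using that ab s by blast
qed

lemma test_function_ip:
  assumes \<phi>: "\<phi> \<in> test_functions l" and y: "y \<in> {0..l}"
  shows "ip l (deriv \<phi>) y = \<phi> y" and "jp l (deriv \<phi>) y = - \<phi> y"
    and "\<phi> \<in> L2 l" and "deriv \<phi> \<in> L2 l" and "(\<integral>x. deriv \<phi> x \<partial>\<Omega> l) = 0"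
proof -
  obtain a b where ab: "0 < a" "b < l" "\<And>y. y \<notin> {a..b} \<Longrightarrow> \<phi> y = 0" and s: "smooth \<phi>"
    using test_function_interval[OF \<phi>] by metis
  show L: "\<phi> \<in> L2 l" "deriv \<phi> \<in> L2 l"
    by (intro continuous_on_imp_L2 smooth_continuous smooth_deriv s)+
  have ip: "ip l (deriv \<phi>) y = \<phi> y" if "y \<in> {0..l}" for y
    using ip_derivative[of l \<phi> "deriv \<phi>" y] smooth_deriv[OF s] smooth_continuous that ab(1) ab(3)[of 0]
    by (simp add: has_field_derivative_at_within)
  then show "ip l (deriv \<phi>) y = \<phi> y" using y by blast
  have "ip l (deriv \<phi>) l = 0" using ip[of l] y ab(2) ab(3)[of l] by simp
  then show "(\<integral>x. deriv \<phi> x \<partial>\<Omega> l) = 0" "jp l (deriv \<phi>) y = - \<phi> y"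
    using ip[OF y] by (simp_all add: ip_l[symmetric] jp_eq[OF L(2)])
qed

lemma L2_L1_loc:
  assumes "u \<in> L2 l" shows "u \<in> L1_loc l"
  unfolding L1_loc_def
proof (intro CollectI allI impI)
  fix a b :: real assume ab: "0 < a" "b < l"
  have "(\<lambda>x. indicat_real {0<..<l} x *\<^sub>R u x) = (\<lambda>x. if 0 < x \<and> x < l then u x else 0)"
    by (auto simp: fun_eq_iff indicator_def)
  then have "set_integrable lebesgue {0<..<l} u"
    using L2_integrable[OF assms] by (simp add: set_integrable_def integrable_\<Omega>_iff)
  then show "set_integrable lebesgue {a..b} u"
    by (rule set_integrable_subset) (use ab in auto)
qed

text \<open>Weak derivatives pair merely locally integrable functions with test functions. The
  compact support inside (0,l) makes the pairing a genuine integral, so that it may be split and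
  compared.\<close>

lemma L1_loc_mult_test:
  assumes w: "w \<in> L1_loc l" and \<phi>: "continuous_on UNIV \<phi>"
    and ab: "0 < a" "b < l" "\<And>y. y \<notin> {a..b} \<Longrightarrow> \<phi> y = 0"
  shows "integrable (\<Omega> l) (\<lambda>x. w x * \<phi> x)"
    and "(\<integral>x. w x * \<phi> x \<partial>\<Omega> l) = (\<integral>x. indicator {a..b} x *\<^sub>R w x * \<phi> x \<partial>lebesgue)"
proof -
  have W: "integrable lebesgue (\<lambda>x. indicator {a..b} x *\<^sub>R w x)"
    using w ab by (simp add: L1_loc_def set_integrable_def)
  have "compact (\<phi> ` {a..b})"
    by (rule compact_continuous_image) (auto intro: continuous_on_subset[OF \<phi>])
  then obtain B where B: "\<And>x. x \<in> {a..b} \<Longrightarrow> norm (\<phi> x) \<le> B" by (meson bounded_iff compact_imp_bounded image_eqI)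
  have \<phi>m: "\<phi> \<in> borel_measurable lebesgue"
    using borel_measurable_continuous_onI[OF \<phi>] by (simp add: measurable_completion)
  have "integrable lebesgue (\<lambda>x. (indicator {a..b} x *\<^sub>R w x) * \<phi> x)"
  proof (rule Bochner_Integration.integrable_bound)
    show "integrable lebesgue (\<lambda>x. B * (indicator {a..b} x *\<^sub>R w x))" using W by simp
    show "(\<lambda>x. (indicator {a..b} x *\<^sub>R w x) * \<phi> x) \<in> borel_measurable lebesgue"
      by (intro borel_measurable_times \<phi>m borel_measurable_integrable[OF W])
    show "AE x in lebesgue. norm ((indicator {a..b} x *\<^sub>R w x) * \<phi> x) \<le> norm (B * (indicator {a..b} x *\<^sub>R w x))"
    proof (rule AE_I2)
      fix x
      have "\<bar>\<phi> x\<bar> * \<bar>w x\<bar> \<le> \<bar>B\<bar> * \<bar>w x\<bar>" if "x \<in> {a..b}"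
        using B[OF that] by (intro mult_right_mono) auto
      then show "norm ((indicator {a..b} x *\<^sub>R w x) * \<phi> x) \<le> norm (B * (indicator {a..b} x *\<^sub>R w x))"
        by (auto simp: indicator_def abs_mult mult.commute)
    qed
  qed
  moreover have "(\<lambda>x. if 0 < x \<and> x < l then w x * \<phi> x else 0) = (\<lambda>x. (indicator {a..b} x *\<^sub>R w x) * \<phi> x)"
    using ab by (auto simp: fun_eq_iff indicator_def)
  ultimately show "integrable (\<Omega> l) (\<lambda>x. w x * \<phi> x)"
    and "(\<integral>x. w x * \<phi> x \<partial>\<Omega> l) = (\<integral>x. indicator {a..b} x *\<^sub>R w x * \<phi> x \<partial>lebesgue)"
    unfolding integrable_\<Omega>_iff integral_\<Omega> by simp_all
qed

text \<open>Bumps converge boundedly to the indicator of (p,q), and dominated convergence carries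
  the vanishing pairing to the limit; the end points are null.\<close>

lemma integral_interval_zero:
  assumes w: "w \<in> L1_loc l" and test: "\<And>\<phi>. \<phi> \<in> test_functions l \<Longrightarrow> (\<integral>x. w x * \<phi> x \<partial>\<Omega> l) = 0"
    and pq: "0 < p" "q < l"
  shows "set_lebesgue_integral lebesgue {p..q} w = 0"
proof -
  define W where "W = (\<lambda>x. indicator {p..q} x *\<^sub>R w x)"
  have W: "integrable lebesgue W"
    using w pq by (simp add: L1_loc_def set_integrable_def W_def)
  have \<phi>m: "bump p q k \<in> borel_measurable lebesgue" for k
    using borel_measurable_continuous_onI[OF smooth_continuous[OF bump_smooth]] by (simp add: measurable_completion)
  have "(\<lambda>n. \<integral>x. W x * bump p q (real (Suc n)) x \<partial>lebesgue) \<longlonglongrightarrow> (\<integral>x. W x * indicator {p<..<q} x \<partial>lebesgue)"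
  proof (rule integral_dominated_convergence)
    show "(\<lambda>x. W x * indicator {p<..<q} x) \<in> borel_measurable lebesgue"
      by (intro borel_measurable_times borel_measurable_integrable[OF W] borel_measurable_indicator) simp
    show "(\<lambda>x. W x * bump p q (real (Suc n)) x) \<in> borel_measurable lebesgue" for n
      by (intro borel_measurable_times borel_measurable_integrable[OF W] \<phi>m)
    show "integrable lebesgue (\<lambda>x. \<bar>W x\<bar>)" using W by simp
    show "AE x in lebesgue. (\<lambda>n. W x * bump p q (real (Suc n)) x) \<longlonglongrightarrow> W x * indicator {p<..<q} x"
      by (rule AE_I2) (intro tendsto_intros bump_tendsto_indicator)
    show "AE x in lebesgue. norm (W x * bump p q (real (Suc n)) x) \<le> \<bar>W x\<bar>" for n
      using bump_bounds[of p q "real (Suc n)"]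
      by (intro AE_I2) (simp add: abs_mult mult_left_le)
  qed
  moreover have "(\<integral>x. W x * bump p q (real (Suc n)) x \<partial>lebesgue) = 0" for n
  proof -
    have "bump p q (real (Suc n)) y = 0" if "y \<notin> {p..q}" for y
      by (rule bump_zero) (use that in auto)
    then show ?thesis
      unfolding W_def
      using L1_loc_mult_test(2)[OF w smooth_continuous[OF bump_smooth] pq]
        test[OF bump_test_function[OF pq, of "real (Suc n)"]] by simp
  qed
  ultimately have "(\<integral>x. W x * indicator {p<..<q} x \<partial>lebesgue) = 0"
    using LIMSEQ_unique[OF _ tendsto_const] by simp
  moreover have "(\<integral>x. W x * indicator {p<..<q} x \<partial>lebesgue) = (\<integral>x. W x \<partial>lebesgue)"
  proof (rule integral_cong_AE)
    show "AE x in lebesgue. W x * indicator {p<..<q} x = W x"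
      using AE_completion[OF AE_lborel_singleton[of p]] AE_completion[OF AE_lborel_singleton[of q]]
      by eventually_elim (auto simp: W_def indicator_def)
    show "(\<lambda>x. W x * indicator {p<..<q} x) \<in> borel_measurable lebesgue"
      by (intro borel_measurable_times borel_measurable_integrable[OF W] borel_measurable_indicator) simp
  qed (use W in simp)
  ultimately show ?thesis by (simp add: set_lebesgue_integral_def W_def)
qed

text \<open>A Dynkin class argument extends the vanishing from intervals to all Borel sets;
  \<open>total\<close> supplies the case of complements. A function whose integrals over all these
  sets vanish is zero almost everywhere.\<close>

lemma integral_intervals_zero_imp_AE:
  fixes W :: "real \<Rightarrow> real"
  assumes W: "integrable lebesgue W" and total: "(\<integral>x. W x \<partial>lebesgue) = 0"
    and int: "\<And>c d. c \<le> d \<Longrightarrow> set_lebesgue_integral lebesgue {c..d} W = 0"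
  shows "AE x in lebesgue. W x = 0"
proof -
  have sint: "set_integrable lebesgue A W" if "A \<in> sets borel" for A
    using W that unfolding set_integrable_def by (intro integrable_mult_indicator) auto
  have zero: "set_lebesgue_integral lebesgue A W = 0" if "A \<in> sets borel" for A
    using that
  proof (induction rule: borel_set_induct)
    case empty then show ?case by (simp add: set_lebesgue_integral_def)
  next
    case (interval a b) then show ?case by (rule int)
  next
    case (compl A)
    have "(\<lambda>x. indicator (- A) x *\<^sub>R W x) = (\<lambda>x. W x - indicator A x *\<^sub>R W x)"
      by (auto simp: fun_eq_iff indicator_def)
    then show ?case
      using compl W sint[OF compl(1)] total
      by (simp add: set_lebesgue_integral_def set_integrable_def)
  next
    case (union f)
    have "set_lebesgue_integral lebesgue (\<Union>i. f i) W = (\<Sum>i. set_lebesgue_integral lebesgue (f i) W)"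
      by (rule lebesgue_integral_countable_add)
        (use union in \<open>auto intro!: sint simp: disjoint_family_on_def\<close>)
    then show ?case using union by simp
  qed
  \<comment> \<open>The density argument runs on \<open>lborel\<close>, so \<open>W\<close> is
    replaced by a Borel function that agrees with it off a null set.\<close>
  have "W \<in> borel_measurable (completion lborel)" using W by simp
  then obtain W' where W': "W' \<in> borel_measurable lborel" "AE x in lborel. W x = W' x"
    using completion_ex_borel_measurable_real by blast
  have ae: "AE x in lebesgue. W x = W' x" by (rule AE_completion[OF W'(2)])
  have iW': "integrable lebesgue W'"
    using W integrable_cong_AE[of W lebesgue W'] ae W'(1) by (simp add: measurable_completion)
  have "AE x in lborel. W' x = 0"
  proof (rule sigma_finite_measure.density_zero[OF lborel.sigma_finite_measure_axioms])
    show "integrable lborel W'" using iW' integrable_completion[OF W'(1)] by simp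
    fix A :: "real set" assume A: "A \<in> sets lborel"
    have m: "(\<lambda>x. indicator A x *\<^sub>R W' x) \<in> borel_measurable lborel" using A W'(1) by auto
    have "(\<integral>x. indicator A x *\<^sub>R W' x \<partial>lborel) = (\<integral>x. indicator A x *\<^sub>R W' x \<partial>lebesgue)"
      by (rule integral_completion[symmetric, OF m])
    also have "\<dots> = (\<integral>x. indicator A x *\<^sub>R W x \<partial>lebesgue)"
    proof (rule integral_cong_AE)
      show "AE x in lebesgue. indicator A x *\<^sub>R W' x = indicator A x *\<^sub>R W x" using ae by eventually_elim simp
      show "(\<lambda>x. indicator A x *\<^sub>R W' x) \<in> borel_measurable lebesgue" using m by (rule measurable_completion)
      show "(\<lambda>x. indicator A x *\<^sub>R W x) \<in> borel_measurable lebesgue"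
        using sint[of A] A by (simp add: set_integrable_def)
    qed
    also have "\<dots> = 0" using zero[of A] A by (simp add: set_lebesgue_integral_def)
    finally show "set_lebesgue_integral lborel A W' = 0" by (simp add: set_lebesgue_integral_def)
  qed
  from AE_completion[OF this] ae show ?thesis by eventually_elim simp
qed

text \<open>Integrability is available on compact subintervals only, hence the exhaustion of (0,l)
  by \<open>{r n..l - r n}\<close>.\<close>

lemma fundamental_lemma:
  assumes w: "w \<in> L1_loc l" and test: "\<And>\<phi>. \<phi> \<in> test_functions l \<Longrightarrow> (\<integral>x. w x * \<phi> x \<partial>\<Omega> l) = 0"
  shows "ae_eq l w (\<lambda>x. 0)"
proof -
  note zero = integral_interval_zero[OF w test]
  have loc: "AE x in lebesgue. indicator {a..b} x *\<^sub>R w x = 0" if ab: "0 < a" "b < l" for a b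
  proof (rule integral_intervals_zero_imp_AE)
    show "integrable lebesgue (\<lambda>x. indicator {a..b} x *\<^sub>R w x)"
      using w ab by (simp add: L1_loc_def set_integrable_def)
    show "(\<integral>x. indicator {a..b} x *\<^sub>R w x \<partial>lebesgue) = 0"
      using zero[of a b] ab by (simp add: set_lebesgue_integral_def)
    fix c d :: real
    have "(\<lambda>x. indicator {c..d} x *\<^sub>R indicator {a..b} x *\<^sub>R w x) = (\<lambda>x. indicator {max a c..min b d} x *\<^sub>R w x)"
      by (auto simp: fun_eq_iff indicator_def)
    then show "set_lebesgue_integral lebesgue {c..d} (\<lambda>x. indicator {a..b} x *\<^sub>R w x) = 0"
      using zero[of "max a c" "min b d"] ab by (simp add: set_lebesgue_integral_def)
  qed
  define r where "r = (\<lambda>n. inverse (real (Suc n)))"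
  have r: "r n > 0" for n by (simp add: r_def)
  have "AE x in lebesgue. \<forall>n. indicator {r n..l - r n} x *\<^sub>R w x = 0"
    unfolding AE_all_countable using loc r by simp
  then have "AE x in lebesgue. 0 < x \<and> x < l \<longrightarrow> w x = 0"
  proof eventually_elim
    fix x assume x: "\<forall>n. indicator {r n..l - r n} x *\<^sub>R w x = 0"
    show "0 < x \<and> x < l \<longrightarrow> w x = 0"
    proof
      assume "0 < x \<and> x < l"
      then obtain n where "r n < min x (l - x)" using reals_Archimedean[of "min x (l - x)"] by (auto simp: r_def)
      then have "x \<in> {r n..l - r n}" by auto
      then show "w x = 0" using x by (metis indicator_simps(1) scaleR_one)
    qed
  qed
  then show ?thesis unfolding ae_eq_def AE_\<Omega>_iff .
qed

text \<open>Mean zero is exactly what brings the primitive back to zero on the right of the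
  support.\<close>

lemma test_function_antiderivative:
  assumes l: "l > 0" and \<psi>: "\<psi> \<in> test_functions l" and zero: "(\<integral>x. \<psi> x \<partial>\<Omega> l) = 0"
  shows "\<exists>\<phi>\<in>test_functions l. deriv \<phi> = \<psi>"
proof -
  obtain a b where ab: "0 < a" "b < l" "\<And>y. y \<notin> {a..b} \<Longrightarrow> \<psi> y = 0" and s: "smooth \<psi>"
    using test_function_interval[OF \<psi>] by metis
  obtain G where G: "\<And>x. (G has_real_derivative \<psi> x) (at x)"
  proof -
    have "\<exists>F. \<forall>x::real. -\<infinity> < ereal x \<longrightarrow> ereal x < \<infinity> \<longrightarrow> (F has_vector_derivative \<psi> x) (at x)"
      by (rule einterval_antiderivative) (use smooth_deriv(1)[OF s] DERIV_isCont in auto)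
    then show ?thesis using that by (auto simp: has_real_derivative_iff_has_vector_derivative)
  qed
  define \<phi> where "\<phi> = (\<lambda>x. G x - G 0)"
  have \<phi>': "(\<phi> has_real_derivative \<psi> x) (at x)" for x
    unfolding \<phi>_def using DERIV_diff[OF G DERIV_const] by simp
  then have d: "deriv \<phi> = \<psi>" by (auto intro!: DERIV_imp_deriv)
  have smooth: "smooth \<phi>"
  \<comment> \<open>One derivative of \<open>\<phi>\<close> leads to the smooth function
    \<open>\<psi>\<close>, so the enlarged family is still closed under differentiation.\<close>
  proof (rule smooth_coinduct[of _ "insert \<phi> (Collect smooth)"])
    fix f assume "f \<in> insert \<phi> (Collect smooth)"
    then consider "f = \<phi>" | "smooth f" by auto
    then show "\<exists>f'\<in>insert \<phi> (Collect smooth). \<forall>x. (f has_real_derivative f' x) (at x)"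
    proof cases
      case 1
      then show ?thesis using \<phi>' s by (intro bexI[of _ \<psi>]) auto
    next
      case 2
      then show ?thesis using smooth_deriv[OF 2] by (intro bexI[of _ "deriv f"]) auto
    qed
  qed simp
  have \<phi>l: "\<phi> l = 0"
    using ip_derivative[of l \<phi> \<psi> l] \<phi>' smooth_continuous[OF s] l zero
    by (simp add: has_field_derivative_at_within ip_l \<phi>_def)
  have const: "\<phi> y = \<phi> z" if "y \<in> S" "z \<in> S" "convex S" "S \<inter> {a..b} = {}" for y z S
  proof -
    have "\<exists>c. \<forall>x\<in>S. \<phi> x = c"
    proof (rule has_field_derivative_zero_constant[OF that(3)])
      fix x assume "x \<in> S"
      then have "\<psi> x = 0" using that(4) by (intro ab(3)) auto
      then show "(\<phi> has_real_derivative 0) (at x within S)"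
        using \<phi>'[of x] by (simp add: has_field_derivative_at_within)
    qed
    then show ?thesis using that by metis
  qed
  have "\<phi> y = 0" if "y \<notin> {a..b}" for y
  proof (cases "y < a")
    case True
    then show ?thesis using const[of y "{..<a}" 0] ab by (simp add: \<phi>_def disjoint_iff)
  next
    case False
    then have "y > b" using that by auto
    then show ?thesis using const[of y "{b<..}" l] ab \<phi>l by (simp add: disjoint_iff)
  qed
  then have "\<phi> \<in> test_functions l" unfolding test_functions_iff using ab smooth by blast
  with d show ?thesis by blast
qed

lemma test_functions_diff_scale:
  assumes "\<phi> \<in> test_functions l" "\<psi> \<in> test_functions l"
  shows "(\<lambda>x. \<phi> x - c * \<psi> x) \<in> test_functions l"
proof -
  obtain a b where ab: "0 < a" "b < l" "\<And>y. y \<notin> {a..b} \<Longrightarrow> \<phi> y = 0" and s: "smooth \<phi>"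
    using test_function_interval[OF assms(1)] by metis
  obtain a' b' where ab': "0 < a'" "b' < l" "\<And>y. y \<notin> {a'..b'} \<Longrightarrow> \<psi> y = 0" and s': "smooth \<psi>"
    using test_function_interval[OF assms(2)] by metis
  have "smooth (\<lambda>x. \<phi> x - c * \<psi> x)" using smooth_add_scale[OF s s', of "- c"] by simp
  moreover have "\<phi> y - c * \<psi> y = 0" if "y \<notin> {min a a'..max b b'}" for y
  proof -
    have "y \<notin> {a..b}" "y \<notin> {a'..b'}" using that by auto
    then show ?thesis using ab(3) ab'(3) by simp
  qed
  ultimately show ?thesis unfolding test_functions_iff
    using ab ab' by (intro conjI exI[of _ "min a a'"] exI[of _ "max b b'"]) auto
qed

lemma test_function_mult_integrable:
  assumes "w \<in> L1_loc l" "\<phi> \<in> test_functions l"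
  shows "integrable (\<Omega> l) (\<lambda>x. w x * \<phi> x)"
proof -
  obtain a b where "0 < a" "b < l" "\<And>y. y \<notin> {a..b} \<Longrightarrow> \<phi> y = 0" and s: "smooth \<phi>"
    using test_function_interval[OF assms(2)] by metis
  then show ?thesis by (intro L1_loc_mult_test(1)[OF assms(1) smooth_continuous]) auto
qed

text \<open>A test function has a test function as primitive only if its mean is zero; an arbitrary
  one is corrected by a multiple of the fixed bump \<open>\<theta>\<close>. The constant is the
  average of \<open>u\<close> with weight \<open>\<theta>\<close>.\<close>

lemma du_Bois_Reymond:
  assumes l: "l > 0" and u: "u \<in> L1_loc l"
    and test: "\<And>\<phi>. \<phi> \<in> test_functions l \<Longrightarrow> (\<integral>x. u x * deriv \<phi> x \<partial>\<Omega> l) = 0"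
  shows "\<exists>c. ae_eq l u (\<lambda>x. c)"
proof -
  define \<theta> where "\<theta> = bump (l / 3) (2 * l / 3) 1"
  have \<theta>: "\<theta> \<in> test_functions l" unfolding \<theta>_def by (rule bump_test_function) (use l in auto)
  define m where "m = (\<integral>x. \<theta> x \<partial>\<Omega> l)"
  have one: "(\<lambda>x. 1) \<in> L1_loc l" by (rule L2_L1_loc[OF L2_const])
  have "m \<noteq> 0"
  proof
    assume "m = 0"
    have "integrable (\<Omega> l) \<theta>" using test_function_mult_integrable[OF one \<theta>] by simp
    moreover have "AE x in \<Omega> l. 0 \<le> \<theta> x" by (simp add: \<theta>_def bump_bounds)
    ultimately have "AE x in \<Omega> l. \<theta> x = 0"
      using \<open>m = 0\<close> by (simp add: m_def integral_nonneg_eq_0_iff_AE)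
    then have ae: "ae_eq l \<theta> (\<lambda>x. 0)" by (simp add: ae_eq_def)
    have "(\<integral>x. indicat_real {l / 3<..<2 * l / 3} x \<partial>\<Omega> l) = (\<integral>x. 0 \<partial>\<Omega> l)"
    proof (rule integral_ae_eq)
      show "indicat_real {l / 3<..<2 * l / 3} \<in> borel_measurable (\<Omega> l)"
        by (intro measurable_restrict_space1 borel_measurable_indicator) simp
      show "ae_eq l (indicator {l / 3<..<2 * l / 3}) (\<lambda>x. 0)"
        using ae unfolding ae_eq_def
      proof eventually_elim
        fix x assume "\<theta> x = 0"
        then show "indicat_real {l / 3<..<2 * l / 3} x = 0"
          using bump_pos[of 1 x "l / 3" "2 * l / 3"] by (auto simp: \<theta>_def indicator_def)
      qed
    qed
    moreover have "(\<integral>x. indicat_real {l / 3<..<2 * l / 3} x \<partial>\<Omega> l) = 2 * l / 3 - l / 3"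
      by (rule integral_indicator_interval) (use l in auto)
    ultimately have "2 * l / 3 - l / 3 = (\<integral>x. 0 \<partial>\<Omega> l)" by (rule trans[OF sym, rotated])
    then show False using l by simp
  qed
  define c where "c = (\<integral>x. u x * \<theta> x \<partial>\<Omega> l) / m"
  have uc: "(\<lambda>x. u x - c) \<in> L1_loc l"
    using u L2_L1_loc[OF L2_const[of c]] unfolding L1_loc_def by (auto intro: set_integral_diff(1))
  have "ae_eq l (\<lambda>x. u x - c) (\<lambda>x. 0)"
  proof (rule fundamental_lemma[OF uc])
    fix \<psi> assume \<psi>: "\<psi> \<in> test_functions l"
    define k where "k = (\<integral>x. \<psi> x \<partial>\<Omega> l) / m"
    have i\<theta>: "integrable (\<Omega> l) \<theta>" "integrable (\<Omega> l) \<psi>"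
      using test_function_mult_integrable[OF one] \<theta> \<psi> by simp_all
    have iu: "integrable (\<Omega> l) (\<lambda>x. u x * \<theta> x)" "integrable (\<Omega> l) (\<lambda>x. u x * \<psi> x)"
      using test_function_mult_integrable[OF u] \<theta> \<psi> by simp_all
    have "(\<integral>x. \<psi> x - k * \<theta> x \<partial>\<Omega> l) = 0"
      using i\<theta> \<open>m \<noteq> 0\<close> by (simp add: k_def m_def[symmetric])
    then obtain \<phi> where \<phi>: "\<phi> \<in> test_functions l" "deriv \<phi> = (\<lambda>x. \<psi> x - k * \<theta> x)"
      using test_function_antiderivative[OF l test_functions_diff_scale[OF \<psi> \<theta>]] by blast
    have "0 = (\<integral>x. u x * \<psi> x - k * (u x * \<theta> x) \<partial>\<Omega> l)"
      using test[OF \<phi>(1)] unfolding \<phi>(2) by (simp add: algebra_simps)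
    also have "\<dots> = (\<integral>x. u x * \<psi> x \<partial>\<Omega> l) - k * (c * m)"
      using iu \<open>m \<noteq> 0\<close> by (simp add: c_def)
    also have "k * (c * m) = c * (\<integral>x. \<psi> x \<partial>\<Omega> l)" using \<open>m \<noteq> 0\<close> by (simp add: k_def)
    also have "(\<integral>x. u x * \<psi> x \<partial>\<Omega> l) - c * (\<integral>x. \<psi> x \<partial>\<Omega> l) = (\<integral>x. (u x - c) * \<psi> x \<partial>\<Omega> l)"
      using iu i\<theta> by (simp add: left_diff_distrib)
    finally show "(\<integral>x. (u x - c) * \<psi> x \<partial>\<Omega> l) = 0" by simp
  qed
  then have "ae_eq l u (\<lambda>x. c)" unfolding ae_eq_def by (elim eventually_mono) simp
  then show ?thesis ..
qed

lemma weak_deriv_unique: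
  assumes "has_weak_deriv l u v" "has_weak_deriv l u w"
  shows "ae_eq l v w"
proof -
  have vw: "v \<in> L1_loc l" "w \<in> L1_loc l" using assms by (auto simp: has_weak_deriv_def)
  then have "(\<lambda>x. v x - w x) \<in> L1_loc l"
    unfolding L1_loc_def by (auto intro: set_integral_diff(1))
  then have "ae_eq l (\<lambda>x. v x - w x) (\<lambda>x. 0)"
  proof (rule fundamental_lemma)
    fix \<phi> assume \<phi>: "\<phi> \<in> test_functions l"
    have "(\<integral>x. v x * \<phi> x \<partial>\<Omega> l) = (\<integral>x. w x * \<phi> x \<partial>\<Omega> l)"
      using bspec[OF conjunct2[OF conjunct2[OF assms(1)[unfolded has_weak_deriv_def]]] \<phi>]
        bspec[OF conjunct2[OF conjunct2[OF assms(2)[unfolded has_weak_deriv_def]]] \<phi>] by simp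
    then show "(\<integral>x. (v x - w x) * \<phi> x \<partial>\<Omega> l) = 0"
      using test_function_mult_integrable[OF vw(1) \<phi>] test_function_mult_integrable[OF vw(2) \<phi>]
      by (simp add: left_diff_distrib)
  qed
  then show ?thesis unfolding ae_eq_def by (elim eventually_mono) simp
qed


text \<open>The set of disagreement inside the interval is open and null, hence empty; continuity
  adds the end points. This gives the boundary values of a class their meaning.\<close>

lemma continuous_ae_eq_imp_eq:
  assumes u: "continuous_on {0..l} u" and v: "continuous_on {0..l} v" and l: "l > 0"
    and ae: "ae_eq l u v" and y: "y \<in> {0..l}"
  shows "u y = v y"
proof -
  define S where "S = {0<..<l} \<inter> (\<lambda>x. u x - v x) -` (- {0})"
  have cont: "continuous_on {0..l} (\<lambda>x. u x - v x)" by (intro continuous_on_diff u v)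
  have "open S" unfolding S_def
    by (rule continuous_open_preimage[OF continuous_on_subset[OF cont]]) auto
  moreover have "negligible S"
  proof -
    have "AE x in lebesgue. x \<notin> S"
      using ae unfolding ae_eq_def AE_\<Omega>_iff by (elim eventually_mono) (auto simp: S_def)
    moreover have "S \<in> sets lebesgue" using \<open>open S\<close> by simp
    ultimately show ?thesis
      by (simp add: negligible_iff_null_sets AE_iff_null_sets)
  qed
  ultimately have "S = {}" using open_not_negligible by blast
  then have "u x - v x = 0" if "x \<in> {0<..<l}" for x using that by (auto simp: S_def)
  then have "u y - v y = 0"
    by (rule continuous_constant_on_closure[where S = "{0<..<l}" and f = "\<lambda>x. u x - v x", rotated])
      (use l y cont in simp_all)
  then show ?thesis by simp
qed

section \<open>Absolutely continuous representatives\<close>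

lemma ac_rep_ae_eq: "ae_eq l (ac_rep l u) u"
proof (cases "\<exists>v\<in>AC l. ae_eq l v u")
  case True
  then have "\<exists>v. v \<in> AC l \<and> ae_eq l v u" by blast
  from someI_ex[OF this] True show ?thesis by (simp add: ac_rep_def)
qed (simp add: ac_rep_def)

lemma ac_rep_AC:
  assumes "v \<in> AC l" "ae_eq l v u" shows "ac_rep l u \<in> AC l"
proof -
  have "\<exists>v. v \<in> AC l \<and> ae_eq l v u" using assms by blast
  from someI_ex[OF this] show ?thesis using assms by (auto simp: ac_rep_def)
qed

text \<open>The choice inside \<open>ac_rep\<close> is harmless: two continuous representatives of
  one class agree on the closed interval.\<close>

lemma ac_rep_eq:
  assumes "l > 0" "v \<in> AC l" "ae_eq l v u" "y \<in> {0..l}"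
  shows "ac_rep l u y = v y"
  by (rule continuous_ae_eq_imp_eq[OF AC_continuous_on[OF ac_rep_AC[OF assms(2,3)]] AC_continuous_on[OF assms(2)]
        assms(1) ae_eq_trans[OF ac_rep_ae_eq ae_eq_sym[OF assms(3)]] assms(4)])

lemma AC_cong:
  assumes "u \<in> AC l" "\<And>y. y \<in> {0..l} \<Longrightarrow> u y = v y"
  shows "v \<in> AC l"
proof -
  have "(\<Sum>i<n. \<bar>u (b i) - u (a i)\<bar>) = (\<Sum>i<n. \<bar>v (b i) - v (a i)\<bar>)"
    if ab: "\<forall>i<n. 0 \<le> a i \<and> a i \<le> b i \<and> b i \<le> l" for n :: nat and a b
  proof (rule sum.cong)
    fix i assume "i \<in> {..<n}"
    then have "a i \<in> {0..l}" "b i \<in> {0..l}" using ab by force+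
    then show "\<bar>u (b i) - u (a i)\<bar> = \<bar>v (b i) - v (a i)\<bar>" using assms(2) by simp
  qed simp
  then show ?thesis using assms(1) unfolding AC_def mem_Collect_eq by (simp cong: imp_cong)
qed

subsection \<open>Primitives of square integrable functions\<close>

text \<open>Pointwise substitute for "absolutely continuous with weak derivative
  \<open>\<phi>\<close> in L^2"; \<open>prim_weak_deriv\<close> and
  \<open>weak_deriv_imp_prim\<close> relate the two. In contrast to \<open>wd\<close> it involves no
  choice, so it is evidently linear and determines boundary values.\<close>

definition prim :: "real \<Rightarrow> (real \<Rightarrow> real) \<Rightarrow> (real \<Rightarrow> real) \<Rightarrow> bool" where
  "prim l f \<phi> \<longleftrightarrow> \<phi> \<in> L2 l \<and> (\<exists>c. \<forall>y\<in>{0..l}. f y = c + ip l \<phi> y)"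

lemma primI: "\<phi> \<in> L2 l \<Longrightarrow> (\<And>y. y \<in> {0..l} \<Longrightarrow> f y = c + ip l \<phi> y) \<Longrightarrow> prim l f \<phi>"
  unfolding prim_def by blast

lemma primE:
  assumes "prim l f \<phi>"
  obtains c where "\<phi> \<in> L2 l" "\<And>y. y \<in> {0..l} \<Longrightarrow> f y = c + ip l \<phi> y"
  using assms unfolding prim_def by blast

lemma prim_eq:
  assumes "prim l f \<phi>" "y \<in> {0..l}" shows "f y = f 0 + ip l \<phi> y"
proof -
  obtain c where c: "\<And>y. y \<in> {0..l} \<Longrightarrow> f y = c + ip l \<phi> y" using assms(1) unfolding prim_def by blast
  show ?thesis using c[of 0] c[OF assms(2)] assms(2) by simp
qed

lemma prim_L2: "prim l f \<phi> \<Longrightarrow> \<phi> \<in> L2 l"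
  by (erule primE)

lemma prim_cong:
  assumes "prim l f \<phi>" "\<And>y. y \<in> {0..l} \<Longrightarrow> f y = g y" shows "prim l g \<phi>"
proof -
  obtain c where c: "\<phi> \<in> L2 l" "\<And>y. y \<in> {0..l} \<Longrightarrow> f y = c + ip l \<phi> y" using assms(1) unfolding prim_def by blast
  show ?thesis by (rule primI[OF c(1)]) (use c(2) assms(2) in force)
qed

lemma prim_cong_ae:
  assumes "prim l f \<phi>" "ae_eq l \<phi> \<psi>" shows "prim l f \<psi>"
proof -
  obtain c where c: "\<phi> \<in> L2 l" "\<And>y. y \<in> {0..l} \<Longrightarrow> f y = c + ip l \<phi> y" using assms(1) unfolding prim_def by blast
  show ?thesis
    by (rule primI[OF L2_ae_eq[OF c(1) assms(2)]]) (simp add: c(2) ip_cong_ae[OF c(1) assms(2)])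
qed

lemma prim_ip: "\<phi> \<in> L2 l \<Longrightarrow> prim l (ip l \<phi>) \<phi>"
  by (rule primI[of _ _ _ 0]) auto

lemma prim_const: "prim l (\<lambda>y. c) (\<lambda>y. 0)"
  using ip_scale[of l 0 "\<lambda>x. 0"] by (intro primI[of _ _ _ c] L2_const) simp

lemma prim_add:
  assumes "prim l f \<phi>" "prim l g \<psi>" shows "prim l (\<lambda>y. f y + g y) (\<lambda>y. \<phi> y + \<psi> y)"
proof -
  obtain c where c: "\<phi> \<in> L2 l" "\<And>y. y \<in> {0..l} \<Longrightarrow> f y = c + ip l \<phi> y" using assms(1) unfolding prim_def by blast
  obtain d where d: "\<psi> \<in> L2 l" "\<And>y. y \<in> {0..l} \<Longrightarrow> g y = d + ip l \<psi> y" using assms(2) unfolding prim_def by blast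
  show ?thesis by (rule primI[of _ _ _ "c + d"]) (simp_all add: c d L2_add ip_add)
qed

lemma prim_scale:
  assumes "prim l f \<phi>" shows "prim l (\<lambda>y. k * f y) (\<lambda>y. k * \<phi> y)"
proof -
  obtain c where c: "\<phi> \<in> L2 l" "\<And>y. y \<in> {0..l} \<Longrightarrow> f y = c + ip l \<phi> y" using assms(1) unfolding prim_def by blast
  show ?thesis by (rule primI[of _ _ _ "k * c"]) (simp_all add: c L2_scale ip_scale distrib_left)
qed

lemma prim_minus: "prim l f \<phi> \<Longrightarrow> prim l (\<lambda>y. - f y) (\<lambda>y. - \<phi> y)"
  using prim_scale[of l f \<phi> "- 1"] by simp

lemma prim_id: "prim l (\<lambda>y. y) (\<lambda>y. 1)"
proof (rule primI[of _ _ _ 0])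
  fix y assume "y \<in> {0..l}"
  then have "ip l (\<lambda>x. 1) y = y - 0"
    by (intro ip_derivative) (auto intro!: derivative_eq_intros)
  then show "y = 0 + ip l (\<lambda>x. 1) y" by simp
qed (rule L2_const)

lemma prim_jp:
  assumes "\<phi> \<in> L2 l" shows "prim l (jp l \<phi>) (\<lambda>y. - \<phi> y)"
  using ip_scale[of l "- 1" \<phi>] by (intro primI[of _ _ _ "ip l \<phi> l"]) (simp_all add: assms L2_minus jp_eq)

lemma prim_AC: "prim l f \<phi> \<Longrightarrow> f \<in> AC l"
proof (erule primE)
  fix c assume "\<phi> \<in> L2 l" and c: "\<And>y. y \<in> {0..l} \<Longrightarrow> f y = c + ip l \<phi> y"
  from this(1) show "f \<in> AC l" by (rule AC_cong[OF AC_ip[of \<phi> l c]]) (simp add: c)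
qed

lemma prim_L2': "prim l f \<phi> \<Longrightarrow> f \<in> L2 l"
  by (rule continuous_on_imp_L2[OF AC_continuous_on[OF prim_AC]])

text \<open>Integration by parts is the adjoint relation \<open>ip_adjoint\<close>, because
  integrating \<open>deriv \<psi>\<close> from the right gives \<open>- \<psi>\<close>.\<close>

lemma prim_weak_deriv:
  assumes l: "l > 0" and f: "prim l f \<phi>"
  shows "has_weak_deriv l f \<phi>"
  unfolding has_weak_deriv_def
proof (intro conjI ballI)
  show "f \<in> L1_loc l" "\<phi> \<in> L1_loc l" by (rule L2_L1_loc[OF prim_L2'[OF f]] L2_L1_loc[OF prim_L2[OF f]])+
  fix \<psi> assume \<psi>: "\<psi> \<in> test_functions l"
  have \<phi>: "\<phi> \<in> L2 l" by (rule prim_L2[OF f])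
  note T = test_function_ip[OF \<psi>]
  have d: "deriv \<psi> \<in> L2 l" using T(4)[of 0] l by simp
  have "(\<integral>y. f y * deriv \<psi> y \<partial>\<Omega> l) = (\<integral>y. f 0 * deriv \<psi> y + ip l \<phi> y * deriv \<psi> y \<partial>\<Omega> l)"
  proof (rule Bochner_Integration.integral_cong)
    fix y assume "y \<in> space (\<Omega> l)"
    then have "f y = f 0 + ip l \<phi> y" by (intro prim_eq[OF f]) simp
    then show "f y * deriv \<psi> y = f 0 * deriv \<psi> y + ip l \<phi> y * deriv \<psi> y"
      unfolding distrib_right[symmetric] by (rule arg_cong)
  qed simp
  also have "\<dots> = f 0 * (\<integral>y. deriv \<psi> y \<partial>\<Omega> l) + (\<integral>y. ip l \<phi> y * deriv \<psi> y \<partial>\<Omega> l)"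
    using L2_integrable[OF d] L2_mult_integrable[OF ip_L2[OF \<phi>] d] by simp
  also have "(\<integral>y. deriv \<psi> y \<partial>\<Omega> l) = 0" using T(5)[of 0] l by simp
  also have "(\<integral>y. ip l \<phi> y * deriv \<psi> y \<partial>\<Omega> l) = (\<integral>y. \<phi> y * jp l (deriv \<psi>) y \<partial>\<Omega> l)"
    by (rule ip_adjoint[OF \<phi> d])
  also have "\<dots> = (\<integral>y. - (\<phi> y * \<psi> y) \<partial>\<Omega> l)"
    by (rule Bochner_Integration.integral_cong) (auto simp: T(2))
  finally show "(\<integral>y. f y * deriv \<psi> y \<partial>\<Omega> l) = - (\<integral>y. \<phi> y * \<psi> y \<partial>\<Omega> l)" by simp
qed

text \<open>\<open>f - ip l v\<close> has weak derivative zero: it is constant almost everywhere by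
  du Bois-Reymond, and everywhere on the interval by continuity.\<close>

lemma weak_deriv_imp_prim:
  assumes l: "l > 0" and f: "f \<in> AC l" and fv: "has_weak_deriv l f v" and v: "v \<in> L2 l"
  shows "prim l f v"
proof -
  have fL: "f \<in> L2 l" by (rule continuous_on_imp_L2[OF AC_continuous_on[OF f]])
  have "\<exists>c. ae_eq l (\<lambda>y. f y - ip l v y) (\<lambda>y. c)"
  proof (rule du_Bois_Reymond[OF l])
    show "(\<lambda>y. f y - ip l v y) \<in> L1_loc l" by (intro L2_L1_loc L2_diff fL ip_L2 v)
    fix \<psi> assume \<psi>: "\<psi> \<in> test_functions l"
    have d: "deriv \<psi> \<in> L2 l" using test_function_ip(4)[OF \<psi>, of 0] l by simp
    have "(\<integral>y. (f y - ip l v y) * deriv \<psi> y \<partial>\<Omega> l)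
        = (\<integral>y. f y * deriv \<psi> y \<partial>\<Omega> l) - (\<integral>y. ip l v y * deriv \<psi> y \<partial>\<Omega> l)"
      using L2_mult_integrable[OF fL d] L2_mult_integrable[OF ip_L2[OF v] d] by (simp add: left_diff_distrib)
    also have "\<dots> = 0"
      using bspec[OF conjunct2[OF conjunct2[OF fv[unfolded has_weak_deriv_def]]] \<psi>]
        bspec[OF conjunct2[OF conjunct2[OF prim_weak_deriv[OF l prim_ip[OF v], unfolded has_weak_deriv_def]]] \<psi>]
      by simp
    finally show "(\<integral>y. (f y - ip l v y) * deriv \<psi> y \<partial>\<Omega> l) = 0" .
  qed
  then obtain c where c: "ae_eq l (\<lambda>y. f y - ip l v y) (\<lambda>y. c)" ..
  have "f y - ip l v y = c" if "y \<in> {0..l}" for y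
    by (rule continuous_ae_eq_imp_eq[OF _ _ l c that])
      (intro continuous_intros AC_continuous_on f ip_continuous_on v)+
  then show ?thesis by (intro primI[of _ _ _ c] v) (simp add: algebra_simps)
qed

lemma weak_deriv_some:
  assumes "has_weak_deriv l u v"
  shows "ae_eq l (wd l u) v"
proof -
  have "has_weak_deriv l u (SOME v. has_weak_deriv l u v)" using assms by (rule someI[where P = "has_weak_deriv l u"])
  then have "ae_eq l (SOME v. has_weak_deriv l u v) v" using assms by (rule weak_deriv_unique)
  then show ?thesis unfolding wd_def by (rule ae_eq_trans[OF ac_rep_ae_eq])
qed

lemma prim_wd:
  assumes "l > 0" "prim l f \<phi>"
  shows "ae_eq l (wd l f) \<phi>" "wd l f \<in> L2 l" "prim l f (wd l f)"
proof -
  show ae: "ae_eq l (wd l f) \<phi>" by (rule weak_deriv_some[OF prim_weak_deriv[OF assms]])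
  show "wd l f \<in> L2 l" by (rule L2_ae_eq[OF prim_L2[OF assms(2)] ae_eq_sym[OF ae]])
  show "prim l f (wd l f)" by (rule prim_cong_ae[OF assms(2) ae_eq_sym[OF ae]])
qed

lemma prim_wd_AC:
  assumes l: "l > 0" and f: "prim l f \<phi>" and \<phi>: "\<phi> \<in> AC l"
  shows "wd l f \<in> AC l" "y \<in> {0..l} \<Longrightarrow> wd l f y = \<phi> y"
proof -
  have "has_weak_deriv l f (SOME v. has_weak_deriv l f v)" using prim_weak_deriv[OF l f] by (rule someI[where P = "has_weak_deriv l f"])
  then have ae: "ae_eq l \<phi> (SOME v. has_weak_deriv l f v)"
    using prim_weak_deriv[OF l f] weak_deriv_unique by blast
  show "wd l f \<in> AC l" unfolding wd_def by (rule ac_rep_AC[OF \<phi> ae])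
  show "wd l f y = \<phi> y" if "y \<in> {0..l}" unfolding wd_def by (rule ac_rep_eq[OF l \<phi> ae that])
qed

text \<open>The first derivative has an absolutely continuous representative, so
  \<open>wd l f\<close> is known at every point of the closed interval and can be differentiated
  again; the second derivative is known only almost everywhere.\<close>

lemma prim_wd_wd:
  assumes l: "l > 0" and f: "prim l f \<phi>" and \<phi>: "prim l \<phi> \<psi>"
  shows "prim l (wd l f) \<psi>" "ae_eq l (wd l (wd l f)) \<psi>" "wd l f \<in> AC l"
    "y \<in> {0..l} \<Longrightarrow> wd l f y = \<phi> y"
proof -
  note AC = prim_wd_AC[OF l f prim_AC[OF \<phi>]]
  show "prim l (wd l f) \<psi>" by (rule prim_cong[OF \<phi>]) (simp add: AC(2))
  then show "ae_eq l (wd l (wd l f)) \<psi>" by (rule prim_wd(1)[OF l])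
  show "wd l f \<in> AC l" "y \<in> {0..l} \<Longrightarrow> wd l f y = \<phi> y" using AC by auto
qed

lemma prim_Sobolev_1:
  assumes "l > 0" "prim l f \<phi>" shows "f \<in> Sobolev l 1"
  using prim_L2[OF assms(2)] prim_L2'[OF assms(2)] prim_weak_deriv[OF assms] by auto

lemma prim_Sobolev_2:
  assumes "l > 0" "prim l f \<phi>" "prim l \<phi> \<psi>" shows "f \<in> Sobolev l 2"
  using prim_L2'[OF assms(2)] prim_weak_deriv[OF assms(1,2)] prim_Sobolev_1[OF assms(1,3)]
  by (auto simp: numeral_2_eq_2)

lemma Sobolev_1_prim:
  assumes "l > 0" "f \<in> Sobolev l 1" "f \<in> AC l"
  shows "prim l f (wd l f)"
proof -
  obtain v where "v \<in> L2 l" "has_weak_deriv l f v" using assms(2) by auto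
  then have "prim l f v" using weak_deriv_imp_prim assms by blast
  then show ?thesis by (rule prim_wd(3)[OF assms(1)])
qed

lemma has_weak_deriv_cong_ae:
  assumes "has_weak_deriv l u v" "ae_eq l u w" "u \<in> L2 l"
  shows "has_weak_deriv l w v"
proof -
  have w: "w \<in> L2 l" by (rule L2_ae_eq[OF assms(3,2)])
  have "(\<integral>y. u y * deriv \<phi> y \<partial>\<Omega> l) = (\<integral>y. w y * deriv \<phi> y \<partial>\<Omega> l)" if \<phi>: "\<phi> \<in> test_functions l" for \<phi>
  proof (rule integral_ae_eq)
    have "deriv \<phi> \<in> borel_measurable (\<Omega> l)"
      using test_function_interval[OF \<phi>] smooth_deriv(2) smooth_continuous
        continuous_imp_measurable_on_sets_lebesgue[of "{0<..<l}" "deriv \<phi>"] by fastforce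
    then show "(\<lambda>y. u y * deriv \<phi> y) \<in> borel_measurable (\<Omega> l)"
      by (intro borel_measurable_times L2_measurable[OF assms(3)])
    show "ae_eq l (\<lambda>y. u y * deriv \<phi> y) (\<lambda>y. w y * deriv \<phi> y)"
      using assms(2) unfolding ae_eq_def by (elim eventually_mono) simp
  qed
  then show ?thesis using assms(1) L2_L1_loc[OF w] by (simp add: has_weak_deriv_def)
qed

lemma Sobolev_2_prim:
  assumes l: "l > 0" and f: "f \<in> Sobolev l 2" "f \<in> AC l" and wf: "wd l f \<in> AC l"
  shows "prim l f (wd l f)" "prim l (wd l f) (wd l (wd l f))"
proof -
  obtain v w where v: "v \<in> L2 l" "has_weak_deriv l f v" and w: "w \<in> L2 l" "has_weak_deriv l v w"
    using f(1) by (auto simp: numeral_2_eq_2)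
  have "prim l f v" by (rule weak_deriv_imp_prim[OF l f(2) v(2,1)])
  then show "prim l f (wd l f)" by (rule prim_wd(3)[OF l])
  \<comment> \<open>The Sobolev witness \<open>v\<close> and \<open>wd l f\<close> agree only almost
    everywhere, which suffices for weak derivatives.\<close>
  have "has_weak_deriv l (wd l f) w"
    by (rule has_weak_deriv_cong_ae[OF w(2) ae_eq_sym[OF weak_deriv_some[OF v(2)]] v(1)])
  then have "prim l (wd l f) w" by (rule weak_deriv_imp_prim[OF l wf _ w(1)])
  then show "prim l (wd l f) (wd l (wd l f))" by (rule prim_wd(3)[OF l])
qed

section \<open>Integral operators on the Hilbert space\<close>

text \<open>The orthogonal projection onto the functions that vanish off (0,l).\<close>

lift_definition cut :: "real \<Rightarrow> l2 \<Rightarrow> l2" is "\<lambda>l f x. if 0 < x \<and> x < l then f x else 0"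
  by (auto simp: L2_rel_def intro: sq_integrable_cut elim!: eventually_mono)

lemma cut_abs_l2: "sq_integrable f \<Longrightarrow> cut l (abs_l2 f) = l2_of l f"
  unfolding l2_of_def by (rule cut.abs_eq) (simp add: L2_rel_def)

lemma L2_of_sq_integrable: "sq_integrable f \<Longrightarrow> f \<in> L2 l"
  by (simp add: L2_iff_sq_integrable sq_integrable_cut)

lemma ex_function: "\<exists>u. u \<in> L2 l \<and> l2_of l u = cut l x"
  using abs_l2_rep[of x] cut_abs_l2 L2_of_sq_integrable by metis

text \<open>A chosen representative on (0,l). The choice respects sums and multiples only up to null
  sets, see \<open>fn_add\<close> and \<open>fn_scaleR\<close>.\<close>

definition fn :: "real \<Rightarrow> l2 \<Rightarrow> real \<Rightarrow> real" where
  "fn l x = (SOME u. u \<in> L2 l \<and> l2_of l u = cut l x)"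

lemma fn_L2: "fn l x \<in> L2 l" and l2_of_fn: "l2_of l (fn l x) = cut l x"
  using someI_ex[OF ex_function[of l x]] by (auto simp: fn_def)

lemma cut_l2_of [simp]: "u \<in> L2 l \<Longrightarrow> cut l (l2_of l u) = l2_of l u"
  unfolding L2_iff_sq_integrable l2_of_def[of l u]
  by (subst cut_abs_l2) (auto simp: l2_of_def intro!: arg_cong[of _ _ abs_l2])

lemma cut_add: "cut l (x + y) = cut l x + cut l y"
  by transfer (auto simp: L2_rel_def intro!: sq_integrable_cut sq_integrable_add)

lemma cut_scaleR: "cut l (c *\<^sub>R x) = c *\<^sub>R cut l x"
  by transfer (auto simp: L2_rel_def intro!: sq_integrable_cut sq_integrable_scale)

lemma cut_cut [simp]: "cut l (cut l x) = cut l x"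
  by (metis cut_l2_of fn_L2 l2_of_fn)

lemma cut_inner: "cut l x \<bullet> y = x \<bullet> cut l y"
proof transfer
  fix l :: real and f g assume "L2_rel f f" "L2_rel g g"
  show "(\<integral>x. (if 0 < x \<and> x < l then f x else 0) * g x \<partial>lebesgue)
      = (\<integral>x. f x * (if 0 < x \<and> x < l then g x else 0) \<partial>lebesgue)"
    by (rule Bochner_Integration.integral_cong) auto
qed

lemma cut_inner_cut: "cut l x \<bullet> cut l y = cut l x \<bullet> y"
  by (metis cut_cut cut_inner)

lemma norm_cut_le: "norm (cut l x) \<le> norm x"
proof -
  have "norm (cut l x) * norm (cut l x) = cut l x \<bullet> x"
    using cut_inner_cut[of l x x] by (simp add: power2_norm_eq_inner[symmetric] power2_eq_square)
  also have "\<dots> \<le> norm (cut l x) * norm x" by (rule norm_cauchy_schwarz)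
  finally show ?thesis by (cases "cut l x = 0") auto
qed

lemma bounded_linear_cut: "bounded_linear (cut l)"
  by (rule bounded_linear_intro[where K = 1]) (simp_all add: cut_add cut_scaleR norm_cut_le)

lemma fn_add: "ae_eq l (fn l (x + y)) (\<lambda>s. fn l x s + fn l y s)"
  by (subst l2_of_eq_iff[symmetric]) (simp_all add: fn_L2 L2_add l2_of_fn l2_of_add cut_add)

lemma fn_scaleR: "ae_eq l (fn l (c *\<^sub>R x)) (\<lambda>s. c * fn l x s)"
  by (subst l2_of_eq_iff[symmetric]) (simp_all add: fn_L2 L2_scale l2_of_fn l2_of_scale cut_scaleR)

lemma fn_l2_of: "u \<in> L2 l \<Longrightarrow> ae_eq l (fn l (l2_of l u)) u"
  by (subst l2_of_eq_iff[symmetric]) (simp_all add: fn_L2 l2_of_fn)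

lemma L2_norm_le:
  assumes "l > 0" "u \<in> L2 l" "\<And>y. 0 < y \<Longrightarrow> y < l \<Longrightarrow> \<bar>u y\<bar> \<le> B" "B \<ge> 0"
  shows "L2_norm l u \<le> B * sqrt l"
proof -
  have "(\<integral>y. (u y)\<^sup>2 \<partial>\<Omega> l) \<le> (\<integral>y. B\<^sup>2 \<partial>\<Omega> l)"
  proof (rule integral_mono)
    show "integrable (\<Omega> l) (\<lambda>y. (u y)\<^sup>2)" using assms(2) by (simp add: L2_def)
    show "integrable (\<Omega> l) (\<lambda>y. B\<^sup>2)" by (rule L2_integrable[OF L2_const])
    show "(u y)\<^sup>2 \<le> B\<^sup>2" if "y \<in> space (\<Omega> l)" for y
      using power_mono[OF assms(3)[of y], of 2] that by simp
  qed
  also have "(\<integral>y. B\<^sup>2 \<partial>\<Omega> l) = B\<^sup>2 * ip l (\<lambda>x. 1) l"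
    using integral_mult_right_zero[of "\<Omega> l" "B\<^sup>2" "\<lambda>x. 1"] by (simp only: ip_l mult_1_right)
  also have "ip l (\<lambda>x. 1) l = l - 0"
    by (rule ip_derivative[of l "\<lambda>x. x"]) (use assms(1) in \<open>auto intro!: derivative_eq_intros\<close>)
  finally have "L2_norm l u \<le> sqrt (B\<^sup>2 * l)" by (simp add: L2_norm_def)
  then show ?thesis using assms(4) by (simp add: real_sqrt_mult)
qed

lemma integral_indicator_mult_le:
  assumes l: "l > 0" and u: "u \<in> L2 l" and A: "A \<in> sets borel"
  shows "\<bar>\<integral>s. indicator A s * u s \<partial>\<Omega> l\<bar> \<le> sqrt l * L2_norm l u"
proof -
  have A': "indicat_real A \<in> L2 l" using L2_indicator_mult[OF L2_const[of 1] A] by simp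
  have "\<bar>\<integral>s. indicator A s * u s \<partial>\<Omega> l\<bar> \<le> L2_norm l (indicator A) * L2_norm l u"
    by (rule L2_Cauchy_Schwarz[OF A' u])
  also have "L2_norm l (indicator A) \<le> 1 * sqrt l"
    by (rule L2_norm_le[OF l A']) (auto simp: indicator_def)
  finally show ?thesis by (simp add: L2_norm_def mult_right_mono)
qed

definition Iop :: "real \<Rightarrow> l2 \<Rightarrow> l2" where "Iop l x = l2_of l (ip l (fn l x))"
definition Jop :: "real \<Rightarrow> l2 \<Rightarrow> l2" where "Jop l x = l2_of l (jp l (fn l x))"

lemma jp_cong_ae: "u \<in> L2 l \<Longrightarrow> ae_eq l u v \<Longrightarrow> jp l u y = jp l v y"
  using ip_cong_ae[of u l v] L2_ae_eq[of u l v] by (simp add: jp_eq)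

lemma jp_add: "u \<in> L2 l \<Longrightarrow> v \<in> L2 l \<Longrightarrow> jp l (\<lambda>x. u x + v x) y = jp l u y + jp l v y"
  by (simp add: jp_eq L2_add ip_add)

lemma jp_scale: "u \<in> L2 l \<Longrightarrow> jp l (\<lambda>x. c * u x) y = c * jp l u y"
  by (simp add: jp_eq L2_scale ip_scale right_diff_distrib)

lemma Iop_l2_of: "u \<in> L2 l \<Longrightarrow> Iop l (l2_of l u) = l2_of l (ip l u)"
  unfolding Iop_def by (rule l2_of_cong) (rule ip_cong_ae[OF fn_L2 fn_l2_of])

lemma Jop_l2_of: "u \<in> L2 l \<Longrightarrow> Jop l (l2_of l u) = l2_of l (jp l u)"
  unfolding Jop_def by (rule l2_of_cong) (rule jp_cong_ae[OF fn_L2 fn_l2_of])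

lemma L2_norm_fn_le: "L2_norm l (fn l x) \<le> norm x"
  using norm_cut_le[of l x] by (simp add: l2_of_norm[OF fn_L2, symmetric] l2_of_fn)

lemma ip_bound: "l > 0 \<Longrightarrow> u \<in> L2 l \<Longrightarrow> \<bar>ip l u y\<bar> \<le> sqrt l * L2_norm l u"
  unfolding ip_def by (rule integral_indicator_mult_le) auto

lemma jp_bound: "l > 0 \<Longrightarrow> u \<in> L2 l \<Longrightarrow> \<bar>jp l u y\<bar> \<le> sqrt l * L2_norm l u"
  unfolding jp_def by (rule integral_indicator_mult_le) auto

text \<open>Serves \<open>Iop\<close> and \<open>Jop\<close> alike. The condition
  \<open>cong\<close> makes up for \<open>fn l\<close> being linear only almost everywhere; a
  uniform bound with factor \<open>sqrt l\<close>, on an interval of length \<open>l\<close>, gives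
  operator norm at most \<open>l\<close>.\<close>

lemma bounded_linear_l2_of:
  assumes l: "l > 0" and L2: "\<And>u. u \<in> L2 l \<Longrightarrow> T u \<in> L2 l"
    and cong: "\<And>u v y. u \<in> L2 l \<Longrightarrow> ae_eq l u v \<Longrightarrow> T u y = T v y"
    and add: "\<And>u v y. u \<in> L2 l \<Longrightarrow> v \<in> L2 l \<Longrightarrow> T (\<lambda>x. u x + v x) y = T u y + T v y"
    and scale: "\<And>u c y. u \<in> L2 l \<Longrightarrow> T (\<lambda>x. c * u x) y = c * T u y"
    and bound: "\<And>u y. u \<in> L2 l \<Longrightarrow> \<bar>T u y\<bar> \<le> sqrt l * L2_norm l u"
  shows "bounded_linear (\<lambda>x. l2_of l (T (fn l x)))"
proof (rule bounded_linear_intro[where K = l])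
  show "l2_of l (T (fn l (x + y))) = l2_of l (T (fn l x)) + l2_of l (T (fn l y))" for x y
    by (subst l2_of_add[symmetric])
      (auto simp: L2 fn_L2 add[symmetric] intro!: l2_of_cong cong[OF fn_L2 fn_add])
  show "l2_of l (T (fn l (c *\<^sub>R x))) = c *\<^sub>R l2_of l (T (fn l x))" for c x
    by (subst l2_of_scale[symmetric])
      (auto simp: L2 fn_L2 scale[symmetric] intro!: l2_of_cong cong[OF fn_L2 fn_scaleR])
  show "norm (l2_of l (T (fn l x))) \<le> norm x * l" for x
  proof -
    have "norm (l2_of l (T (fn l x))) = L2_norm l (T (fn l x))" by (simp add: l2_of_norm L2 fn_L2)
    also have "\<dots> \<le> (sqrt l * L2_norm l (fn l x)) * sqrt l"
      by (rule L2_norm_le[OF l L2[OF fn_L2]]) (use l bound[OF fn_L2] in \<open>simp_all add: L2_norm_def\<close>)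
    also have "\<dots> = L2_norm l (fn l x) * l" using l by simp
    also have "\<dots> \<le> norm x * l" using l L2_norm_fn_le by (intro mult_right_mono) auto
    finally show ?thesis .
  qed
qed

lemma bounded_linear_Iop: "l > 0 \<Longrightarrow> bounded_linear (Iop l)"
  unfolding Iop_def[abs_def]
  by (rule bounded_linear_l2_of) (simp_all add: ip_L2 ip_cong_ae ip_add ip_scale ip_bound)

lemma bounded_linear_Jop: "l > 0 \<Longrightarrow> bounded_linear (Jop l)"
  unfolding Jop_def[abs_def]
  by (rule bounded_linear_l2_of)
    (simp_all add: jp_L2 jp_cong_ae jp_add jp_scale jp_bound)

lemma cut_Iop [simp]: "cut l (Iop l x) = Iop l x" and cut_Jop [simp]: "cut l (Jop l x) = Jop l x"
  by (simp_all add: Iop_def Jop_def ip_L2 jp_L2 fn_L2)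

lemma Iop_cut [simp]: "Iop l (cut l x) = Iop l x" and Jop_cut [simp]: "Jop l (cut l x) = Jop l x"
  by (simp_all add: l2_of_fn[symmetric] Iop_l2_of Jop_l2_of fn_L2 Iop_def[of l x] Jop_def[of l x])

lemma Iop_adjoint: "Iop l x \<bullet> y = x \<bullet> Jop l y"
proof -
  have "Iop l x \<bullet> y = Iop l x \<bullet> cut l y" by (simp add: cut_inner[symmetric])
  also have "\<dots> = (\<integral>s. ip l (fn l x) s * fn l y s \<partial>\<Omega> l)"
    by (simp add: Iop_def l2_of_fn[symmetric] l2_of_inner ip_L2 fn_L2)
  also have "\<dots> = (\<integral>s. fn l x s * jp l (fn l y) s \<partial>\<Omega> l)" by (rule ip_adjoint[OF fn_L2 fn_L2])
  also have "\<dots> = cut l x \<bullet> Jop l y"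
    by (simp add: Jop_def l2_of_fn[symmetric] l2_of_inner jp_L2 fn_L2)
  also have "\<dots> = x \<bullet> Jop l y" by (simp add: cut_inner)
  finally show ?thesis .
qed

lemma l2_of_zero [simp]: "l2_of l (\<lambda>x. 0) = 0"
  using l2_of_scale[OF L2_const[of 0 l], of 0] by simp

text \<open>A continuous \<open>f\<close> that is zero almost everywhere is zero, and its weak
  derivative is unique. This makes both integral operators injective on functions over
  (0,l).\<close>

lemma prim_zero_imp:
  assumes l: "l > 0" and f: "prim l f \<phi>" and zero: "ae_eq l f (\<lambda>x. 0)"
  shows "l2_of l \<phi> = 0"
proof -
  have "f y = 0" if "y \<in> {0..l}" for y
    by (rule continuous_ae_eq_imp_eq[OF AC_continuous_on[OF prim_AC[OF f]] _ l zero that]) simp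
  then have "prim l (\<lambda>x. 0) \<phi>" by (rule prim_cong[OF f])
  then have "ae_eq l \<phi> (\<lambda>x. 0)"
    using weak_deriv_unique prim_weak_deriv[OF l] prim_const[of l 0] by blast
  then have "l2_of l \<phi> = l2_of l (\<lambda>x. 0)"
    by (subst l2_of_eq_iff) (use prim_L2[OF f] L2_const in auto)
  then show ?thesis by simp
qed

lemma Iop_eq_0:
  assumes "l > 0" "Iop l x = 0" shows "cut l x = 0"
proof -
  have "l2_of l (ip l (fn l x)) = l2_of l (\<lambda>x. 0)" using assms(2) by (simp add: Iop_def)
  then have "ae_eq l (ip l (fn l x)) (\<lambda>x. 0)" by (subst (asm) l2_of_eq_iff) (auto simp: ip_L2 fn_L2 L2_const)
  from prim_zero_imp[OF assms(1) prim_ip[OF fn_L2] this] show ?thesis by (simp add: l2_of_fn)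
qed

lemma Jop_eq_0:
  assumes "l > 0" "Jop l x = 0" shows "cut l x = 0"
proof -
  have "l2_of l (jp l (fn l x)) = l2_of l (\<lambda>x. 0)" using assms(2) by (simp add: Jop_def)
  then have "ae_eq l (jp l (fn l x)) (\<lambda>x. 0)" by (subst (asm) l2_of_eq_iff) (auto simp: jp_L2 fn_L2 L2_const)
  from prim_zero_imp[OF assms(1) prim_jp[OF fn_L2] this] show ?thesis by (simp add: l2_of_minus fn_L2 l2_of_fn)
qed

section \<open>The beam-string system in energy variables\<close>

lemma prim_diff: "prim l f \<phi> \<Longrightarrow> prim l g \<psi> \<Longrightarrow> prim l (\<lambda>y. f y - g y) (\<lambda>y. \<phi> y - \<psi> y)"
  using prim_add[of l f \<phi> "\<lambda>y. - g y" "\<lambda>y. - \<psi> y"] prim_minus[of l g \<psi>] by simp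

lemma ae_eq_lincomb:
  assumes "ae_eq l u u'" "ae_eq l v v'"
  shows "ae_eq l (\<lambda>y. a * u y + b * v y) (\<lambda>y. a * u' y + b * v' y)"
  using assms unfolding ae_eq_def by eventually_elim simp

lemma ae_eq_l2_of:
  assumes "v \<in> L2 l" "ae_eq l u v" shows "l2_of l u = l2_of l v"
  using assms L2_ae_eq[OF assms(1) ae_eq_sym[OF assms(2)]] by (subst l2_of_eq_iff) auto

lemma prim_from_0:
  assumes "prim l f \<phi>" "f 0 = 0" "y \<in> {0..l}" shows "f y = ip l \<phi> y"
  using prim_eq[OF assms(1,3)] assms(2) by linarith

lemma prim_from_l:
  assumes "prim l f \<phi>" "y \<in> {0..l}" shows "f y = f l - jp l \<phi> y"
proof -
  have "f l = f 0 + ip l \<phi> l" by (rule prim_eq[OF assms(1)]) (use assms(2) in auto)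
  moreover have "f y = f 0 + ip l \<phi> y" by (rule prim_eq[OF assms])
  ultimately show ?thesis using jp_eq[OF prim_L2[OF assms(1)], of y] by linarith
qed

lemma l2_of_prim_0: "prim l f \<phi> \<Longrightarrow> f 0 = 0 \<Longrightarrow> l2_of l f = Iop l (l2_of l \<phi>)"
  by (subst Iop_l2_of) (auto simp: prim_L2 intro!: l2_of_cong prim_from_0)

text \<open>Meant for moment and stress, whose conditions sit at \<open>y = l\<close>: integration
  from the right produces \<open>Jop\<close>, while the boundary value survives as a multiple of a
  fixed function. This is the origin of \<open>E\<close>.\<close>

lemma l2_of_prim_l: "prim l f \<phi> \<Longrightarrow> l2_of l f = f l *\<^sub>R l2_of l (\<lambda>y. 1) - Jop l (l2_of l \<phi>)"
  by (subst Jop_l2_of)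
    (auto simp: prim_L2 L2_const L2_scale jp_L2 l2_of_scale[symmetric] l2_of_diff[symmetric]
      intro!: l2_of_cong prim_from_l)

locale beam_string =
  fixes l a1 a2 b1 b2 c1 c2 p1 p2 q1 q2 :: real
  assumes pos: "l > 0" "a1 > 0" "a2 > 0" "b1 > 0" "b2 > 0"
begin

abbreviation "DA \<equiv> dom_A1 l a1 a2 b1 b2"
abbreviation "A1 \<equiv> op_A1 l a1 a2 b1 b2"
abbreviation "A2 \<equiv> op_A2 c1 c2 p1 p2 q1 q2"
abbreviation "B \<equiv> op_B l a1 a2 b1 b2"

text \<open>A state \<open>(f, g, h, z)\<close> is encoded as \<open>(\<surd>a\<^sub>1 f\<^sub>y\<^sub>y, g, \<surd>a\<^sub>2 h\<^sub>y, z)\<close>, which makes the energy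
  norm the plain norm of a product of \<open>L\<^sup>2\<close> spaces.\<close>

definition emb :: "state \<Rightarrow> l2 \<times> l2 \<times> l2 \<times> l2" where
  "emb = (\<lambda>(f, g, h, z).
    (sqrt a1 *\<^sub>R l2_of l (wd l (wd l f)), l2_of l g, sqrt a2 *\<^sub>R l2_of l (wd l h), l2_of l z))"

text \<open>The inverse of \<open>- A\<^sub>1\<close> with homogeneous boundary conditions. The terms \<open>\<beta> - cut l \<beta>\<close> and
  \<open>\<delta> - cut l \<delta>\<close> keep it injective on functions living outside \<open>(0,l)\<close>.\<close>

definition K :: "l2 \<times> l2 \<times> l2 \<times> l2 \<Rightarrow> l2 \<times> l2 \<times> l2 \<times> l2" where
  "K = (\<lambda>(\<alpha>, \<beta>, \<gamma>, \<delta>).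
    ((1 / sqrt a1) *\<^sub>R Jop l (Jop l \<beta>) + (b1 / a1) *\<^sub>R \<alpha>,
     \<beta> - cut l \<beta> - (1 / sqrt a1) *\<^sub>R Iop l (Iop l \<alpha>),
     (1 / sqrt a2) *\<^sub>R Jop l \<delta> + (b2 / a2) *\<^sub>R \<gamma>,
     \<delta> - cut l \<delta> - (1 / sqrt a2) *\<^sub>R Iop l \<gamma>))"

text \<open>The operator \<open>A2\<close> in energy variables. Since \<open>h 0 = 0\<close>, the
  component \<open>h\<close> is recovered from \<open>\<psi> = \<surd>a\<^sub>2 h\<^sub>y\<close> as
  \<open>(1 / sqrt a2) *\<^sub>R Iop l \<psi>\<close>.\<close>

definition P :: "l2 \<times> l2 \<times> l2 \<times> l2 \<Rightarrow> l2 \<times> l2 \<times> l2 \<times> l2" where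
  "P = (\<lambda>(\<phi>, g, \<psi>, z).
    (0, (c1 / sqrt a2) *\<^sub>R Iop l \<psi> + p1 *\<^sub>R z + q1 *\<^sub>R g,
     0, (c2 / sqrt a2) *\<^sub>R Iop l \<psi> + p2 *\<^sub>R z + q2 *\<^sub>R g))"

definition cut4 :: "l2 \<times> l2 \<times> l2 \<times> l2 \<Rightarrow> l2 \<times> l2 \<times> l2 \<times> l2" where
  "cut4 = (\<lambda>(\<alpha>, \<beta>, \<gamma>, \<delta>). (cut l \<alpha>, cut l \<beta>, cut l \<gamma>, cut l \<delta>))"

text \<open>The stationary state with boundary values \<open>(p, q)\<close>: zero velocities, moment
  \<open>p * (y - l)\<close> and constant stress \<open>q\<close>, divided by the stiffnesses and
  weighted as in \<open>emb\<close>.\<close>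

definition E :: "real \<Rightarrow> real \<Rightarrow> l2 \<times> l2 \<times> l2 \<times> l2" where
  "E p q = ((p / sqrt a1) *\<^sub>R l2_of l (\<lambda>y. y - l), 0, (q / sqrt a2) *\<^sub>R l2_of l (\<lambda>y. 1), 0)"

text \<open>The weights of \<open>emb\<close> for a quadruple whose first and third entries are
  already derivatives; in \<open>dom_rep_imp\<close> it encodes \<open>- A1 X\<close>.\<close>

definition V :: "state \<Rightarrow> l2 \<times> l2 \<times> l2 \<times> l2" where
  "V = (\<lambda>(\<alpha>, \<beta>, \<gamma>, \<delta>). (sqrt a1 *\<^sub>R l2_of l \<alpha>, l2_of l \<beta>, sqrt a2 *\<^sub>R l2_of l \<gamma>, l2_of l \<delta>))"

abbreviation "L4 \<equiv> L2 l \<times> L2 l \<times> L2 l \<times> L2 l"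

interpretation I: bounded_linear "Iop l" by (rule bounded_linear_Iop[OF pos(1)])
interpretation J: bounded_linear "Jop l" by (rule bounded_linear_Jop[OF pos(1)])
interpretation C: bounded_linear "cut l" by (rule bounded_linear_cut)

lemma bounded_linear_K: "bounded_linear K"
  unfolding K_def case_prod_beta
  by (intro bounded_linear_Pair bounded_linear_add bounded_linear_sub
      bounded_linear_compose[OF bounded_linear_scaleR_right] bounded_linear_compose[OF I.bounded_linear]
      bounded_linear_compose[OF J.bounded_linear] bounded_linear_compose[OF C.bounded_linear]
      bounded_linear_compose[OF bounded_linear_fst] bounded_linear_compose[OF bounded_linear_snd]
      bounded_linear_fst bounded_linear_snd)

lemma bounded_linear_P: "bounded_linear P"
  unfolding P_def case_prod_beta
  by (intro bounded_linear_Pair bounded_linear_add bounded_linear_zero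
      bounded_linear_compose[OF bounded_linear_scaleR_right] bounded_linear_compose[OF I.bounded_linear]
      bounded_linear_compose[OF bounded_linear_fst] bounded_linear_compose[OF bounded_linear_snd]
      bounded_linear_fst bounded_linear_snd)

lemma bounded_linear_cut4: "bounded_linear cut4"
  unfolding cut4_def case_prod_beta
  by (intro bounded_linear_Pair bounded_linear_compose[OF C.bounded_linear]
      bounded_linear_compose[OF bounded_linear_fst] bounded_linear_compose[OF bounded_linear_snd]
      bounded_linear_fst bounded_linear_snd)

text \<open>The cross terms cancel because \<open>Jop\<close> is the adjoint of \<open>Iop\<close>.\<close>

lemma K_accretive: "0 \<le> K x \<bullet> x"
proof -
  obtain \<alpha> \<beta> \<gamma> \<delta> where x: "x = (\<alpha>, \<beta>, \<gamma>, \<delta>)" by (cases x) auto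
  have sq: "\<beta> \<bullet> \<beta> - cut l \<beta> \<bullet> \<beta> \<ge> 0" for \<beta> :: l2
  proof -
    have "(\<beta> - cut l \<beta>) \<bullet> (\<beta> - cut l \<beta>) = \<beta> \<bullet> \<beta> - cut l \<beta> \<bullet> \<beta>"
      by (simp add: inner_diff_left inner_diff_right cut_inner_cut inner_commute[of \<beta> "cut l \<beta>"])
    then show ?thesis by (metis inner_ge_zero)
  qed
  have "Iop l (Iop l \<alpha>) \<bullet> \<beta> = Jop l (Jop l \<beta>) \<bullet> \<alpha>" "Iop l \<gamma> \<bullet> \<delta> = Jop l \<delta> \<bullet> \<gamma>"
    unfolding Iop_adjoint by (rule inner_commute)+
  then have "K x \<bullet> x = (b1 / a1) * (\<alpha> \<bullet> \<alpha>) + (\<beta> \<bullet> \<beta> - cut l \<beta> \<bullet> \<beta>)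
      + ((b2 / a2) * (\<gamma> \<bullet> \<gamma>) + (\<delta> \<bullet> \<delta> - cut l \<delta> \<bullet> \<delta>))"
    by (simp add: x K_def inner_add_left inner_diff_left)
  then show ?thesis using sq[of \<beta>] sq[of \<delta>] pos by simp
qed

text \<open>Under \<open>cut l\<close> the terms \<open>\<beta> - cut l \<beta>\<close> and
  \<open>\<delta> - cut l \<delta>\<close> disappear, and injectivity of the integral operators
  makes all components vanish on (0,l). Off the interval the damping terms force
  \<open>\<alpha>\<close> and \<open>\<gamma>\<close> to vanish, and the identity parts do so for
  \<open>\<beta>\<close> and \<open>\<delta>\<close>.\<close>

lemma K_injective:
  assumes "K x = 0" shows "x = 0"
proof -
  obtain \<alpha> \<beta> \<gamma> \<delta> where x: "x = (\<alpha>, \<beta>, \<gamma>, \<delta>)" by (cases x) auto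
  have 1: "(1 / sqrt a1) *\<^sub>R Jop l (Jop l \<beta>) + (b1 / a1) *\<^sub>R \<alpha> = 0"
    and 2: "\<beta> - cut l \<beta> - (1 / sqrt a1) *\<^sub>R Iop l (Iop l \<alpha>) = 0"
    and 3: "(1 / sqrt a2) *\<^sub>R Jop l \<delta> + (b2 / a2) *\<^sub>R \<gamma> = 0"
    and 4: "\<delta> - cut l \<delta> - (1 / sqrt a2) *\<^sub>R Iop l \<gamma> = 0"
    using assms by (simp_all add: x K_def zero_prod_def)
  have "Iop l (Iop l \<alpha>) = 0"
    using arg_cong[OF 2, of "cut l"] pos by (simp add: C.diff C.scaleR C.zero)
  then have "Iop l \<alpha> = 0" using Iop_eq_0[OF pos(1), of "Iop l \<alpha>"] by simp
  then have \<alpha>: "cut l \<alpha> = 0" by (rule Iop_eq_0[OF pos(1)])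
  have "Jop l (Jop l \<beta>) = 0"
    using arg_cong[OF 1, of "cut l"] pos \<alpha> by (simp add: C.add C.scaleR C.zero)
  then have "Jop l \<beta> = 0" using Jop_eq_0[OF pos(1), of "Jop l \<beta>"] by simp
  then have "cut l \<beta> = 0" by (rule Jop_eq_0[OF pos(1)])
  then have "\<alpha> = 0" "\<beta> = 0" using 1 2 \<open>Jop l (Jop l \<beta>) = 0\<close> \<open>Iop l (Iop l \<alpha>) = 0\<close> pos by simp_all
  have "Iop l \<gamma> = 0"
    using arg_cong[OF 4, of "cut l"] pos by (simp add: C.diff C.scaleR C.zero)
  then have \<gamma>: "cut l \<gamma> = 0" by (rule Iop_eq_0[OF pos(1)])
  have "Jop l \<delta> = 0"
    using arg_cong[OF 3, of "cut l"] pos \<gamma> by (simp add: C.add C.scaleR C.zero)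
  then have "cut l \<delta> = 0" by (rule Jop_eq_0[OF pos(1)])
  then have "\<gamma> = 0" "\<delta> = 0" using 3 4 \<open>Jop l \<delta> = 0\<close> \<open>Iop l \<gamma> = 0\<close> pos by simp_all
  with \<open>\<alpha> = 0\<close> \<open>\<beta> = 0\<close> show ?thesis by (simp add: x zero_prod_def)
qed

lemma evolution: "evolution K P"
  by (rule evolution.intro[OF bounded_linear_K bounded_linear_P K_accretive K_injective])

text \<open>Together with \<open>cut4_P\<close>: a solution in the large Hilbert space projects to
  one carried by (0,l), which comes from states.\<close>

lemma cut4_K: "cut4 (K x) = K (cut4 x)"
  by (cases x) (simp add: cut4_def K_def C.add C.diff C.scaleR)

lemma cut4_P: "cut4 (P x) = P (cut4 x)"
  by (cases x) (simp add: cut4_def P_def C.add C.zero C.scaleR)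

lemma y_minus_l_L2: "(\<lambda>y. y - l) \<in> L2 l"
  by (rule continuous_on_imp_L2) (intro continuous_intros)

lemma cut4_E: "cut4 (E p q) = E p q"
  by (simp add: cut4_def E_def C.scaleR C.zero y_minus_l_L2 L2_const)

subsection \<open>The state space\<close>

text \<open>Membership in \<open>H_space\<close> with the second derivative of \<open>f\<close> and
  the first derivative of \<open>h\<close> as explicit data. Freed from \<open>wd\<close>, it passes
  to sums and multiples, and so does \<open>emb\<close>.\<close>

definition H_rep :: "state \<Rightarrow> (real \<Rightarrow> real) \<Rightarrow> (real \<Rightarrow> real) \<Rightarrow> bool" where
  "H_rep = (\<lambda>(f, g, h, z) \<phi> \<psi>. g \<in> L2 l \<and> z \<in> L2 l \<and> f 0 = 0 \<and> h 0 = 0 \<and> prim l h \<psi> \<and>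
     (\<exists>f'. prim l f f' \<and> prim l f' \<phi> \<and> f' 0 = 0))"

lemma H_rep_imp:
  assumes "H_rep (f, g, h, z) \<phi> \<psi>"
  shows "(f, g, h, z) \<in> H_space l"
    and "emb (f, g, h, z) = (sqrt a1 *\<^sub>R l2_of l \<phi>, l2_of l g, sqrt a2 *\<^sub>R l2_of l \<psi>, l2_of l z)"
proof -
  obtain f' where f: "prim l f f'" "prim l f' \<phi>" "f' 0 = 0"
    and X: "g \<in> L2 l" "z \<in> L2 l" "f 0 = 0" "h 0 = 0" "prim l h \<psi>"
    using assms by (auto simp: H_rep_def)
  note wd = prim_wd_wd[OF pos(1) f(1,2)]
  show "(f, g, h, z) \<in> H_space l"
    unfolding H_space_def
    using X prim_Sobolev_2[OF pos(1) f(1,2)] prim_Sobolev_1[OF pos(1) X(5)] prim_AC[OF f(1)] prim_AC[OF X(5)]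
      wd(3) wd(4)[of 0] f(3) pos(1) by simp
  show "emb (f, g, h, z) = (sqrt a1 *\<^sub>R l2_of l \<phi>, l2_of l g, sqrt a2 *\<^sub>R l2_of l \<psi>, l2_of l z)"
    using ae_eq_l2_of[OF prim_L2[OF f(2)] wd(2)] ae_eq_l2_of[OF prim_L2[OF X(5)] prim_wd(1)[OF pos(1) X(5)]]
    by (simp add: emb_def)
qed

lemma H_space_rep:
  assumes "(f, g, h, z) \<in> H_space l"
  shows "H_rep (f, g, h, z) (wd l (wd l f)) (wd l h)"
proof -
  have X: "f \<in> Sobolev l 2" "g \<in> L2 l" "h \<in> Sobolev l 1" "z \<in> L2 l" "f \<in> AC l" "wd l f \<in> AC l"
    "h \<in> AC l" "f 0 = 0" "wd l f 0 = 0" "h 0 = 0"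
    using assms unfolding H_space_def by blast+
  show ?thesis
    unfolding H_rep_def prod.case using Sobolev_2_prim[OF pos(1) X(1,5,6)] Sobolev_1_prim[OF pos(1) X(3,7)] X by blast
qed

lemma H_rep_add:
  assumes "H_rep X \<phi> \<psi>" "H_rep X' \<phi>' \<psi>'"
  shows "H_rep (X + X') (\<lambda>y. \<phi> y + \<phi>' y) (\<lambda>y. \<psi> y + \<psi>' y)"
proof -
  obtain f g h z f' g' h' z' where X: "X = (f, g, h, z)" "X' = (f', g', h', z')"
    by (cases X, cases X') auto
  from assms show ?thesis
    unfolding X H_rep_def by (auto simp: plus_fun_def L2_add intro: prim_add intro!: exI)
qed

lemma H_rep_scale:
  assumes "H_rep X \<phi> \<psi>"
  shows "H_rep (c *\<^sub>R X) (\<lambda>y. c * \<phi> y) (\<lambda>y. c * \<psi> y)"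
proof -
  obtain f g h z where X: "X = (f, g, h, z)" by (cases X) auto
  from assms show ?thesis
    unfolding X H_rep_def by (auto simp: scaleR_fun_def L2_scale intro: prim_scale intro!: exI)
qed

lemma emb_add:
  assumes "X \<in> H_space l" "X' \<in> H_space l"
  shows "X + X' \<in> H_space l" "emb (X + X') = emb X + emb X'"
proof -
  obtain f g h z f' g' h' z' where X: "X = (f, g, h, z)" "X' = (f', g', h', z')"
    by (cases X, cases X') auto
  note R = H_space_rep[OF assms(1)[unfolded X]] H_space_rep[OF assms(2)[unfolded X]]
  note R' = H_rep_imp[OF H_rep_add[OF R, unfolded add_Pair]]
  show "X + X' \<in> H_space l" using R'(1) by (simp add: X)
  have L: "g \<in> L2 l" "g' \<in> L2 l" "z \<in> L2 l" "z' \<in> L2 l" "wd l (wd l f) \<in> L2 l" "wd l (wd l f') \<in> L2 l"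
    "wd l h \<in> L2 l" "wd l h' \<in> L2 l"
    using R by (auto simp: H_rep_def intro: prim_L2)
  show "emb (X + X') = emb X + emb X'"
    unfolding X add_Pair R'(2) using L by (simp add: emb_def plus_fun_def l2_of_add scaleR_add_right)
qed

lemma emb_scale:
  assumes "X \<in> H_space l"
  shows "c *\<^sub>R X \<in> H_space l" "emb (c *\<^sub>R X) = c *\<^sub>R emb X"
proof -
  obtain f g h z where X: "X = (f, g, h, z)" by (cases X) auto
  note R = H_space_rep[OF assms(1)[unfolded X]]
  note R' = H_rep_imp[OF H_rep_scale[OF R, of c, unfolded scaleR_Pair]]
  show "c *\<^sub>R X \<in> H_space l" using R'(1) by (simp add: X)
  have L: "g \<in> L2 l" "z \<in> L2 l" "wd l (wd l f) \<in> L2 l" "wd l h \<in> L2 l"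
    using R by (auto simp: H_rep_def intro: prim_L2)
  show "emb (c *\<^sub>R X) = c *\<^sub>R emb X"
    unfolding X scaleR_Pair R'(2) using L by (simp add: emb_def scaleR_fun_def l2_of_scale)
qed

lemma H_norm_emb:
  assumes "X \<in> H_space l" shows "H_norm l a1 a2 X = norm (emb X)"
proof -
  obtain f g h z where X: "X = (f, g, h, z)" by (cases X) auto
  have L: "g \<in> L2 l" "z \<in> L2 l" "wd l (wd l f) \<in> L2 l" "wd l h \<in> L2 l"
    using H_space_rep[OF assms(1)[unfolded X]] by (auto simp: H_rep_def intro: prim_L2)
  note i = L2_mult_integrable[OF L(1,1)] L2_mult_integrable[OF L(2,2)]
    L2_mult_integrable[OF L(3,3)] L2_mult_integrable[OF L(4,4)]
  have "H_inner l a1 a2 X X = emb X \<bullet> emb X"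
    unfolding X H_inner_def emb_def using L i pos
    by (simp add: l2_of_inner mult.assoc del: integral_mult_right)
       (simp add: mult.assoc[symmetric])
  then show ?thesis by (simp add: H_norm_def norm_eq_sqrt_inner)
qed

text \<open>The conditions \<open>f = f\<^sub>y = 0\<close> and \<open>h = 0\<close> at 0 let
  \<open>f\<close> and \<open>h\<close> be recovered from the derivatives that \<open>emb\<close>
  keeps.\<close>

lemma emb_eq_iff:
  assumes "X \<in> H_space l" "X' \<in> H_space l"
  shows "emb X = emb X' \<longleftrightarrow> H_eq l X X'"
proof -
  obtain f g h z f' g' h' z' where X: "X = (f, g, h, z)" "X' = (f', g', h', z')"
    by (cases X, cases X') auto
  obtain F where F: "prim l f F" "prim l F (wd l (wd l f))" "F 0 = 0" "f 0 = 0" "h 0 = 0" "prim l h (wd l h)"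
    "g \<in> L2 l" "z \<in> L2 l"
    using H_space_rep[OF assms(1)[unfolded X]] by (auto simp: H_rep_def)
  obtain F' where F': "prim l f' F'" "prim l F' (wd l (wd l f'))" "F' 0 = 0" "f' 0 = 0" "h' 0 = 0" "prim l h' (wd l h')"
    "g' \<in> L2 l" "z' \<in> L2 l"
    using H_space_rep[OF assms(2)[unfolded X]] by (auto simp: H_rep_def)
  have prim_iff: "ae_eq l u u' \<longleftrightarrow> ae_eq l v v'"
    if u: "prim l u v" "u 0 = 0" and u': "prim l u' v'" "u' 0 = 0" for u u' v v'
  proof
    assume "ae_eq l u u'"
    then have "u y = u' y" if "y \<in> {0..l}" for y
      by (intro continuous_ae_eq_imp_eq[OF AC_continuous_on[OF prim_AC[OF u(1)]] AC_continuous_on[OF prim_AC[OF u'(1)]] pos(1) _ that])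
    then have "prim l u' v" by (rule prim_cong[OF u(1)])
    then show "ae_eq l v v'"
      by (intro weak_deriv_unique[OF prim_weak_deriv[OF pos(1)] prim_weak_deriv[OF pos(1) u'(1)]])
  next
    assume ae: "ae_eq l v v'"
    show "ae_eq l u u'"
    proof (rule ae_eqI)
      fix x assume "0 < x" "x < l"
      then have "u x = ip l v x" "u' x = ip l v' x" using prim_from_0 u u' by auto
      then show "u x = u' x" using ip_cong_ae[OF prim_L2[OF u(1)] ae] by simp
    qed
  qed
  have "ae_eq l f f' \<longleftrightarrow> ae_eq l F F'" "ae_eq l F F' \<longleftrightarrow> ae_eq l (wd l (wd l f)) (wd l (wd l f'))"
    "ae_eq l h h' \<longleftrightarrow> ae_eq l (wd l h) (wd l h')"
    using prim_iff F F' by blast+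
  moreover have "emb X = emb X' \<longleftrightarrow> ae_eq l (wd l (wd l f)) (wd l (wd l f')) \<and> ae_eq l g g' \<and>
      ae_eq l (wd l h) (wd l h') \<and> ae_eq l z z'"
    unfolding X emb_def using pos F(7,8) F'(7,8)
    by (simp add: l2_of_eq_iff prim_L2[OF F(2)] prim_L2[OF F'(2)] prim_L2[OF F(6)] prim_L2[OF F'(6)])
  ultimately show ?thesis by (auto simp: X H_eq_def)
qed

end

section \<open>Time derivatives through an isometric encoding\<close>

text \<open>The time regularity notions use a seminorm on representatives. An additive, homogeneous
  and norm-preserving map on \<open>S\<close> turns them into ordinary continuity and
  differentiability in a normed space; this is needed for the states and for the forcing in
  \<open>L2 l\<close>.\<close>

locale seminorm_encoding =
  fixes S :: "'a::real_vector set" and N :: "'a \<Rightarrow> real" and e :: "'a \<Rightarrow> 'b::real_normed_vector"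
  assumes add: "x \<in> S \<Longrightarrow> y \<in> S \<Longrightarrow> x + y \<in> S" and scale: "x \<in> S \<Longrightarrow> c *\<^sub>R x \<in> S"
    and e_add: "x \<in> S \<Longrightarrow> y \<in> S \<Longrightarrow> e (x + y) = e x + e y"
    and e_scale: "x \<in> S \<Longrightarrow> e (c *\<^sub>R x) = c *\<^sub>R e x"
    and N_e: "x \<in> S \<Longrightarrow> N x = norm (e x)"
begin

lemma diff: "x \<in> S \<Longrightarrow> y \<in> S \<Longrightarrow> x - y \<in> S \<and> e (x - y) = e x - e y"
  using add[of x "- 1 *\<^sub>R y"] e_add[of x "- 1 *\<^sub>R y"] scale[of y "- 1"] e_scale[of y "- 1"] by simp

lemma C0_time_iff:
  assumes "\<And>t. t \<ge> 0 \<Longrightarrow> X t \<in> S"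
  shows "X \<in> C0_time S N \<longleftrightarrow> continuous_on {0..} (\<lambda>t. e (X t))"
proof -
  have "((\<lambda>s. N (X s - X t)) \<longlongrightarrow> 0) (at t within {0..}) \<longleftrightarrow> continuous (at t within {0..}) (\<lambda>t. e (X t))"
    if t: "t \<ge> 0" for t
  proof -
    have "((\<lambda>s. N (X s - X t)) \<longlongrightarrow> 0) (at t within {0..}) \<longleftrightarrow>
        ((\<lambda>s. norm (e (X s) - e (X t))) \<longlongrightarrow> 0) (at t within {0..})"
      by (rule tendsto_cong) (use assms t in \<open>auto simp: eventually_at_filter diff N_e intro!: always_eventually\<close>)
    also have "\<dots> \<longleftrightarrow> ((\<lambda>s. e (X s)) \<longlongrightarrow> e (X t)) (at t within {0..})"
      unfolding tendsto_norm_zero_iff by (rule LIM_zero_iff)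
    finally show ?thesis by (simp add: continuous_within)
  qed
  then show ?thesis using assms by (auto simp: C0_time_def continuous_on_eq_continuous_within)
qed

lemma has_time_deriv_iff:
  assumes X: "\<And>t. t \<ge> 0 \<Longrightarrow> X t \<in> S" and D: "D \<in> S" and t: "t \<ge> 0"
  shows "has_time_deriv N X D t \<longleftrightarrow> ((\<lambda>t. e (X t)) has_vector_derivative e D) (at t within {0..})"
proof -
  have "has_time_deriv N X D t \<longleftrightarrow>
     ((\<lambda>s. norm (e (X s) - e (X t) - (s - t) *\<^sub>R e D) / norm (s - t)) \<longlongrightarrow> 0) (at t within {0..})"
    unfolding has_time_deriv_def
  proof (rule tendsto_cong, unfold eventually_at_filter, intro always_eventually allI impI)
    fix s assume s: "s \<noteq> t" "s \<in> {0..}"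
    have d: "X s - X t \<in> S" "e (X s - X t) = e (X s) - e (X t)" using diff[of "X s" "X t"] X s t by auto
    have q: "(1 / (s - t)) *\<^sub>R (X s - X t) \<in> S" "e ((1 / (s - t)) *\<^sub>R (X s - X t)) = (1 / (s - t)) *\<^sub>R (e (X s) - e (X t))"
      using d scale e_scale by auto
    have "N ((1 / (s - t)) *\<^sub>R (X s - X t) - D) = norm ((1 / (s - t)) *\<^sub>R (e (X s) - e (X t)) - e D)"
      using diff[OF q(1) D] by (simp add: N_e q(2))
    also have "(1 / (s - t)) *\<^sub>R (e (X s) - e (X t)) - e D = (1 / (s - t)) *\<^sub>R (e (X s) - e (X t) - (s - t) *\<^sub>R e D)"
      using s by (simp add: scaleR_diff_right)
    finally show "N ((1 / (s - t)) *\<^sub>R (X s - X t) - D) = norm (e (X s) - e (X t) - (s - t) *\<^sub>R e D) / norm (s - t)"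
      by (simp add: divide_inverse mult.commute)
  qed
  also have "\<dots> \<longleftrightarrow> ((\<lambda>t. e (X t)) has_vector_derivative e D) (at t within {0..})"
    unfolding has_vector_derivative_def has_derivative_iff_norm by (simp add: bounded_linear_scaleR_left)
  finally show ?thesis .
qed

lemma C1_timeE:
  assumes "X \<in> C1_time S N"
  obtains D where "continuous_on {0..} D" "\<And>t. t \<ge> 0 \<Longrightarrow> X t \<in> S"
    "\<And>t. t \<ge> 0 \<Longrightarrow> ((\<lambda>t. e (X t)) has_vector_derivative D t) (at t within {0..})"
proof -
  obtain X' where X': "X' \<in> C0_time S N" "\<And>t. t \<ge> 0 \<Longrightarrow> has_time_deriv N X (X' t) t" and "X \<in> C0_time S N"
    using assms by (auto simp: C1_time_def)
  then have S: "X t \<in> S" "X' t \<in> S" if "t \<ge> 0" for t using that by (auto simp: C0_time_def)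
  show ?thesis
    using that[of "\<lambda>t. e (X' t)"] C0_time_iff[of X'] has_time_deriv_iff[of X] X' S by blast
qed

end

lemma L2_encoding: "seminorm_encoding (L2 l) (L2_norm l) (l2_of l)"
proof
  fix u v :: "real \<Rightarrow> real" and c :: real assume u: "u \<in> L2 l"
  show "c *\<^sub>R u \<in> L2 l" "l2_of l (c *\<^sub>R u) = c *\<^sub>R l2_of l u"
    using L2_scale[OF u, of c] l2_of_scale[OF u, of c] by (simp_all add: scaleR_fun_def)
  show "L2_norm l u = norm (l2_of l u)" by (simp add: l2_of_norm u)
  assume v: "v \<in> L2 l"
  show "u + v \<in> L2 l" "l2_of l (u + v) = l2_of l u + l2_of l v"
    using L2_add[OF u v] l2_of_add[OF u v] by (simp_all add: plus_fun_def)
qed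

context beam_string
begin

lemma H_encoding: "seminorm_encoding (H_space l) (H_norm l a1 a2) emb"
  by (rule seminorm_encoding.intro) (simp_all add: emb_add emb_scale H_norm_emb)

subsection \<open>The domain of the generator\<close>

text \<open>\<open>dom_rep X w p q\<close> says that \<open>X\<close> lies in the domain, \<open>A1 X = - (\<integral>\<integral>\<alpha>, \<beta>, \<integral>\<gamma>, \<delta>)\<close> for \<open>w = (\<alpha>, \<beta>, \<gamma>, \<delta>)\<close>, and
  \<open>B X = (p, q)\<close>; the witnesses \<open>m\<close> and \<open>s\<close> are moment and stress. Unlike membership in the domain
  it is visibly linear.\<close>

definition dom_rep :: "state \<Rightarrow> state \<Rightarrow> real \<Rightarrow> real \<Rightarrow> bool" where
  "dom_rep X = (\<lambda>(\<alpha>, \<beta>, \<gamma>, \<delta>) p q. \<exists>f f' \<phi> g g' h \<psi> z m m' s. X = (f, g, h, z) \<and>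
     prim l f f' \<and> prim l f' \<phi> \<and> prim l g g' \<and> prim l g' (\<lambda>y. - \<alpha> y) \<and> prim l h \<psi> \<and> prim l z (\<lambda>y. - \<gamma> y) \<and>
     prim l m m' \<and> prim l m' \<beta> \<and> prim l s (\<lambda>y. - \<delta> y) \<and>
     f 0 = 0 \<and> f' 0 = 0 \<and> g 0 = 0 \<and> g' 0 = 0 \<and> h 0 = 0 \<and> z 0 = 0 \<and> m l = 0 \<and> m' l = p \<and> s l = q \<and>
     ae_eq l m (\<lambda>y. a1 * \<phi> y - b1 * \<alpha> y) \<and> ae_eq l s (\<lambda>y. a2 * \<psi> y - b2 * \<gamma> y))"

lemma dom_rep_L2:
  assumes "dom_rep X w p q" shows "w \<in> L4"
proof -
  obtain \<alpha> \<beta> \<gamma> \<delta> where w: "w = (\<alpha>, \<beta>, \<gamma>, \<delta>)" by (cases w) auto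
  have "(\<lambda>y. - \<alpha> y) \<in> L2 l" "\<beta> \<in> L2 l" "(\<lambda>y. - \<gamma> y) \<in> L2 l" "(\<lambda>y. - \<delta> y) \<in> L2 l"
    using assms prim_L2 unfolding dom_rep_def w prod.case by blast+
  then show ?thesis
    using L2_minus[of "\<lambda>y. - \<alpha> y" l] L2_minus[of "\<lambda>y. - \<gamma> y" l] L2_minus[of "\<lambda>y. - \<delta> y" l] by (simp add: w)
qed

text \<open>The damping terms of \<open>K\<close>: with \<open>\<alpha>\<close> equal to minus the
  spatial derivative of the velocity, the law \<open>m = a \<phi> - b \<alpha>\<close> is solved for
  the weighted strain. It provides the first and third rows.\<close>

lemma scaled_constitutive_law:
  assumes "a > 0" "\<phi> \<in> L2 l" "\<alpha> \<in> L2 l" "ae_eq l m (\<lambda>y. a * \<phi> y - b * \<alpha> y)"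
  shows "sqrt a *\<^sub>R l2_of l \<phi> = (1 / sqrt a) *\<^sub>R l2_of l m + (b / a) *\<^sub>R (sqrt a *\<^sub>R l2_of l \<alpha>)"
proof -
  have "l2_of l m = a *\<^sub>R l2_of l \<phi> - b *\<^sub>R l2_of l \<alpha>"
    using ae_eq_l2_of[OF _ assms(4)] assms by (simp add: L2_diff L2_scale l2_of_diff l2_of_scale)
  then have "(1 / sqrt a) *\<^sub>R l2_of l m + (b / a) *\<^sub>R (sqrt a *\<^sub>R l2_of l \<alpha>)
      = (a / sqrt a) *\<^sub>R l2_of l \<phi> + ((b / a) * sqrt a - b / sqrt a) *\<^sub>R l2_of l \<alpha>"
    by (simp add: scaleR_diff_right scaleR_diff_left)
  also have "(b / a) * sqrt a - b / sqrt a = 0"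
    using assms(1) by (simp add: real_div_sqrt field_simps)
  also have "a / sqrt a = sqrt a" using assms(1) by (simp add: real_div_sqrt)
  finally show ?thesis by simp
qed

text \<open>The rows of \<open>K\<close> are integrations under the boundary conditions:
  \<open>g\<close> and \<open>z\<close> from the left, \<open>m\<close> and \<open>s\<close> from
  the right, while the strains follow from the constitutive law. On the closed interval the chosen
  representatives in \<open>moment\<close> and \<open>stress\<close> coincide with \<open>m\<close>
  and \<open>s\<close>, so the boundary values agree.\<close>

lemma dom_rep_imp:
  assumes "dom_rep X w p q"
  shows "X \<in> DA" "X \<in> H_space l" "B X = (p, q)" "emb X = K (V w) + E p q"
    and "A1 X \<in> H_space l" "emb (A1 X) = - V w"
proof -
  obtain \<alpha> \<beta> \<gamma> \<delta> where w: "w = (\<alpha>, \<beta>, \<gamma>, \<delta>)" by (cases w) auto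
  obtain f f' \<phi> g g' h \<psi> z m m' s where X: "X = (f, g, h, z)"
    and f: "prim l f f'" "prim l f' \<phi>" and g: "prim l g g'" "prim l g' (\<lambda>y. - \<alpha> y)"
    and h: "prim l h \<psi>" and z: "prim l z (\<lambda>y. - \<gamma> y)"
    and m: "prim l m m'" "prim l m' \<beta>" and s: "prim l s (\<lambda>y. - \<delta> y)"
    and bc: "f 0 = 0" "f' 0 = 0" "g 0 = 0" "g' 0 = 0" "h 0 = 0" "z 0 = 0" "m l = 0" "m' l = p" "s l = q"
    and ae: "ae_eq l m (\<lambda>y. a1 * \<phi> y - b1 * \<alpha> y)" "ae_eq l s (\<lambda>y. a2 * \<psi> y - b2 * \<gamma> y)"
    using assms unfolding dom_rep_def w prod.case by blast
  have L: "\<alpha> \<in> L2 l" "\<beta> \<in> L2 l" "\<gamma> \<in> L2 l" "\<delta> \<in> L2 l" using dom_rep_L2[OF assms] by (simp_all add: w)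
  have l0: "0 \<in> {0..l}" "l \<in> {0..l}" using pos(1) by auto
  note wf = prim_wd_wd[OF pos(1) f] and wg = prim_wd_wd[OF pos(1) g]
  note wh = prim_wd[OF pos(1) h] and wz = prim_wd[OF pos(1) z]
  have ae_m: "ae_eq l m (\<lambda>y. a1 * wd l (wd l f) y + b1 * wd l (wd l g) y)"
    using ae_eq_trans[OF ae(1)] ae_eq_sym[OF ae_eq_lincomb[OF wf(2) wg(2), of a1 b1]] by simp
  have ae_s: "ae_eq l s (\<lambda>y. a2 * wd l h y + b2 * wd l z y)"
    using ae_eq_trans[OF ae(2)] ae_eq_sym[OF ae_eq_lincomb[OF wh(1) wz(1), of a2 b2]] by simp
  define M where "M = moment l a1 b1 f g"
  define T where "T = stress l a2 b2 h z"
  have M_eq: "M y = m y" if "y \<in> {0..l}" for y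
    unfolding M_def moment_def by (rule ac_rep_eq[OF pos(1) prim_AC[OF m(1)] ae_m that])
  have T_eq: "T y = s y" if "y \<in> {0..l}" for y
    unfolding T_def stress_def by (rule ac_rep_eq[OF pos(1) prim_AC[OF s] ae_s that])
  have M: "prim l M m'" by (rule prim_cong[OF m(1)]) (simp add: M_eq)
  have T: "prim l T (\<lambda>y. - \<delta> y)" by (rule prim_cong[OF s]) (simp add: T_eq)
  note wM = prim_wd_wd[OF pos(1) M m(2)] and wT = prim_wd[OF pos(1) T]
  have HX: "H_rep (f, g, h, z) \<phi> \<psi>"
    unfolding H_rep_def prod.case using f h bc prim_L2'[OF g(1)] prim_L2'[OF z] by blast
  show H: "X \<in> H_space l" using H_rep_imp(1)[OF HX] by (simp add: X)
  show "X \<in> DA"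
    unfolding dom_A1_def X mem_Collect_eq prod.case M_def[symmetric] T_def[symmetric]
    using H[unfolded X] prim_Sobolev_2[OF pos(1) g] prim_Sobolev_1[OF pos(1) z] prim_Sobolev_2[OF pos(1) M m(2)]
      prim_Sobolev_1[OF pos(1) T] prim_AC[OF f(1)] wf(3) prim_AC[OF g(1)] wg(3) prim_AC[OF h] prim_AC[OF z]
      prim_AC[OF M] wM(3) prim_AC[OF T] bc wf(4)[OF l0(1)] wg(4)[OF l0(1)] M_eq[OF l0(2)]
    by simp
  show "B X = (p, q)"
    unfolding op_B_def X prod.case M_def[symmetric] T_def[symmetric]
    using wM(4)[OF l0(2)] T_eq[OF l0(2)] bc by simp
  have HA: "H_rep (A1 X) (\<lambda>y. - \<alpha> y) (\<lambda>y. - \<gamma> y)"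
    unfolding op_A1_def X H_rep_def prod.case M_def[symmetric] T_def[symmetric] fun_Compl_def
    using g z bc wT(2) L2_minus[OF L2_ae_eq[OF L(2) ae_eq_sym[OF wM(2)]]] by blast
  have A: "A1 X = (g, - wd l (wd l M), z, wd l T)" by (simp add: op_A1_def X M_def T_def)
  show "A1 X \<in> H_space l" using H_rep_imp(1) HA unfolding A by blast
  have "l2_of l (- wd l (wd l M)) = - l2_of l \<beta>"
    unfolding fun_Compl_def using ae_eq_l2_of[OF L(2) wM(2)] L2_ae_eq[OF L(2) ae_eq_sym[OF wM(2)]]
    by (simp add: l2_of_minus)
  moreover have "l2_of l (wd l T) = - l2_of l \<delta>"
    using ae_eq_l2_of[OF prim_L2[OF T] wT(1)] by (simp add: l2_of_minus L)
  ultimately show "emb (A1 X) = - V w"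
    using H_rep_imp(2)[OF HA[unfolded A]] by (simp add: A V_def w l2_of_minus L)
  have lm: "l2_of l m = Jop l (Jop l (l2_of l \<beta>)) + p *\<^sub>R l2_of l (\<lambda>y. y - l)"
  proof -
    \<comment> \<open>Integrating 1 from the right gives \<open>l - y\<close>; the boundary value
      \<open>p\<close> of \<open>m'\<close> thus contributes the moment \<open>p * (y - l)\<close>
      of \<open>E\<close>.\<close>
    have one: "Jop l (l2_of l (\<lambda>y. 1)) = - l2_of l (\<lambda>y. y - l)"
    proof -
      have "prim l (\<lambda>y. y - l) (\<lambda>y. 1 - 0)" by (rule prim_diff[OF prim_id prim_const])
      from l2_of_prim_l[OF this] show ?thesis by simp
    qed
    have "l2_of l m = - Jop l (l2_of l m')" using l2_of_prim_l[OF m(1)] bc by simp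
    also have "l2_of l m' = p *\<^sub>R l2_of l (\<lambda>y. 1) - Jop l (l2_of l \<beta>)" using l2_of_prim_l[OF m(2)] bc by simp
    finally show ?thesis
      using bounded_linear_Jop[OF pos(1)] one
      by (simp add: linear_diff linear_scale bounded_linear.linear)
  qed
  have ls: "l2_of l s = Jop l (l2_of l \<delta>) + q *\<^sub>R l2_of l (\<lambda>y. 1)"
    using l2_of_prim_l[OF s] bc bounded_linear_Jop[OF pos(1)]
    by (simp add: l2_of_minus L linear_neg bounded_linear.linear)
  note \<phi> = scaled_constitutive_law[OF pos(2) prim_L2[OF f(2)] L(1) ae(1)]
    and \<psi> = scaled_constitutive_law[OF pos(3) prim_L2[OF h] L(3) ae(2)]
  have lg: "l2_of l g = - Iop l (Iop l (l2_of l \<alpha>))"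
    using l2_of_prim_0[OF g(1) bc(3)] l2_of_prim_0[OF g(2) bc(4)] bounded_linear_Iop[OF pos(1)]
    by (simp add: l2_of_minus L linear_neg bounded_linear.linear)
  have lz: "l2_of l z = - Iop l (l2_of l \<gamma>)"
    using l2_of_prim_0[OF z bc(6)] bounded_linear_Iop[OF pos(1)]
    by (simp add: l2_of_minus L linear_neg bounded_linear.linear)
  show "emb X = K (V w) + E p q"
    unfolding X H_rep_imp(2)[OF HX] \<phi> \<psi> lm ls lg lz
    using pos L bounded_linear_Iop[OF pos(1)]
    by (simp add: K_def V_def w E_def linear_scale bounded_linear.linear scaleR_add_right)
qed

text \<open>The signs of the witness make the encoded right-hand side equal to \<open>- V w\<close>,
  which matches \<open>K\<close> as an inverse of the negative generator.\<close>

lemma dom_imp_rep: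
  assumes X: "X \<in> DA" and B: "B X = (p, q)"
  shows "\<exists>w. dom_rep X w p q"
proof -
  obtain f g h z where X_eq: "X = (f, g, h, z)" by (cases X) auto
  define M where "M = moment l a1 b1 f g"
  define T where "T = stress l a2 b2 h z"
  have d: "(f, g, h, z) \<in> H_space l" "g \<in> Sobolev l 2" "z \<in> Sobolev l 1" "M \<in> Sobolev l 2" "T \<in> Sobolev l 1"
    "g \<in> AC l" "wd l g \<in> AC l" "z \<in> AC l" "M \<in> AC l" "wd l M \<in> AC l" "T \<in> AC l"
    "g 0 = 0" "wd l g 0 = 0" "z 0 = 0" "M l = 0"
    using X unfolding X_eq dom_A1_def mem_Collect_eq prod.case M_def[symmetric] T_def[symmetric] by blast+
  have hf: "f \<in> Sobolev l 2" "h \<in> Sobolev l 1" "f \<in> AC l" "wd l f \<in> AC l" "h \<in> AC l"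
    "f 0 = 0" "wd l f 0 = 0" "h 0 = 0"
    using d(1) unfolding H_space_def by blast+
  have BC: "wd l M l = p" "T l = q"
    using B unfolding X_eq op_B_def prod.case M_def[symmetric] T_def[symmetric] by auto
  note f = Sobolev_2_prim[OF pos(1) hf(1,3,4)] and g = Sobolev_2_prim[OF pos(1) d(2,6,7)]
  note h = Sobolev_1_prim[OF pos(1) hf(2,5)] and z = Sobolev_1_prim[OF pos(1) d(3,8)]
  note M = Sobolev_2_prim[OF pos(1) d(4,9,10)] and T = Sobolev_1_prim[OF pos(1) d(5,11)]
  have "ae_eq l M (\<lambda>y. a1 * wd l (wd l f) y - b1 * (- wd l (wd l g) y))"
    unfolding M_def moment_def using ac_rep_ae_eq by simp
  moreover have "ae_eq l T (\<lambda>y. a2 * wd l h y - b2 * (- wd l z y))"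
    unfolding T_def stress_def using ac_rep_ae_eq by simp
  moreover have "prim l (wd l g) (\<lambda>y. - (- wd l (wd l g) y))" "prim l z (\<lambda>y. - (- wd l z y))"
    "prim l T (\<lambda>y. - (- wd l T y))"
    using g z T by simp_all
  ultimately have "dom_rep X (\<lambda>y. - wd l (wd l g) y, wd l (wd l M), \<lambda>y. - wd l z y, \<lambda>y. - wd l T y) p q"
    unfolding dom_rep_def prod.case using X_eq f g(1) h M BC d(12-15) hf(6-8) by blast
  then show ?thesis by blast
qed

text \<open>Solvability of the static problem: arbitrary L^2 data and boundary values are integrated
  to a state in the domain.\<close>

lemma dom_rep_exists:
  assumes "w \<in> L4"
  shows "\<exists>X. dom_rep X w p q"
proof -
  obtain \<alpha> \<beta> \<gamma> \<delta> where w: "w = (\<alpha>, \<beta>, \<gamma>, \<delta>)" and L: "\<alpha> \<in> L2 l" "\<beta> \<in> L2 l" "\<gamma> \<in> L2 l" "\<delta> \<in> L2 l"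
    using assms by (cases w) auto
  define g' where "g' = ip l (\<lambda>y. - \<alpha> y)"
  define m' where "m' = (\<lambda>y. p - jp l \<beta> y)"
  define s where "s = (\<lambda>y. q + jp l \<delta> y)"
  have g': "prim l g' (\<lambda>y. - \<alpha> y)" unfolding g'_def by (rule prim_ip[OF L2_minus[OF L(1)]])
  have m': "prim l m' \<beta>" unfolding m'_def using prim_diff[OF prim_const prim_jp[OF L(2)], of p] by simp
  have s: "prim l s (\<lambda>y. - \<delta> y)" unfolding s_def using prim_add[OF prim_const prim_jp[OF L(4)], of q] by simp
  define m where "m = (\<lambda>y. - jp l m' y)"
  have m: "prim l m m'" unfolding m_def using prim_minus[OF prim_jp[OF prim_L2'[OF m']]] by simp
  \<comment> \<open>The constitutive law solved for the strain; \<open>\<alpha>\<close> is minus the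
    second derivative of \<open>g\<close>, hence the plus sign.\<close>
  define \<phi> where "\<phi> = (\<lambda>y. (1 / a1) * m y + (b1 / a1) * \<alpha> y)"
  define \<psi> where "\<psi> = (\<lambda>y. (1 / a2) * s y + (b2 / a2) * \<gamma> y)"
  have \<phi>: "\<phi> \<in> L2 l" unfolding \<phi>_def by (rule L2_add[OF L2_scale[OF prim_L2'[OF m]] L2_scale[OF L(1)]])
  have \<psi>: "\<psi> \<in> L2 l" unfolding \<psi>_def by (rule L2_add[OF L2_scale[OF prim_L2'[OF s]] L2_scale[OF L(3)]])
  have "(\<lambda>y. a1 * \<phi> y - b1 * \<alpha> y) = m" "(\<lambda>y. a2 * \<psi> y - b2 * \<gamma> y) = s"
    using pos by (auto simp: fun_eq_iff \<phi>_def \<psi>_def field_simps)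
  then have ae: "ae_eq l m (\<lambda>y. a1 * \<phi> y - b1 * \<alpha> y)" "ae_eq l s (\<lambda>y. a2 * \<psi> y - b2 * \<gamma> y)" by simp_all
  have bc: "m l = 0" "m' l = p" "s l = q" "g' 0 = 0" by (simp_all add: m_def m'_def s_def g'_def)
  show ?thesis
    unfolding dom_rep_def w prod.case
    using prim_ip[OF prim_L2'[OF prim_ip[OF \<phi>]]] prim_ip[OF \<phi>] prim_ip[OF prim_L2'[OF g']] g' prim_ip[OF \<psi>]
      prim_ip[OF L2_minus[OF L(3)]] m m' s ae bc ip_0 by blast
qed

text \<open>The graph norm applies \<open>A1\<close> to differences of states, and \<open>A1\<close>
  is built from chosen derivatives and representatives. Its linearity is obtained here by
  subtracting the witnesses.\<close>

lemma dom_rep_diff: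
  assumes "dom_rep X w p q" "dom_rep Y w' p' q'"
  shows "dom_rep (X - Y) (w - w') (p - p') (q - q')"
proof -
  obtain \<alpha> \<beta> \<gamma> \<delta> \<alpha>' \<beta>' \<gamma>' \<delta>' where w: "w = (\<alpha>, \<beta>, \<gamma>, \<delta>)" "w' = (\<alpha>', \<beta>', \<gamma>', \<delta>')"
    by (cases w, cases w') auto
  obtain f F \<phi> g G h \<psi> z m M s where X: "X = (f, g, h, z)"
    "prim l f F" "prim l F \<phi>" "prim l g G" "prim l G (\<lambda>y. - \<alpha> y)" "prim l h \<psi>" "prim l z (\<lambda>y. - \<gamma> y)"
    "prim l m M" "prim l M \<beta>" "prim l s (\<lambda>y. - \<delta> y)"
    and bc: "f 0 = 0" "F 0 = 0" "g 0 = 0" "G 0 = 0" "h 0 = 0" "z 0 = 0" "m l = 0" "M l = p" "s l = q"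
    and ae: "ae_eq l m (\<lambda>y. a1 * \<phi> y - b1 * \<alpha> y)" "ae_eq l s (\<lambda>y. a2 * \<psi> y - b2 * \<gamma> y)"
    using assms(1) unfolding dom_rep_def w prod.case by blast
  obtain f' F' \<phi>' g' G' h' \<psi>' z' m' M' s' where Y: "Y = (f', g', h', z')"
    "prim l f' F'" "prim l F' \<phi>'" "prim l g' G'" "prim l G' (\<lambda>y. - \<alpha>' y)" "prim l h' \<psi>'" "prim l z' (\<lambda>y. - \<gamma>' y)"
    "prim l m' M'" "prim l M' \<beta>'" "prim l s' (\<lambda>y. - \<delta>' y)"
    and bc': "f' 0 = 0" "F' 0 = 0" "g' 0 = 0" "G' 0 = 0" "h' 0 = 0" "z' 0 = 0" "m' l = 0" "M' l = p'" "s' l = q'"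
    and ae': "ae_eq l m' (\<lambda>y. a1 * \<phi>' y - b1 * \<alpha>' y)" "ae_eq l s' (\<lambda>y. a2 * \<psi>' y - b2 * \<gamma>' y)"
    using assms(2) unfolding dom_rep_def w prod.case by blast
  have minus: "(\<lambda>y. - u y - - v y) = (\<lambda>y. - (u y - v y))" for u v :: "real \<Rightarrow> real" by auto
  have lin: "(\<lambda>y. (a * u y - b * v y) - (a * u' y - b * v' y)) = (\<lambda>y. a * (u y - u' y) - b * (v y - v' y))"
    for a b :: real and u v u' v' by (auto simp: fun_eq_iff algebra_simps)
  have ae_diff: "ae_eq l (\<lambda>y. u y - v y) (\<lambda>y. u' y - v' y)" if "ae_eq l u u'" "ae_eq l v v'" for u v u' v'
    using ae_eq_lincomb[OF that, of 1 "- 1"] by simp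
  have XY: "X - Y = (\<lambda>y. f y - f' y, \<lambda>y. g y - g' y, \<lambda>y. h y - h' y, \<lambda>y. z y - z' y)"
    by (simp add: X(1) Y(1) fun_diff_def)
  have ww: "w - w' = (\<lambda>y. \<alpha> y - \<alpha>' y, \<lambda>y. \<beta> y - \<beta>' y, \<lambda>y. \<gamma> y - \<gamma>' y, \<lambda>y. \<delta> y - \<delta>' y)"
    by (simp add: w fun_diff_def)
  show ?thesis
    unfolding dom_rep_def ww prod.case
    apply (rule exI[of _ "\<lambda>y. f y - f' y"], rule exI[of _ "\<lambda>y. F y - F' y"], rule exI[of _ "\<lambda>y. \<phi> y - \<phi>' y"],
        rule exI[of _ "\<lambda>y. g y - g' y"], rule exI[of _ "\<lambda>y. G y - G' y"], rule exI[of _ "\<lambda>y. h y - h' y"],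
        rule exI[of _ "\<lambda>y. \<psi> y - \<psi>' y"], rule exI[of _ "\<lambda>y. z y - z' y"], rule exI[of _ "\<lambda>y. m y - m' y"],
        rule exI[of _ "\<lambda>y. M y - M' y"], rule exI[of _ "\<lambda>y. s y - s' y"])
    using XY prim_diff[OF X(2) Y(2)] prim_diff[OF X(3) Y(3)] prim_diff[OF X(4) Y(4)] prim_diff[OF X(5) Y(5), unfolded minus]
      prim_diff[OF X(6) Y(6)] prim_diff[OF X(7) Y(7), unfolded minus] prim_diff[OF X(8) Y(8)] prim_diff[OF X(9) Y(9)]
      prim_diff[OF X(10) Y(10), unfolded minus] ae_diff[OF ae(1) ae'(1), unfolded lin] ae_diff[OF ae(2) ae'(2), unfolded lin]
      bc bc' by (simp add: diff_minus_eq_add)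
qed

lemma V_diff: "w \<in> L4 \<Longrightarrow> w' \<in> L4 \<Longrightarrow> V (w - w') = V w - V w'"
  using l2_of_diff by (cases w, cases w') (auto simp: V_def scaleR_diff_right fun_diff_def)

text \<open>Every element carried by (0,l) comes from actual functions, so the abstract
  \<open>v\<close> can be turned into data for \<open>dom_rep_exists\<close>.\<close>

lemma V_surj: "\<exists>w\<in>L4. V w = cut4 x"
proof -
  obtain x1 x2 x3 x4 where x: "x = (x1, x2, x3, x4)" by (cases x) auto
  have "l2_of l (\<lambda>y. c * fn l x y) = c *\<^sub>R cut l x" for c x
    by (simp only: l2_of_scale[OF fn_L2] l2_of_fn)
  then have "V (\<lambda>y. (1 / sqrt a1) * fn l x1 y, fn l x2, \<lambda>y. (1 / sqrt a2) * fn l x3 y, fn l x4) = cut4 x"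
    unfolding x V_def cut4_def prod.case l2_of_fn using pos by (simp del: times_divide_eq_left)
  then show ?thesis using fn_L2 L2_scale[OF fn_L2] by blast
qed

lemma cut4_V: "w \<in> L4 \<Longrightarrow> cut4 (V w) = V w"
  by (cases w) (simp add: V_def cut4_def cut_scaleR)

text \<open>Reduces continuity in the graph norm to continuity of \<open>emb X\<close> and of
  \<open>V w\<close> in the Hilbert space.\<close>

lemma graph_norm_diff:
  assumes "dom_rep X w p q" "dom_rep Y w' p' q'"
  shows "graph_norm l a1 a2 b1 b2 (X - Y) = norm (emb X - emb Y) + norm (V w - V w')"
proof -
  note D = dom_rep_imp[OF dom_rep_diff[OF assms]]
  have "emb (X - Y) = emb X - emb Y"
    using seminorm_encoding.diff[OF H_encoding dom_rep_imp(2)[OF assms(1)] dom_rep_imp(2)[OF assms(2)]] by simp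
  then show ?thesis
    unfolding graph_norm_def H_norm_emb[OF D(2)] H_norm_emb[OF D(5)] D(6)
    by (simp add: V_diff dom_rep_L2[OF assms(1)] dom_rep_L2[OF assms(2)] norm_minus_commute)
qed

subsection \<open>Lower order terms and forcing\<close>

lemma emb_A2:
  assumes "X \<in> H_space l"
  shows "A2 X \<in> H_space l" "emb (A2 X) = P (emb X)"
proof -
  obtain f g h z where X: "X = (f, g, h, z)" by (cases X) auto
  have R: "g \<in> L2 l" "z \<in> L2 l" "h 0 = 0" "prim l h (wd l h)"
    using H_space_rep[OF assms[unfolded X]] by (auto simp: H_rep_def)
  have h: "h \<in> L2 l" by (rule prim_L2'[OF R(4)])
  have L: "(\<lambda>y. c * h y + p * z y + q * g y) \<in> L2 l" for c p q by (intro L2_add L2_scale h R)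
  have l: "l2_of l (\<lambda>y. c * h y + p * z y + q * g y) = c *\<^sub>R l2_of l h + p *\<^sub>R l2_of l z + q *\<^sub>R l2_of l g" for c p q
    by (simp add: l2_of_add L2_add L2_scale l2_of_scale h R)
  have A: "A2 X = (\<lambda>y. 0, \<lambda>y. c1 * h y + p1 * z y + q1 * g y, \<lambda>y. 0, \<lambda>y. c2 * h y + p2 * z y + q2 * g y)"
    by (simp add: op_A2_def X zero_fun_def plus_fun_def scaleR_fun_def)
  have H: "H_rep (A2 X) (\<lambda>y. 0) (\<lambda>y. 0)"
    unfolding A H_rep_def prod.case using L prim_const[of l 0] by blast
  show "A2 X \<in> H_space l" using H_rep_imp(1) H unfolding A by blast
  have "Iop l (sqrt a2 *\<^sub>R l2_of l (wd l h)) = sqrt a2 *\<^sub>R l2_of l h"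
    using l2_of_prim_0[OF R(4,3)] bounded_linear_Iop[OF pos(1)] by (simp add: linear_scale bounded_linear.linear)
  then show "emb (A2 X) = P (emb X)"
    unfolding A H_rep_imp(2)[OF H[unfolded A]] l using pos by (simp add: X emb_def P_def)
qed

lemma emb_forcing:
  assumes "u \<in> L2 l" "v \<in> L2 l"
  shows "(0, u, 0, v) \<in> H_space l" "emb (0, u, 0, v) = (0, l2_of l u, 0, l2_of l v)"
proof -
  have H: "H_rep (0, u, 0, v) (\<lambda>y. 0) (\<lambda>y. 0)"
    unfolding H_rep_def prod.case zero_fun_def using assms prim_const[of l 0] by blast
  from H_rep_imp[OF H] show "(0, u, 0, v) \<in> H_space l" "emb (0, u, 0, v) = (0, l2_of l u, 0, l2_of l v)" by simp_all
qed

text \<open>Linearity in the boundary data: time derivatives of the lifting only concern two scalar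
  coefficients of fixed vectors.\<close>

lemma E_eq: "E p q = p *\<^sub>R E 1 0 + q *\<^sub>R E 0 1"
  by (simp add: E_def)

lemma E_has_vector_derivative:
  assumes "(d3 has_real_derivative d3') (at t within S)" "(d4 has_real_derivative d4') (at t within S)"
  shows "((\<lambda>t. E (d3 t) (d4 t)) has_vector_derivative E d3' d4') (at t within S)"
  using has_vector_derivative_add[OF has_vector_derivative_scaleR[OF assms(1) has_vector_derivative_const[of "E 1 0"]]
      has_vector_derivative_scaleR[OF assms(2) has_vector_derivative_const[of "E 0 1"]]]
  by (simp only: E_eq[of "d3 _"] E_eq[of d3'] scaleR_zero_right add_0_left)

lemma E_continuous_on:
  assumes "continuous_on S d3" "continuous_on S d4"
  shows "continuous_on S (\<lambda>t. E (d3 t) (d4 t))"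
  unfolding E_eq[of "d3 _"] by (intro continuous_on_add continuous_on_scaleR continuous_on_const assms)

lemma has_time_deriv_rhs_iff:
  assumes X: "\<And>t. t \<ge> 0 \<Longrightarrow> dom_rep (X t) (w t) (d3 t) (d4 t)"
    and d: "d1 t \<in> L2 l" "d2 t \<in> L2 l" and t: "t \<ge> 0"
  shows "A1 (X t) + A2 (X t) + (0, d1 t, 0, d2 t) \<in> H_space l"
    and "emb (A1 (X t) + A2 (X t) + (0, d1 t, 0, d2 t))
      = - V (w t) + P (emb (X t)) + (0, l2_of l (d1 t), 0, l2_of l (d2 t))"
    and "has_time_deriv (H_norm l a1 a2) X (A1 (X t) + A2 (X t) + (0, d1 t, 0, d2 t)) t \<longleftrightarrow>
      ((\<lambda>t. emb (X t)) has_vector_derivative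
        - V (w t) + P (emb (X t)) + (0, l2_of l (d1 t), 0, l2_of l (d2 t))) (at t within {0..})"
proof -
  note R = dom_rep_imp[OF X[OF t]]
  note A2 = emb_A2[OF R(2)] and F = emb_forcing[OF d]
  note s = emb_add[OF R(5) A2(1)]
  show D: "A1 (X t) + A2 (X t) + (0, d1 t, 0, d2 t) \<in> H_space l" by (rule emb_add(1)[OF s(1) F(1)])
  show eD: "emb (A1 (X t) + A2 (X t) + (0, d1 t, 0, d2 t))
      = - V (w t) + P (emb (X t)) + (0, l2_of l (d1 t), 0, l2_of l (d2 t))"
    unfolding emb_add(2)[OF s(1) F(1)] s(2) A2(2) F(2) R(6) by simp
  show "has_time_deriv (H_norm l a1 a2) X (A1 (X t) + A2 (X t) + (0, d1 t, 0, d2 t)) t \<longleftrightarrow>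
      ((\<lambda>t. emb (X t)) has_vector_derivative
        - V (w t) + P (emb (X t)) + (0, l2_of l (d1 t), 0, l2_of l (d2 t))) (at t within {0..})"
    unfolding eD[symmetric]
    by (rule seminorm_encoding.has_time_deriv_iff[OF H_encoding _ D t]) (rule dom_rep_imp(2)[OF X])
qed

abbreviation "solution \<equiv> is_solution l a1 a2 b1 b2 c1 c2 p1 p2 q1 q2"

lemma solution_exists:
  assumes d: "d1 \<in> C1_time (L2 l) (L2_norm l)" "d2 \<in> C1_time (L2 l) (L2_norm l)"
    and d34: "d3 \<in> C2_real" "d4 \<in> C2_real"
    and X0: "X0 \<in> DA" "B X0 = (d3 0, d4 0)"
  shows "\<exists>X. solution d1 d2 d3 d4 X0 X"
proof -
  interpret ev: evolution K P by (rule evolution)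
  interpret P: bounded_linear P by (rule bounded_linear_P)
  interpret C4: bounded_linear cut4 by (rule bounded_linear_cut4)
  obtain D1 where D1: "continuous_on {0..} D1" "\<And>t. t \<ge> 0 \<Longrightarrow> d1 t \<in> L2 l"
    "\<And>t. t \<ge> 0 \<Longrightarrow> ((\<lambda>t. l2_of l (d1 t)) has_vector_derivative D1 t) (at t within {0..})"
    using seminorm_encoding.C1_timeE[OF L2_encoding d(1)] by blast
  obtain D2 where D2: "continuous_on {0..} D2" "\<And>t. t \<ge> 0 \<Longrightarrow> d2 t \<in> L2 l"
    "\<And>t. t \<ge> 0 \<Longrightarrow> ((\<lambda>t. l2_of l (d2 t)) has_vector_derivative D2 t) (at t within {0..})"
    using seminorm_encoding.C1_timeE[OF L2_encoding d(2)] by blast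
  obtain e3 e3' where e3: "continuous_on {0..} e3'" "\<And>t. t \<ge> 0 \<Longrightarrow> (d3 has_real_derivative e3 t) (at t within {0..})"
    "\<And>t. t \<ge> 0 \<Longrightarrow> (e3 has_real_derivative e3' t) (at t within {0..})"
    using d34(1) unfolding C2_real_def by blast
  obtain e4 e4' where e4: "continuous_on {0..} e4'" "\<And>t. t \<ge> 0 \<Longrightarrow> (d4 has_real_derivative e4 t) (at t within {0..})"
    "\<And>t. t \<ge> 0 \<Longrightarrow> (e4 has_real_derivative e4' t) (at t within {0..})"
    using d34(2) unfolding C2_real_def by blast
  obtain w0 where rep0: "dom_rep X0 w0 (d3 0) (d4 0)"
    using dom_imp_rep[OF X0] by blast
  \<comment> \<open>The compatibility condition gives
    \<open>emb X0 = K v0 + E (d3 0) (d4 0)\<close>, so the remainder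
    \<open>emb X0 - E (d3 0) (d4 0)\<close> starts in the range of \<open>K\<close>.\<close>
  define v0 where "v0 = V w0"
  define G where "G = (\<lambda>t. (0, l2_of l (d1 t), 0, l2_of l (d2 t)) :: l2 \<times> l2 \<times> l2 \<times> l2)"
  \<comment> \<open>The forcing left after subtracting the lifting: \<open>P\<close> acts on it, and
    its time derivative is moved to the right-hand side.\<close>
  define F where "F = (\<lambda>t. G t + P (E (d3 t) (d4 t)) - E (e3 t) (e4 t))"
  define F' where "F' = (\<lambda>t. (0, D1 t, 0, D2 t) + P (E (e3 t) (e4 t)) - E (e3' t) (e4' t))"
  have G': "(G has_vector_derivative (0, D1 t, 0, D2 t)) (at t within {0..})" if "t \<ge> 0" for t
    unfolding G_def by (intro has_vector_derivative_Pair has_vector_derivative_const D1(3) D2(3) that)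
  have F: "(F has_vector_derivative F' t) (at t within {0..})" if t: "t \<ge> 0" for t
    unfolding F_def F'_def
    by (intro has_vector_derivative_diff has_vector_derivative_add P.has_vector_derivative
        E_has_vector_derivative G' e3 e4 t)
  have c34: "continuous_on {0..} d3" "continuous_on {0..} d4" "continuous_on {0..} e3" "continuous_on {0..} e4"
    using continuous_on_atLeast_if_derivative[of d3 e3] continuous_on_atLeast_if_derivative[of d4 e4]
      continuous_on_atLeast_if_derivative[of e3 e3'] continuous_on_atLeast_if_derivative[of e4 e4'] e3 e4
    by (simp_all add: has_real_derivative_iff_has_vector_derivative)
  have cF': "continuous_on {0..} F'"
    unfolding F'_def
    by (intro continuous_on_diff continuous_on_add continuous_on_Pair continuous_on_const D1(1) D2(1)
        P.continuous_on E_continuous_on c34 e3(1) e4(1))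
  obtain u v where uv: "u 0 = K v0" "continuous_on {0..} v" "\<And>t. t \<ge> 0 \<Longrightarrow> u t = K (v t)"
    "\<And>t. t \<ge> 0 \<Longrightarrow> (u has_vector_derivative - v t + P (u t) + F t) (at t within {0..})"
    using ev.classical_solution[OF F cF', of v0] by blast
  \<comment> \<open>The abstract \<open>v t\<close> lives on the whole line; only its part on (0,l)
    comes from states.\<close>
  have "\<forall>t. \<exists>w\<in>L4. V w = cut4 (v t)"
    using V_surj by blast
  then obtain w where V: "\<And>t. V (w t) = cut4 (v t)" and L: "\<And>t. w t \<in> L4" by metis
  have "\<forall>t. \<exists>X. dom_rep X (w t) (d3 t) (d4 t)"
    using dom_rep_exists L by blast
  then obtain X where X: "\<And>t. dom_rep (X t) (w t) (d3 t) (d4 t)" by metis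
  note R = dom_rep_imp[OF X]
  define U where "U = (\<lambda>t. cut4 (u t) + E (d3 t) (d4 t))"
  have emb: "emb (X t) = U t" if "t \<ge> 0" for t
    using R(4)[of t] uv(3)[OF that] by (simp add: U_def V cut4_K)
  have U': "(U has_vector_derivative - cut4 (v t) + P (U t) + G t) (at t within {0..})" if t: "t \<ge> 0" for t
  proof -
    have G: "cut4 (G t) = G t"
      using D1(2)[OF t] D2(2)[OF t] by (simp add: G_def cut4_def linear_0 bounded_linear.linear[OF bounded_linear_cut])
    have "(U has_vector_derivative cut4 (- v t + P (u t) + F t) + E (e3 t) (e4 t)) (at t within {0..})"
      unfolding U_def
      by (intro has_vector_derivative_add C4.has_vector_derivative uv(4) E_has_vector_derivative e3 e4 t)
    also have "cut4 (- v t + P (u t) + F t) + E (e3 t) (e4 t) = - cut4 (v t) + P (U t) + G t"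
      by (simp add: F_def U_def C4.add C4.diff linear_neg[OF bounded_linear.linear[OF bounded_linear_cut4]] cut4_P cut4_E G P.add)
    finally show ?thesis .
  qed
  have emb': "((\<lambda>t. emb (X t)) has_vector_derivative
      - V (w t) + P (emb (X t)) + (0, l2_of l (d1 t), 0, l2_of l (d2 t))) (at t within {0..})"
    if t: "t \<ge> 0" for t
  proof (rule has_vector_derivative_transform[OF _ _ ])
    show "(U has_vector_derivative
        - V (w t) + P (emb (X t)) + (0, l2_of l (d1 t), 0, l2_of l (d2 t))) (at t within {0..})"
      using U'[OF t] by (simp add: V emb[OF t] G_def)
  qed (use t emb in auto)
  note rhs = has_time_deriv_rhs_iff[of X w d3 d4 d1 _ d2, OF X D1(2) D2(2)]
  define rhs_fun where "rhs_fun = (\<lambda>t. A1 (X t) + A2 (X t) + (0, d1 t, 0, d2 t))"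
  have cU: "continuous_on {0..} U" using U' by (rule continuous_on_atLeast_if_derivative)
  have cemb: "continuous_on {0..} (\<lambda>t. emb (X t))" by (rule continuous_on_eq[OF cU]) (simp add: emb)
  \<comment> \<open>\<open>V (w t)\<close> encodes \<open>- A1 (X t)\<close>, so this is the part of
    graph norm continuity that concerns the generator.\<close>
  have cV: "continuous_on {0..} (\<lambda>t. V (w t))"
    unfolding V by (rule C4.continuous_on[OF uv(2)])
  have cG: "continuous_on {0..} G" using G' by (rule continuous_on_atLeast_if_derivative)
  have deriv: "has_time_deriv (H_norm l a1 a2) X (rhs_fun t) t" if "t \<ge> 0" for t
    unfolding rhs_fun_def using rhs(3)[OF that that that] emb'[OF that] by blast
  have rhs_H: "rhs_fun t \<in> H_space l" if "t \<ge> 0" for t unfolding rhs_fun_def by (rule rhs(1)[OF that that that])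
  have "continuous_on {0..} (\<lambda>t. emb (rhs_fun t))"
  proof (rule continuous_on_eq)
    show "continuous_on {0..} (\<lambda>t. - V (w t) + P (emb (X t)) + G t)"
      by (intro continuous_on_add continuous_on_minus cV cG P.continuous_on cemb)
    fix t :: real assume "t \<in> {0..}"
    then have t: "t \<ge> 0" by simp
    show "- V (w t) + P (emb (X t)) + G t = emb (rhs_fun t)"
      unfolding rhs_fun_def rhs(2)[OF t t t] G_def ..
  qed
  then have "rhs_fun \<in> C0_time (H_space l) (H_norm l a1 a2)"
    using seminorm_encoding.C0_time_iff[OF H_encoding, of rhs_fun] rhs_H by blast
  moreover have "X \<in> C0_time (H_space l) (H_norm l a1 a2)"
    using seminorm_encoding.C0_time_iff[OF H_encoding, of X] R(2) cemb by blast
  ultimately have C1: "X \<in> C1_time (H_space l) (H_norm l a1 a2)"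
    unfolding C1_time_def using deriv by blast
  have C0: "X \<in> C0_time DA (graph_norm l a1 a2 b1 b2)"
    unfolding C0_time_def
  proof (intro CollectI allI impI conjI R(1))
    fix t :: real assume t: "t \<ge> 0"
    have "((\<lambda>s. emb (X s)) \<longlongrightarrow> emb (X t)) (at t within {0..})"
      "((\<lambda>s. V (w s)) \<longlongrightarrow> V (w t)) (at t within {0..})"
      using cemb cV t by (auto simp: continuous_on_def)
    then have "((\<lambda>s. norm (emb (X s) - emb (X t)) +
        norm (V (w s) - V (w t))) \<longlongrightarrow> 0 + 0) (at t within {0..})"
      by (intro tendsto_add tendsto_norm_zero LIM_zero)
    then show "((\<lambda>s. graph_norm l a1 a2 b1 b2 (X s - X t)) \<longlongrightarrow> 0) (at t within {0..})"
      by (simp add: graph_norm_diff[OF X X])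
  qed
  \<comment> \<open>\<open>v0\<close> has the form \<open>V w0\<close> and is therefore fixed by
    \<open>cut4\<close>: the projection leaves the initial value unchanged.\<close>
  have "emb (X 0) = emb X0"
    using dom_rep_imp(4)[OF rep0] emb[of 0] uv(1) cut4_V[OF dom_rep_L2[OF rep0]]
    by (simp add: U_def cut4_K v0_def)
  then have "H_eq l (X 0) X0" using emb_eq_iff R(2) dom_rep_imp(2)[OF rep0] by blast
  then have "solution d1 d2 d3 d4 X0 X"
    unfolding is_solution_def using C0 C1 deriv R(3) by (simp add: rhs_fun_def)
  then show ?thesis by (rule exI[where x = X])
qed

text \<open>In the difference of two solutions the lifting and the forcing cancel, which leaves the
  homogeneous equation with zero initial value.\<close>

lemma solution_unique:
  assumes d: "d1 \<in> C1_time (L2 l) (L2_norm l)" "d2 \<in> C1_time (L2 l) (L2_norm l)"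
    and X0: "X0 \<in> DA"
    and X: "solution d1 d2 d3 d4 X0 X" and Y: "solution d1 d2 d3 d4 X0 Y" and t: "t \<ge> 0"
  shows "H_eq l (X t) (Y t)"
proof -
  interpret ev: evolution K P by (rule evolution)
  interpret P: bounded_linear P by (rule bounded_linear_P)
  interpret K: bounded_linear K by (rule bounded_linear_K)
  have dL: "d1 t \<in> L2 l" "d2 t \<in> L2 l" if "t \<ge> 0" for t
    using d that by (auto simp: C1_time_def C0_time_def)
  have rep: "\<exists>v. \<forall>t\<ge>0. emb (Z t) = K (v t) + E (d3 t) (d4 t) \<and> Z t \<in> H_space l \<and>
     ((\<lambda>t. emb (Z t)) has_vector_derivative
      - v t + P (emb (Z t)) + (0, l2_of l (d1 t), 0, l2_of l (d2 t))) (at t within {0..})"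
    and emb0: "emb (Z 0) = emb X0"
    if Z: "solution d1 d2 d3 d4 X0 Z" for Z
  proof -
    have "\<exists>w. dom_rep (Z t) w (d3 t) (d4 t)" if "t \<ge> 0" for t
    proof (rule dom_imp_rep)
      show "Z t \<in> DA" "B (Z t) = (d3 t, d4 t)"
        using Z that by (simp_all add: is_solution_def C0_time_def)
    qed
    then have "\<forall>t. \<exists>w. t \<ge> 0 \<longrightarrow> dom_rep (Z t) w (d3 t) (d4 t)" by blast
    then obtain w where R: "\<And>t. t \<ge> 0 \<Longrightarrow> dom_rep (Z t) (w t) (d3 t) (d4 t)"
      by metis
    have "((\<lambda>t. emb (Z t)) has_vector_derivative
      - V (w t) + P (emb (Z t)) + (0, l2_of l (d1 t), 0, l2_of l (d2 t))) (at t within {0..})"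
      if t: "t \<ge> 0" for t
      using has_time_deriv_rhs_iff(3)[of Z w d3 d4 d1 t d2, OF R dL[OF t] t] Z t
      unfolding is_solution_def by blast
    then show "\<exists>v. \<forall>t\<ge>0. emb (Z t) = K (v t) + E (d3 t) (d4 t) \<and> Z t \<in> H_space l \<and>
     ((\<lambda>t. emb (Z t)) has_vector_derivative
      - v t + P (emb (Z t)) + (0, l2_of l (d1 t), 0, l2_of l (d2 t))) (at t within {0..})"
      by (intro exI[of _ "\<lambda>t. V (w t)"]) (simp add: dom_rep_imp(2,4)[OF R])
    have "X0 \<in> H_space l" using X0 by (auto simp: dom_A1_def)
    moreover have "Z 0 \<in> H_space l" by (rule dom_rep_imp(2)[OF R]) simp
    moreover have "H_eq l (Z 0) X0" using Z by (simp add: is_solution_def)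
    ultimately show "emb (Z 0) = emb X0" using emb_eq_iff by blast
  qed
  obtain v where v: "\<And>t. t \<ge> 0 \<Longrightarrow> emb (X t) = K (v t) + E (d3 t) (d4 t)" "\<And>t. t \<ge> 0 \<Longrightarrow> X t \<in> H_space l"
     "\<And>t. t \<ge> 0 \<Longrightarrow> ((\<lambda>t. emb (X t)) has_vector_derivative
      - v t + P (emb (X t)) + (0, l2_of l (d1 t), 0, l2_of l (d2 t))) (at t within {0..})"
    using rep[OF X] by blast
  obtain w where w: "\<And>t. t \<ge> 0 \<Longrightarrow> emb (Y t) = K (w t) + E (d3 t) (d4 t)" "\<And>t. t \<ge> 0 \<Longrightarrow> Y t \<in> H_space l"
     "\<And>t. t \<ge> 0 \<Longrightarrow> ((\<lambda>t. emb (Y t)) has_vector_derivative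
      - w t + P (emb (Y t)) + (0, l2_of l (d1 t), 0, l2_of l (d2 t))) (at t within {0..})"
    using rep[OF Y] by blast
  have "emb (X t) - emb (Y t) = 0"
  proof (rule ev.zero_solution_unique[where v = "\<lambda>t. v t - w t" and u = "\<lambda>t. emb (X t) - emb (Y t)", OF _ _ _ t])
    show "emb (X 0) - emb (Y 0) = 0" using emb0[OF X] emb0[OF Y] by simp
    fix s :: real assume s: "s \<ge> 0"
    show "emb (X s) - emb (Y s) = K (v s - w s)" using v(1)[OF s] w(1)[OF s] by (simp add: K.diff)
    have "((\<lambda>t. emb (X t) - emb (Y t)) has_vector_derivative
        (- v s + P (emb (X s)) + (0, l2_of l (d1 s), 0, l2_of l (d2 s))) -
        (- w s + P (emb (Y s)) + (0, l2_of l (d1 s), 0, l2_of l (d2 s)))) (at s within {0..})"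
      by (intro has_vector_derivative_diff v(3) w(3) s)
    then show "((\<lambda>t. emb (X t) - emb (Y t)) has_vector_derivative - (v s - w s) + P (emb (X s) - emb (Y s))) (at s within {0..})"
      by (simp add: P.diff algebra_simps)
  qed
  then show ?thesis using emb_eq_iff v(2)[OF t] w(2)[OF t] by simp
qed

end


theorem theorem1:
  fixes l a1 a2 b1 b2 c1 c2 p1 p2 q1 q2 :: real
    and d1 d2 :: "real \<Rightarrow> real \<Rightarrow> real" and d3 d4 :: "real \<Rightarrow> real" and X0 :: state
  assumes "l > 0" "a1 > 0" "a2 > 0" "b1 > 0" "b2 > 0"
    and "c1 \<ge> 0" "c2 \<ge> 0" "p1 \<ge> 0" "p2 \<le> 0" "q1 \<le> 0" "q2 \<ge> 0"
    and "d1 \<in> C1_time (L2 l) (L2_norm l)" "d2 \<in> C1_time (L2 l) (L2_norm l)"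
    and "d3 \<in> C2_real" "d4 \<in> C2_real"
    and "X0 \<in> dom_A1 l a1 a2 b1 b2"
    and "op_B l a1 a2 b1 b2 X0 = (d3 0, d4 0)"
  shows "\<exists>X. is_solution l a1 a2 b1 b2 c1 c2 p1 p2 q1 q2 d1 d2 d3 d4 X0 X \<and>
           (\<forall>Y. is_solution l a1 a2 b1 b2 c1 c2 p1 p2 q1 q2 d1 d2 d3 d4 X0 Y \<longrightarrow>
                (\<forall>t\<ge>0. H_eq l (X t) (Y t)))"
proof -
  interpret beam_string l a1 a2 b1 b2 c1 c2 p1 p2 q1 q2
    by (rule beam_string.intro[OF assms(1-5)])
  obtain X where X: "solution d1 d2 d3 d4 X0 X"
    using solution_exists[OF assms(12-17)] by (rule exE)
  show ?thesis
  proof (intro exI[where x = X] conjI allI impI X)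
    fix Y and t :: real assume "solution d1 d2 d3 d4 X0 Y" and "t \<ge> 0"
    then show "H_eq l (X t) (Y t)" by (rule solution_unique[OF assms(12,13,16) X])
  qed
qed

end
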